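(* Let $k$ be a field of characteristic $p>0$ and $G$ a finite group scheme over $k$. For any $\pi$-point $\alpha$ of $G$, the $G$-module $\Delta_G(\alpha)$ is endofinite and there is an equality $$\mathrm{Add}(\Delta_G(\alpha))=\mathrm{Prod}(\Delta_G(\alpha)).$$
   Context: $kG=\mathrm{Hom}_k(k[G],k)$ is the group algebra of $G$, and a $G$-module is a (possibly infinite dimensional) left $kG$-module. For a field extension $K/k$, $G_K$ is the base change of $G$, with group algebra $KG=K\otimes_k kG$, and $\mathrm{res}^K_k$ is restriction from $G_K$-modules to $G$-modules. A $\pi$-point of $G$ defined over a field extension $K$ of $k$ is a $K$-algebra map $\alpha\colon K[t]/(t^p)\to KG$ that factors through the group algebra of a unipotent abelian subgroup scheme of $G_K$ and makes $KG$ flat as a left (equivalently right) $K[t]/(t^p)$-module. The point module of $\alpha$ is the $G$-module $\Delta_G(\alpha)=\mathrm{res}^K_k\,\alpha_*(K)$, where $\alpha_*(K)=KG\otimes_{K[t]/(t^p)}K$ and $t$ acts as zero on $K$. A module $M$ over a ring $A$ is endofinite if it has finite composition length as a module over its endomorphism ring $\mathrm{End}_A(M)$. $\mathrm{Add}(M)$ (resp. $\mathrm{Prod}(M)$) is the full subcategory of $A$-modules that are direct summands of direct sums (resp. of products) of copies of $M$; here $A=kG$. *)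

theory Defs
  imports "HOL-Algebra.UnivPoly" "HOL-Algebra.QuotRing" "HOL-Algebra.Free_Abelian_Groups"
begin

section \<open>Modules over a not necessarily commutative ring\<close>

text \<open>
  The library locale \<^locale>\<open>module\<close> is restricted to commutative rings.  We keep its record type
  and drop commutativity.  A module record also has the fields \<^term>\<open>monoid.mult\<close> and
  \<^term>\<open>one\<close>; they carry no information unless the module is an algebra.
\<close>

locale left_module = R?: ring R + M?: abelian_group M
  for R :: "('r, 'z) ring_scheme" (structure) and M :: "('r, 'm, 'y) module_scheme" (structure) +
  assumes lm_closed: "\<lbrakk>a \<in> carrier R; x \<in> carrier M\<rbrakk> \<Longrightarrow> a \<odot>\<^bsub>M\<^esub> x \<in> carrier M"
    and lm_l_distr: "\<lbrakk>a \<in> carrier R; b \<in> carrier R; x \<in> carrier M\<rbrakk> \<Longrightarrow>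
      (a \<oplus>\<^bsub>R\<^esub> b) \<odot>\<^bsub>M\<^esub> x = a \<odot>\<^bsub>M\<^esub> x \<oplus>\<^bsub>M\<^esub> b \<odot>\<^bsub>M\<^esub> x"
    and lm_r_distr: "\<lbrakk>a \<in> carrier R; x \<in> carrier M; y \<in> carrier M\<rbrakk> \<Longrightarrow>
      a \<odot>\<^bsub>M\<^esub> (x \<oplus>\<^bsub>M\<^esub> y) = a \<odot>\<^bsub>M\<^esub> x \<oplus>\<^bsub>M\<^esub> a \<odot>\<^bsub>M\<^esub> y"
    and lm_assoc: "\<lbrakk>a \<in> carrier R; b \<in> carrier R; x \<in> carrier M\<rbrakk> \<Longrightarrow>
      (a \<otimes>\<^bsub>R\<^esub> b) \<odot>\<^bsub>M\<^esub> x = a \<odot>\<^bsub>M\<^esub> (b \<odot>\<^bsub>M\<^esub> x)"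
    and lm_one: "x \<in> carrier M \<Longrightarrow> \<one>\<^bsub>R\<^esub> \<odot>\<^bsub>M\<^esub> x = x"

definition with_smult :: "('m, 'z) ring_scheme \<Rightarrow> ('r \<Rightarrow> 'm \<Rightarrow> 'm) \<Rightarrow> ('r, 'm) module" where
  "with_smult M s = \<lparr>carrier = carrier M, monoid.mult = monoid.mult M, one = monoid.one M,
     ring.zero = ring.zero M, ring.add = ring.add M, smult = s\<rparr>"

definition lmod_hom ::
  "('r, 'z) ring_scheme \<Rightarrow> ('r, 'm, 'x) module_scheme \<Rightarrow> ('r, 'n, 'y) module_scheme \<Rightarrow> ('m \<Rightarrow> 'n) set" where
  "lmod_hom R M N = {f \<in> hom (add_monoid M) (add_monoid N).
     \<forall>r\<in>carrier R. \<forall>x\<in>carrier M. f (r \<odot>\<^bsub>M\<^esub> x) = r \<odot>\<^bsub>N\<^esub> f x}"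

definition fin_gen :: "('r, 'z) ring_scheme \<Rightarrow> ('r, 'm, 'y) module_scheme \<Rightarrow> bool" where
  "fin_gen R M \<longleftrightarrow> (\<exists>S. finite S \<and> S \<subseteq> carrier M \<and>
     (\<forall>U. submodule U R M \<and> S \<subseteq> U \<longrightarrow> U = carrier M))"

text \<open>Existence of a composition series \<open>0 = U 0 \<subset> U 1 \<subset> \<dots> \<subset> U n = M\<close>.\<close>

definition finite_length :: "('r, 'z) ring_scheme \<Rightarrow> ('r, 'm, 'y) module_scheme \<Rightarrow> bool" where
  "finite_length R M \<longleftrightarrow> (\<exists>(n::nat) U. U 0 = {\<zero>\<^bsub>M\<^esub>} \<and> U n = carrier M \<and>
     (\<forall>i\<le>n. submodule (U i) R M) \<and>
     (\<forall>i<n. U i \<subset> U (Suc i) \<and> \<not> (\<exists>W. submodule W R M \<and> U i \<subset> W \<and> W \<subset> U (Suc i))))"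

definition End_ring :: "('r, 'z) ring_scheme \<Rightarrow> ('r, 'm, 'y) module_scheme \<Rightarrow> ('m \<Rightarrow> 'm) ring" where
  "End_ring R M = \<lparr>carrier = lmod_hom R M M \<inter> extensional (carrier M),
     monoid.mult = (\<lambda>f g. compose (carrier M) f g), one = (\<lambda>x\<in>carrier M. x),
     ring.zero = (\<lambda>x\<in>carrier M. \<zero>\<^bsub>M\<^esub>), ring.add = (\<lambda>f g. \<lambda>x\<in>carrier M. f x \<oplus>\<^bsub>M\<^esub> g x)\<rparr>"

definition endofinite :: "('r, 'z) ring_scheme \<Rightarrow> ('r, 'm, 'y) module_scheme \<Rightarrow> bool" where
  "endofinite R M \<longleftrightarrow> finite_length (End_ring R M) (with_smult M (\<lambda>f x. f x))"


section \<open>Add and Prod\<close>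

definition direct_product :: "'i set \<Rightarrow> ('r, 'm, 'y) module_scheme \<Rightarrow> ('r, 'i \<Rightarrow> 'm) module" where
  "direct_product I M = \<lparr>carrier = (\<Pi>\<^sub>E i\<in>I. carrier M),
     monoid.mult = (\<lambda>x y. \<lambda>i\<in>I. x i \<otimes>\<^bsub>M\<^esub> y i), one = (\<lambda>i\<in>I. \<one>\<^bsub>M\<^esub>),
     ring.zero = (\<lambda>i\<in>I. \<zero>\<^bsub>M\<^esub>), ring.add = (\<lambda>x y. \<lambda>i\<in>I. x i \<oplus>\<^bsub>M\<^esub> y i),
     smult = (\<lambda>r x. \<lambda>i\<in>I. r \<odot>\<^bsub>M\<^esub> x i)\<rparr>"

definition direct_sum :: "'i set \<Rightarrow> ('r, 'm, 'y) module_scheme \<Rightarrow> ('r, 'i \<Rightarrow> 'm) module" where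
  "direct_sum I M = (direct_product I M)
     \<lparr>carrier := {x \<in> \<Pi>\<^sub>E i\<in>I. carrier M. finite {i \<in> I. x i \<noteq> \<zero>\<^bsub>M\<^esub>}}\<rparr>"

definition direct_summand ::
  "('r, 'z) ring_scheme \<Rightarrow> ('r, 'n, 'x) module_scheme \<Rightarrow> ('r, 'm, 'y) module_scheme \<Rightarrow> bool" where
  "direct_summand R N S \<longleftrightarrow> (\<exists>U V f. submodule U R S \<and> submodule V R S \<and>
     U \<inter> V = {\<zero>\<^bsub>S\<^esub>} \<and> U <+>\<^bsub>S\<^esub> V = carrier S \<and>
     f \<in> lmod_hom R N S \<and> bij_betw f (carrier N) U)"

text \<open>
  HOL cannot quantify over the type of the index set.  The index type \<^typ>\<open>'n \<Rightarrow> 'm\<close> chosen here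
  is large enough: by \<open>in_AddI\<close> and \<open>in_ProdI\<close> below, a summand of a direct sum or a product
  indexed by a set of an arbitrary type belongs to \<open>Add\<close> or \<open>Prod\<close>.
\<close>

definition Add :: "('r, 'z) ring_scheme \<Rightarrow> ('r, 'm) module \<Rightarrow> ('r, 'n) module set" where
  "Add R M = {N. left_module R N \<and> (\<exists>I :: ('n \<Rightarrow> 'm) set. direct_summand R N (direct_sum I M))}"

definition Prod :: "('r, 'z) ring_scheme \<Rightarrow> ('r, 'm) module \<Rightarrow> ('r, 'n) module set" where
  "Prod R M = {N. left_module R N \<and> (\<exists>I :: ('n \<Rightarrow> 'm) set. direct_summand R N (direct_product I M))}"

lemma submodule_zero: "submodule U R S \<Longrightarrow> \<zero>\<^bsub>S\<^esub> \<in> U"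
  using subgroup.one_closed[OF submodule.axioms(1)] by simp

lemma submodule_add: "\<lbrakk>submodule U R S; x \<in> U; y \<in> U\<rbrakk> \<Longrightarrow> x \<oplus>\<^bsub>S\<^esub> y \<in> U"
  using subgroup.m_closed[OF submodule.axioms(1)] by fastforce

lemma submodule_subset: "submodule U R S \<Longrightarrow> U \<subseteq> carrier S"
  using subgroup.subset[OF submodule.axioms(1)] by simp

lemma submodule_minus: "\<lbrakk>submodule U R S; x \<in> U\<rbrakk> \<Longrightarrow> \<ominus>\<^bsub>S\<^esub> x \<in> U"
  using subgroup.m_inv_closed[OF submodule.axioms(1)] by (simp add: a_inv_def)

lemma lmod_homI:
  assumes "\<And>x. x \<in> carrier M \<Longrightarrow> f x \<in> carrier N"
    and "\<And>x y. \<lbrakk>x \<in> carrier M; y \<in> carrier M\<rbrakk> \<Longrightarrow> f (x \<oplus>\<^bsub>M\<^esub> y) = f x \<oplus>\<^bsub>N\<^esub> f y"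
    and "\<And>r x. \<lbrakk>r \<in> carrier R; x \<in> carrier M\<rbrakk> \<Longrightarrow> f (r \<odot>\<^bsub>M\<^esub> x) = r \<odot>\<^bsub>N\<^esub> f x"
  shows "f \<in> lmod_hom R M N"
  using assms by (auto simp: lmod_hom_def hom_def)

lemma lmod_homD:
  assumes "f \<in> lmod_hom R M N"
  shows "\<And>x. x \<in> carrier M \<Longrightarrow> f x \<in> carrier N"
    and "\<And>x y. \<lbrakk>x \<in> carrier M; y \<in> carrier M\<rbrakk> \<Longrightarrow> f (x \<oplus>\<^bsub>M\<^esub> y) = f x \<oplus>\<^bsub>N\<^esub> f y"
    and "\<And>r x. \<lbrakk>r \<in> carrier R; x \<in> carrier M\<rbrakk> \<Longrightarrow> f (r \<odot>\<^bsub>M\<^esub> x) = r \<odot>\<^bsub>N\<^esub> f x"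
  using assms by (auto simp: lmod_hom_def hom_def)

lemma lmod_hom_zero:
  assumes "f \<in> lmod_hom R M N" "abelian_group M" "abelian_group N"
  shows "f \<zero>\<^bsub>M\<^esub> = \<zero>\<^bsub>N\<^esub>"
proof -
  interpret M: abelian_group M by fact
  interpret N: abelian_group N by fact
  have "f \<zero>\<^bsub>M\<^esub> \<oplus>\<^bsub>N\<^esub> f \<zero>\<^bsub>M\<^esub> = f \<zero>\<^bsub>M\<^esub>"
    using lmod_homD(2)[OF assms(1), of "\<zero>\<^bsub>M\<^esub>" "\<zero>\<^bsub>M\<^esub>"] by simp
  then show ?thesis
    using lmod_homD(1)[OF assms(1)] by (metis M.zero_closed N.add.l_cancel_one)
qed

lemma lmod_hom_minus:
  assumes "f \<in> lmod_hom R M N" "abelian_group M" "abelian_group N" "x \<in> carrier M"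
  shows "f (\<ominus>\<^bsub>M\<^esub> x) = \<ominus>\<^bsub>N\<^esub> f x"
proof -
  interpret M: abelian_group M by fact
  interpret N: abelian_group N by fact
  have "f (\<ominus>\<^bsub>M\<^esub> x) \<oplus>\<^bsub>N\<^esub> f x = \<zero>\<^bsub>N\<^esub>"
    using lmod_homD(2)[OF assms(1), of "\<ominus>\<^bsub>M\<^esub> x" x] assms(4) lmod_hom_zero[OF assms(1-3)]
    by (simp add: M.l_neg)
  then show ?thesis
    using lmod_homD(1)[OF assms(1)] assms(4) by (metis M.a_inv_closed N.minus_equality)
qed

lemma direct_summand_iff_retract:
  assumes N: "left_module R N" and S: "left_module R S"
  shows "direct_summand R N S \<longleftrightarrow>
    (\<exists>f\<in>lmod_hom R N S. \<exists>g\<in>lmod_hom R S N. \<forall>x\<in>carrier N. g (f x) = x)"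
proof
  interpret N: left_module R N by fact
  interpret S: left_module R S by fact
  assume "direct_summand R N S"
  then obtain U V f where U: "submodule U R S" and V: "submodule V R S"
    and int: "U \<inter> V = {\<zero>\<^bsub>S\<^esub>}" and sum: "U <+>\<^bsub>S\<^esub> V = carrier S"
    and f: "f \<in> lmod_hom R N S" and bij: "bij_betw f (carrier N) U"
    unfolding direct_summand_def by blast
  define g where "g s = (THE x. x \<in> carrier N \<and> (\<exists>v\<in>V. s = f x \<oplus>\<^bsub>S\<^esub> v))" for s
  note fc = lmod_homD(1)[OF f]
  note Vc = subsetD[OF submodule_subset[OF V]]
  have g: "g (f x \<oplus>\<^bsub>S\<^esub> v) = x" if x: "x \<in> carrier N" and v: "v \<in> V" for x v
    unfolding g_def
  proof (rule the_equality)
    show "x \<in> carrier N \<and> (\<exists>w\<in>V. f x \<oplus>\<^bsub>S\<^esub> v = f x \<oplus>\<^bsub>S\<^esub> w)" using x v by blast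
    fix y assume "y \<in> carrier N \<and> (\<exists>w\<in>V. f x \<oplus>\<^bsub>S\<^esub> v = f y \<oplus>\<^bsub>S\<^esub> w)"
    then obtain w where y: "y \<in> carrier N" and w: "w \<in> V"
      and eq: "f x \<oplus>\<^bsub>S\<^esub> v = f y \<oplus>\<^bsub>S\<^esub> w" by blast
    have mf: "\<ominus>\<^bsub>S\<^esub> f y \<oplus>\<^bsub>S\<^esub> f x \<in> U"
      using bij x y submodule_add[OF U] submodule_minus[OF U] by (meson bij_betwE)
    have "\<ominus>\<^bsub>S\<^esub> f y \<oplus>\<^bsub>S\<^esub> f x = w \<oplus>\<^bsub>S\<^esub> \<ominus>\<^bsub>S\<^esub> v"
    proof -
      have "\<ominus>\<^bsub>S\<^esub> f y \<oplus>\<^bsub>S\<^esub> f x = \<ominus>\<^bsub>S\<^esub> f y \<oplus>\<^bsub>S\<^esub> (f x \<oplus>\<^bsub>S\<^esub> v) \<oplus>\<^bsub>S\<^esub> \<ominus>\<^bsub>S\<^esub> v"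
        using fc x y Vc[OF v] by (simp add: S.a_assoc S.r_neg)
      also have "\<dots> = w \<oplus>\<^bsub>S\<^esub> \<ominus>\<^bsub>S\<^esub> v"
        unfolding eq using fc x y Vc[OF v] Vc[OF w] by (simp add: S.a_assoc[symmetric] S.l_neg)
      finally show ?thesis .
    qed
    then have "\<ominus>\<^bsub>S\<^esub> f y \<oplus>\<^bsub>S\<^esub> f x \<in> V"
      using submodule_add[OF V w] submodule_minus[OF V v] by simp
    then have "\<ominus>\<^bsub>S\<^esub> f y \<oplus>\<^bsub>S\<^esub> f x = \<zero>\<^bsub>S\<^esub>" using mf int by blast
    then have "f x = f y"
      using fc x y by (metis S.add.inv_closed S.minus_equality S.minus_minus S.a_comm)
    then show "y = x" using bij x y by (metis bij_betw_inv_into_left)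
  qed
  have decomp: "\<exists>x\<in>carrier N. \<exists>v\<in>V. s = f x \<oplus>\<^bsub>S\<^esub> v" if "s \<in> carrier S" for s
  proof -
    have "s \<in> U <+>\<^bsub>S\<^esub> V" using sum that by simp
    then obtain u v where "u \<in> U" "v \<in> V" "s = u \<oplus>\<^bsub>S\<^esub> v"
      unfolding set_add_def set_mult_def by auto
    moreover have "u \<in> f ` carrier N" using bij \<open>u \<in> U\<close> by (simp add: bij_betw_def)
    ultimately show ?thesis by blast
  qed
  have "g \<in> lmod_hom R S N"
  proof (rule lmod_homI)
    fix s assume "s \<in> carrier S"
    with decomp g show "g s \<in> carrier N" by metis
  next
    fix s t assume "s \<in> carrier S" "t \<in> carrier S"
    then obtain x v y w where *: "x \<in> carrier N" "v \<in> V" "s = f x \<oplus>\<^bsub>S\<^esub> v"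
      "y \<in> carrier N" "w \<in> V" "t = f y \<oplus>\<^bsub>S\<^esub> w"
      using decomp by metis
    have "s \<oplus>\<^bsub>S\<^esub> t = f (x \<oplus>\<^bsub>N\<^esub> y) \<oplus>\<^bsub>S\<^esub> (v \<oplus>\<^bsub>S\<^esub> w)"
      using * fc Vc lmod_homD(2)[OF f] by (simp add: S.a_ac)
    then show "g (s \<oplus>\<^bsub>S\<^esub> t) = g s \<oplus>\<^bsub>N\<^esub> g t"
      using * g submodule_add[OF V] by simp
  next
    fix r s assume r: "r \<in> carrier R" and "s \<in> carrier S"
    then obtain x v where *: "x \<in> carrier N" "v \<in> V" "s = f x \<oplus>\<^bsub>S\<^esub> v"
      using decomp by metis
    have "r \<odot>\<^bsub>S\<^esub> s = f (r \<odot>\<^bsub>N\<^esub> x) \<oplus>\<^bsub>S\<^esub> r \<odot>\<^bsub>S\<^esub> v"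
      using * r fc Vc lmod_homD(3)[OF f] by (simp add: S.lm_r_distr)
    then show "g (r \<odot>\<^bsub>S\<^esub> s) = r \<odot>\<^bsub>N\<^esub> g s"
      using * r g N.lm_closed submodule.smult_closed[OF V] by simp
  qed
  moreover have "g (f x) = x" if "x \<in> carrier N" for x
    using g[OF that submodule_zero[OF V]] fc that by simp
  ultimately show "\<exists>f\<in>lmod_hom R N S. \<exists>g\<in>lmod_hom R S N. \<forall>x\<in>carrier N. g (f x) = x"
    using f by blast
next
  interpret N: left_module R N by fact
  interpret S: left_module R S by fact
  assume "\<exists>f\<in>lmod_hom R N S. \<exists>g\<in>lmod_hom R S N. \<forall>x\<in>carrier N. g (f x) = x"
  then obtain f g where f: "f \<in> lmod_hom R N S" and g: "g \<in> lmod_hom R S N"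
    and gf: "\<And>x. x \<in> carrier N \<Longrightarrow> g (f x) = x" by blast
  note fD = lmod_homD[OF f] and gD = lmod_homD[OF g]
  note f0 = lmod_hom_zero[OF f N.abelian_group_axioms S.abelian_group_axioms]
  note g0 = lmod_hom_zero[OF g S.abelian_group_axioms N.abelian_group_axioms]
  note fm = lmod_hom_minus[OF f N.abelian_group_axioms S.abelian_group_axioms]
  note gm = lmod_hom_minus[OF g S.abelian_group_axioms N.abelian_group_axioms]
  define U where "U = f ` carrier N"
  define V where "V = {s \<in> carrier S. g s = \<zero>\<^bsub>N\<^esub>}"
  have U: "submodule U R S"
  proof (intro submodule.intro subgroup.intro submodule_axioms.intro)
    show "U \<subseteq> carrier (add_monoid S)" using fD(1) by (auto simp: U_def)
    show "x \<otimes>\<^bsub>add_monoid S\<^esub> y \<in> U" if xy: "x \<in> U" "y \<in> U" for x y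
    proof -
      obtain a b where ab: "a \<in> carrier N" "b \<in> carrier N" "x = f a" "y = f b"
        using xy by (auto simp: U_def)
      then have "x \<oplus>\<^bsub>S\<^esub> y = f (a \<oplus>\<^bsub>N\<^esub> b)" using fD(2) by simp
      then show ?thesis using ab by (auto simp: U_def)
    qed
    show "\<one>\<^bsub>add_monoid S\<^esub> \<in> U" using f0 by (force simp: U_def)
    show "inv\<^bsub>add_monoid S\<^esub> x \<in> U" if x: "x \<in> U" for x
    proof -
      obtain y where y: "y \<in> carrier N" "x = f y" using x by (auto simp: U_def)
      have "\<ominus>\<^bsub>S\<^esub> x = f (\<ominus>\<^bsub>N\<^esub> y)" using fm y by simp
      then show ?thesis using y by (auto simp: U_def a_inv_def[symmetric])
    qed
    show "r \<odot>\<^bsub>S\<^esub> x \<in> U" if r: "r \<in> carrier R" and x: "x \<in> U" for r x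
    proof -
      obtain y where y: "y \<in> carrier N" "x = f y" using x by (auto simp: U_def)
      have "r \<odot>\<^bsub>S\<^esub> x = f (r \<odot>\<^bsub>N\<^esub> y)" using fD(3) y r by simp
      then show ?thesis using y N.lm_closed[OF r] by (auto simp: U_def)
    qed
  qed
  have V: "submodule V R S"
  proof (intro submodule.intro subgroup.intro submodule_axioms.intro)
    show "V \<subseteq> carrier (add_monoid S)" by (auto simp: V_def)
    show "x \<otimes>\<^bsub>add_monoid S\<^esub> y \<in> V" if "x \<in> V" "y \<in> V" for x y
      using that gD(2) by (auto simp: V_def)
    show "\<one>\<^bsub>add_monoid S\<^esub> \<in> V" using g0 by (auto simp: V_def)
    show "inv\<^bsub>add_monoid S\<^esub> x \<in> V" if "x \<in> V" for x
      using that gm by (auto simp: V_def a_inv_def[symmetric])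
    show "r \<odot>\<^bsub>S\<^esub> x \<in> V" if "r \<in> carrier R" "x \<in> V" for r x
    proof -
      have "r \<odot>\<^bsub>N\<^esub> \<zero>\<^bsub>N\<^esub> \<oplus>\<^bsub>N\<^esub> r \<odot>\<^bsub>N\<^esub> \<zero>\<^bsub>N\<^esub> = r \<odot>\<^bsub>N\<^esub> \<zero>\<^bsub>N\<^esub>"
        using N.lm_r_distr[of r "\<zero>\<^bsub>N\<^esub>" "\<zero>\<^bsub>N\<^esub>"] that by simp
      then have "r \<odot>\<^bsub>N\<^esub> \<zero>\<^bsub>N\<^esub> = \<zero>\<^bsub>N\<^esub>"
        using N.lm_closed that by (metis N.M.zero_closed N.M.add.l_cancel_one)
      then show ?thesis using that gD(3) S.lm_closed by (auto simp: V_def)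
    qed
  qed
  have "U \<inter> V = {\<zero>\<^bsub>S\<^esub>}"
  proof
    show "U \<inter> V \<subseteq> {\<zero>\<^bsub>S\<^esub>}"
    proof
      fix s assume "s \<in> U \<inter> V"
      then obtain x where "x \<in> carrier N" "s = f x" "g s = \<zero>\<^bsub>N\<^esub>" unfolding U_def V_def by blast
      then show "s \<in> {\<zero>\<^bsub>S\<^esub>}" using gf[of x] f0 by simp
    qed
    show "{\<zero>\<^bsub>S\<^esub>} \<subseteq> U \<inter> V" using submodule_zero[OF U] submodule_zero[OF V] by blast
  qed
  moreover have "U <+>\<^bsub>S\<^esub> V = carrier S"
  proof
    show "U <+>\<^bsub>S\<^esub> V \<subseteq> carrier S"
    proof
      fix s assume "s \<in> U <+>\<^bsub>S\<^esub> V"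
      then obtain u v where "u \<in> U" "v \<in> V" "s = u \<oplus>\<^bsub>S\<^esub> v"
        unfolding set_add_def set_mult_def by auto
      then show "s \<in> carrier S"
        using subsetD[OF submodule_subset[OF U]] subsetD[OF submodule_subset[OF V]] by simp
    qed
    show "carrier S \<subseteq> U <+>\<^bsub>S\<^esub> V"
    proof
      fix s assume s: "s \<in> carrier S"
      have gs: "g s \<in> carrier N" using gD(1) s by blast
      have "f (g s) \<in> U" using gs by (auto simp: U_def)
      moreover have "\<ominus>\<^bsub>S\<^esub> f (g s) \<oplus>\<^bsub>S\<^esub> s \<in> V"
      proof -
        have fg: "f (g s) \<in> carrier S" using gs fD(1) by blast
        have "g (\<ominus>\<^bsub>S\<^esub> f (g s) \<oplus>\<^bsub>S\<^esub> s) = \<ominus>\<^bsub>N\<^esub> g (f (g s)) \<oplus>\<^bsub>N\<^esub> g s"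
          using gD(2)[OF S.M.a_inv_closed[OF fg] s] gm[OF fg] by simp
        also have "\<dots> = \<zero>\<^bsub>N\<^esub>" unfolding gf[OF gs] using gs by (rule N.M.l_neg)
        finally show ?thesis using fg s by (simp add: V_def)
      qed
      moreover have "s = f (g s) \<oplus>\<^bsub>S\<^esub> (\<ominus>\<^bsub>S\<^esub> f (g s) \<oplus>\<^bsub>S\<^esub> s)"
        using s fD(1)[OF gs] by (simp add: S.M.a_assoc[symmetric] S.M.r_neg)
      ultimately show "s \<in> U <+>\<^bsub>S\<^esub> V"
        unfolding set_add_def set_mult_def by auto
    qed
  qed
  moreover have "bij_betw f (carrier N) U"
    unfolding bij_betw_def U_def using inj_on_inverseI[of "carrier N" g f] gf by simp
  ultimately show "direct_summand R N S"
    unfolding direct_summand_def using U V f by blast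
qed

text \<open>\<open>fin = True\<close> is the direct sum, \<open>fin = False\<close> the direct product.\<close>

definition direct_power :: "bool \<Rightarrow> 'i set \<Rightarrow> ('r, 'm, 'y) module_scheme \<Rightarrow> ('r, 'i \<Rightarrow> 'm) module" where
  "direct_power fin I M = (if fin then direct_sum I M else direct_product I M)"

lemma direct_power_simps:
  "carrier (direct_power fin I M) = {x \<in> \<Pi>\<^sub>E i\<in>I. carrier M. fin \<longrightarrow> finite {i \<in> I. x i \<noteq> \<zero>\<^bsub>M\<^esub>}}"
  "x \<oplus>\<^bsub>direct_power fin I M\<^esub> y = (\<lambda>i\<in>I. x i \<oplus>\<^bsub>M\<^esub> y i)"
  "\<zero>\<^bsub>direct_power fin I M\<^esub> = (\<lambda>i\<in>I. \<zero>\<^bsub>M\<^esub>)"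
  "r \<odot>\<^bsub>direct_power fin I M\<^esub> x = (\<lambda>i\<in>I. r \<odot>\<^bsub>M\<^esub> x i)"
  by (auto simp: direct_power_def direct_sum_def direct_product_def)

lemma left_module_smult_zero:
  assumes "left_module R M" "r \<in> carrier R"
  shows "r \<odot>\<^bsub>M\<^esub> \<zero>\<^bsub>M\<^esub> = \<zero>\<^bsub>M\<^esub>"
proof -
  interpret left_module R M by fact
  have "r \<odot>\<^bsub>M\<^esub> \<zero>\<^bsub>M\<^esub> \<oplus>\<^bsub>M\<^esub> r \<odot>\<^bsub>M\<^esub> \<zero>\<^bsub>M\<^esub> = r \<odot>\<^bsub>M\<^esub> \<zero>\<^bsub>M\<^esub>"
    using lm_r_distr[of r "\<zero>\<^bsub>M\<^esub>" "\<zero>\<^bsub>M\<^esub>"] assms by simp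
  then show ?thesis
    using lm_closed assms by (metis M.zero_closed M.add.l_cancel_one)
qed

lemma left_module_direct_power:
  assumes M: "left_module R M"
  shows "left_module R (direct_power fin I M)"
proof -
  interpret left_module R M by fact
  let ?P = "direct_power fin I M"
  have add: "x \<oplus>\<^bsub>?P\<^esub> y \<in> carrier ?P" if "x \<in> carrier ?P" "y \<in> carrier ?P" for x y
  proof -
    have "finite {i \<in> I. x i \<oplus>\<^bsub>M\<^esub> y i \<noteq> \<zero>\<^bsub>M\<^esub>}" if fin
      by (rule finite_subset[of _ "{i \<in> I. x i \<noteq> \<zero>\<^bsub>M\<^esub>} \<union> {i \<in> I. y i \<noteq> \<zero>\<^bsub>M\<^esub>}"])
        (use \<open>x \<in> carrier ?P\<close> \<open>y \<in> carrier ?P\<close> that in \<open>auto simp: direct_power_simps\<close>)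
    moreover have "{i \<in> I. (\<lambda>i\<in>I. x i \<oplus>\<^bsub>M\<^esub> y i) i \<noteq> \<zero>\<^bsub>M\<^esub>} = {i \<in> I. x i \<oplus>\<^bsub>M\<^esub> y i \<noteq> \<zero>\<^bsub>M\<^esub>}"
      by auto
    ultimately show ?thesis using that by (auto simp: direct_power_simps PiE_iff)
  qed
  have smult: "r \<odot>\<^bsub>?P\<^esub> x \<in> carrier ?P" if "r \<in> carrier R" "x \<in> carrier ?P" for r x
  proof -
    have "finite {i \<in> I. r \<odot>\<^bsub>M\<^esub> x i \<noteq> \<zero>\<^bsub>M\<^esub>}" if fin
      by (rule finite_subset[of _ "{i \<in> I. x i \<noteq> \<zero>\<^bsub>M\<^esub>}"])
        (use \<open>x \<in> carrier ?P\<close> \<open>r \<in> carrier R\<close> that left_module_smult_zero[OF M]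
         in \<open>auto simp: direct_power_simps\<close>)
    moreover have "{i \<in> I. (\<lambda>i\<in>I. r \<odot>\<^bsub>M\<^esub> x i) i \<noteq> \<zero>\<^bsub>M\<^esub>} = {i \<in> I. r \<odot>\<^bsub>M\<^esub> x i \<noteq> \<zero>\<^bsub>M\<^esub>}"
      by auto
    ultimately show ?thesis using that lm_closed by (auto simp: direct_power_simps PiE_iff)
  qed
  have minus: "(\<lambda>i\<in>I. \<ominus>\<^bsub>M\<^esub> x i) \<in> carrier ?P" if "x \<in> carrier ?P" for x
  proof -
    have "finite {i \<in> I. \<ominus>\<^bsub>M\<^esub> x i \<noteq> \<zero>\<^bsub>M\<^esub>}" if fin
      by (rule finite_subset[of _ "{i \<in> I. x i \<noteq> \<zero>\<^bsub>M\<^esub>}"])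
        (use \<open>x \<in> carrier ?P\<close> that in \<open>auto simp: direct_power_simps\<close>)
    moreover have "{i \<in> I. (\<lambda>i\<in>I. \<ominus>\<^bsub>M\<^esub> x i) i \<noteq> \<zero>\<^bsub>M\<^esub>} = {i \<in> I. \<ominus>\<^bsub>M\<^esub> x i \<noteq> \<zero>\<^bsub>M\<^esub>}"
      by auto
    ultimately show ?thesis using that by (auto simp: direct_power_simps PiE_iff)
  qed
  have ext: "x = y" if "x \<in> carrier ?P" "y \<in> carrier ?P" "\<And>i. i \<in> I \<Longrightarrow> x i = y i" for x y
    using that by (auto simp: direct_power_simps intro: PiE_ext)
  have mem: "x i \<in> carrier M" if "x \<in> carrier ?P" "i \<in> I" for x i
    using that by (auto simp: direct_power_simps)
  have zero: "\<zero>\<^bsub>?P\<^esub> \<in> carrier ?P"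
  proof -
    have "{i \<in> I. (\<lambda>i\<in>I. \<zero>\<^bsub>M\<^esub>) i \<noteq> \<zero>\<^bsub>M\<^esub>} = {}" by auto
    then show ?thesis by (auto simp: direct_power_simps)
  qed
  have grp: "abelian_group ?P"
  proof (rule abelian_groupI)
    fix x y z assume "x \<in> carrier ?P" "y \<in> carrier ?P" "z \<in> carrier ?P"
    then show "x \<oplus>\<^bsub>?P\<^esub> y \<oplus>\<^bsub>?P\<^esub> z = x \<oplus>\<^bsub>?P\<^esub> (y \<oplus>\<^bsub>?P\<^esub> z)"
      by (intro ext add) (auto simp: direct_power_simps(2) M.a_assoc mem)
  next
    fix x y assume "x \<in> carrier ?P" "y \<in> carrier ?P"
    then show "x \<oplus>\<^bsub>?P\<^esub> y = y \<oplus>\<^bsub>?P\<^esub> x"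
      by (intro ext add) (auto simp: direct_power_simps(2) M.a_comm mem)
  next
    fix x assume x: "x \<in> carrier ?P"
    then show "\<zero>\<^bsub>?P\<^esub> \<oplus>\<^bsub>?P\<^esub> x = x"
      by (intro ext add zero) (auto simp: direct_power_simps(2,3) mem)
    have "(\<lambda>i\<in>I. \<ominus>\<^bsub>M\<^esub> x i) \<oplus>\<^bsub>?P\<^esub> x = \<zero>\<^bsub>?P\<^esub>"
      using x by (intro ext add zero minus) (auto simp: direct_power_simps(2,3) mem M.l_neg)
    then show "\<exists>y\<in>carrier ?P. y \<oplus>\<^bsub>?P\<^esub> x = \<zero>\<^bsub>?P\<^esub>" using minus[OF x] by blast
  qed (use add zero in auto)
  show ?thesis
  proof (intro left_module.intro left_module_axioms.intro)
    show "ring R" by (rule R.ring_axioms)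
    show "abelian_group ?P" by (rule grp)
    show "r \<odot>\<^bsub>?P\<^esub> x \<in> carrier ?P" if "r \<in> carrier R" "x \<in> carrier ?P" for r x
      using smult that .
    show "(a \<oplus>\<^bsub>R\<^esub> b) \<odot>\<^bsub>?P\<^esub> x = a \<odot>\<^bsub>?P\<^esub> x \<oplus>\<^bsub>?P\<^esub> b \<odot>\<^bsub>?P\<^esub> x"
      if "a \<in> carrier R" "b \<in> carrier R" "x \<in> carrier ?P" for a b x
      using that by (intro ext add smult) (auto simp: direct_power_simps(2,4) lm_l_distr mem)
    show "a \<odot>\<^bsub>?P\<^esub> (x \<oplus>\<^bsub>?P\<^esub> y) = a \<odot>\<^bsub>?P\<^esub> x \<oplus>\<^bsub>?P\<^esub> a \<odot>\<^bsub>?P\<^esub> y"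
      if "a \<in> carrier R" "x \<in> carrier ?P" "y \<in> carrier ?P" for a x y
      using that by (intro ext add smult) (auto simp: direct_power_simps(2,4) lm_r_distr mem)
    show "(a \<otimes>\<^bsub>R\<^esub> b) \<odot>\<^bsub>?P\<^esub> x = a \<odot>\<^bsub>?P\<^esub> (b \<odot>\<^bsub>?P\<^esub> x)"
      if "a \<in> carrier R" "b \<in> carrier R" "x \<in> carrier ?P" for a b x
      using that by (intro ext smult) (auto simp: direct_power_simps(4) lm_assoc mem)
    show "\<one>\<^bsub>R\<^esub> \<odot>\<^bsub>?P\<^esub> x = x" if "x \<in> carrier ?P" for x
      using that by (intro ext smult) (auto simp: direct_power_simps(4) lm_one mem)
  qed
qed

lemma direct_power_reindex:
  fixes M :: "('r, 'm, 'y) module_scheme" and N :: "('r, 'n, 'x) module_scheme" and I :: "'i set"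
  assumes M: "left_module R M" and N: "left_module R N"
    and sub: "direct_summand R N (direct_power fin I M)"
  shows "\<exists>J :: ('n \<Rightarrow> 'm) set. direct_summand R N (direct_power fin J M)"
proof -
  interpret M: left_module R M by fact
  interpret N: left_module R N by fact
  let ?P = "direct_power fin I M"
  obtain f g where f: "f \<in> lmod_hom R N ?P" and g: "g \<in> lmod_hom R ?P N"
    and gf: "\<And>x. x \<in> carrier N \<Longrightarrow> g (f x) = x"
    using sub unfolding direct_summand_iff_retract[OF N left_module_direct_power[OF M]] by blast
  note fD = lmod_homD[OF f] and gD = lmod_homD[OF g]
  define c where "c i = (\<lambda>x\<in>carrier N. f x i)" for i
  define J where "J = c ` I - {\<lambda>x\<in>carrier N. \<zero>\<^bsub>M\<^esub>}"
  let ?Q = "direct_power fin J M"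
  have fmem: "f x i \<in> carrier M" if "x \<in> carrier N" "i \<in> I" for x i
    using fD(1)[OF that(1)] that(2) by (auto simp: direct_power_simps)
  define f' where "f' x = (\<lambda>j\<in>J. j x)" for x
  define D where "D y = (\<lambda>i\<in>I. if c i \<in> J then y (c i) else \<zero>\<^bsub>M\<^esub>)" for y
  have f'c: "f' x \<in> carrier ?Q" if x: "x \<in> carrier N" for x
  proof -
    have "finite {j \<in> J. f' x j \<noteq> \<zero>\<^bsub>M\<^esub>}" if fin
    proof (rule finite_subset)
      show "{j \<in> J. f' x j \<noteq> \<zero>\<^bsub>M\<^esub>} \<subseteq> c ` {i \<in> I. f x i \<noteq> \<zero>\<^bsub>M\<^esub>}"
        using x by (auto simp: J_def f'_def c_def)
      show "finite (c ` {i \<in> I. f x i \<noteq> \<zero>\<^bsub>M\<^esub>})"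
        using fD(1)[OF x] that by (auto simp: direct_power_simps)
    qed
    moreover have "f' x \<in> (\<Pi>\<^sub>E j\<in>J. carrier M)"
      using x fmem by (auto simp: f'_def J_def c_def)
    ultimately show ?thesis by (simp add: direct_power_simps)
  qed
  have f': "f' \<in> lmod_hom R N ?Q"
  proof (rule lmod_homI)
    show "f' (x \<oplus>\<^bsub>N\<^esub> y) = f' x \<oplus>\<^bsub>?Q\<^esub> f' y" if "x \<in> carrier N" "y \<in> carrier N" for x y
      unfolding direct_power_simps f'_def
    proof (rule restrict_ext)
      fix j assume "j \<in> J"
      then obtain i where i: "i \<in> I" "j = c i" unfolding J_def by blast
      have j: "j z = f z i" if "z \<in> carrier N" for z using that i(2) by (simp add: c_def)
      have "f (x \<oplus>\<^bsub>N\<^esub> y) i = f x i \<oplus>\<^bsub>M\<^esub> f y i"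
        using fD(2)[OF that] i(1) by (simp add: direct_power_simps(2))
      then show "j (x \<oplus>\<^bsub>N\<^esub> y) = (\<lambda>j\<in>J. j x) j \<oplus>\<^bsub>M\<^esub> (\<lambda>j\<in>J. j y) j"
        using that \<open>j \<in> J\<close> j by simp
    qed
    show "f' (r \<odot>\<^bsub>N\<^esub> x) = r \<odot>\<^bsub>?Q\<^esub> f' x" if "r \<in> carrier R" "x \<in> carrier N" for r x
      unfolding direct_power_simps f'_def
    proof (rule restrict_ext)
      fix j assume "j \<in> J"
      then obtain i where i: "i \<in> I" "j = c i" unfolding J_def by blast
      have j: "j z = f z i" if "z \<in> carrier N" for z using that i(2) by (simp add: c_def)
      have "f (r \<odot>\<^bsub>N\<^esub> x) i = r \<odot>\<^bsub>M\<^esub> f x i"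
        using fD(3)[OF that] i(1) by (simp add: direct_power_simps(4))
      then show "j (r \<odot>\<^bsub>N\<^esub> x) = r \<odot>\<^bsub>M\<^esub> (\<lambda>j\<in>J. j x) j"
        using that \<open>j \<in> J\<close> j N.lm_closed[OF that] by simp
    qed
  qed (rule f'c)
  have fin_fibre: "finite {i \<in> I. c i = j}" if fin "j \<in> J" for j
  proof -
    obtain i where i: "i \<in> I" "j = c i" and "c i \<noteq> (\<lambda>x\<in>carrier N. \<zero>\<^bsub>M\<^esub>)"
      using \<open>j \<in> J\<close> by (auto simp: J_def)
    then obtain x where x: "x \<in> carrier N" "f x i \<noteq> \<zero>\<^bsub>M\<^esub>"
      unfolding c_def by (metis restrict_ext)
    show ?thesis
    proof (rule finite_subset)
      show "{i \<in> I. c i = j} \<subseteq> {i \<in> I. f x i \<noteq> \<zero>\<^bsub>M\<^esub>}"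
      proof safe
        fix i' assume "i' \<in> I" "j = c i'" "f x i' = \<zero>\<^bsub>M\<^esub>"
        then show False using i x by (metis c_def restrict_apply')
      qed
      show "finite {i \<in> I. f x i \<noteq> \<zero>\<^bsub>M\<^esub>}"
        using fD(1)[OF x(1)] \<open>fin\<close> by (auto simp: direct_power_simps)
    qed
  qed
  have D: "D \<in> lmod_hom R ?Q ?P"
  proof (rule lmod_homI)
    fix y assume y: "y \<in> carrier ?Q"
    have "finite {i \<in> I. D y i \<noteq> \<zero>\<^bsub>M\<^esub>}" if fin
    proof (rule finite_subset)
      show "{i \<in> I. D y i \<noteq> \<zero>\<^bsub>M\<^esub>} \<subseteq> (\<Union>j\<in>{j \<in> J. y j \<noteq> \<zero>\<^bsub>M\<^esub>}. {i \<in> I. c i = j})"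
        by (auto simp: D_def split: if_splits)
      show "finite (\<Union>j\<in>{j \<in> J. y j \<noteq> \<zero>\<^bsub>M\<^esub>}. {i \<in> I. c i = j})"
        using y fin_fibre that by (intro finite_UN_I) (auto simp: direct_power_simps)
    qed
    moreover have "D y \<in> (\<Pi>\<^sub>E i\<in>I. carrier M)"
      using y by (auto simp: D_def direct_power_simps)
    ultimately show "D y \<in> carrier ?P" by (simp add: direct_power_simps)
  next
    show "D (x \<oplus>\<^bsub>?Q\<^esub> y) = D x \<oplus>\<^bsub>?P\<^esub> D y" if "x \<in> carrier ?Q" "y \<in> carrier ?Q" for x y
      using that by (auto simp: D_def direct_power_simps intro!: restrict_ext)
    show "D (r \<odot>\<^bsub>?Q\<^esub> x) = r \<odot>\<^bsub>?P\<^esub> D x" if "r \<in> carrier R" "x \<in> carrier ?Q" for r x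
      using that left_module_smult_zero[OF M]
      by (auto simp: D_def direct_power_simps intro!: restrict_ext)
  qed
  have "D (f' x) = f x" if x: "x \<in> carrier N" for x
  proof (rule PiE_ext)
    show "D (f' x) \<in> (\<Pi>\<^sub>E i\<in>I. carrier M)" "f x \<in> (\<Pi>\<^sub>E i\<in>I. carrier M)"
      using lmod_homD(1)[OF D f'c[OF x]] fD(1)[OF x] by (auto simp: direct_power_simps)
    fix i assume i: "i \<in> I"
    show "D (f' x) i = f x i"
    proof (cases "c i \<in> J")
      case True
      then show ?thesis using i x by (simp add: D_def f'_def) (simp add: c_def)
    next
      case False
      then have "c i = (\<lambda>x\<in>carrier N. \<zero>\<^bsub>M\<^esub>)" using i by (auto simp: J_def)
      then have "f x i = \<zero>\<^bsub>M\<^esub>" using x unfolding c_def by (metis restrict_apply')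
      then show ?thesis using i False by (simp add: D_def)
    qed
  qed
  then have "\<forall>x\<in>carrier N. (g \<circ> D) (f' x) = x" using gf by simp
  moreover have "g \<circ> D \<in> lmod_hom R ?Q N"
    by (rule lmod_homI) (simp_all add: lmod_homD[OF D] gD)
  ultimately have "direct_summand R N ?Q"
    using direct_summand_iff_retract[OF N left_module_direct_power[OF M], of fin J] f' by metis
  then show ?thesis by blast
qed

lemma in_AddI:
  assumes "left_module R M" "left_module R N" "direct_summand R N (direct_sum I M)"
  shows "N \<in> Add R M"
  using direct_power_reindex[OF assms(1,2), of True I] assms by (auto simp: Add_def direct_power_def)

lemma in_ProdI:
  assumes "left_module R M" "left_module R N" "direct_summand R N (direct_product I M)"
  shows "N \<in> Prod R M"
  using direct_power_reindex[OF assms(1,2), of False I] assms by (auto simp: Prod_def direct_power_def)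

section \<open>Tensor products over a commutative ring\<close>

text \<open>
  \<open>M \<otimes>\<^sub>R N\<close> is the free abelian group on pairs modulo the subgroup generated by the
  bilinearity relations.
\<close>

type_synonym ('m, 'n) tens = "('m \<times> 'n \<Rightarrow>\<^sub>0 int) set"

definition tensor_null ::
  "('r, 'z) ring_scheme \<Rightarrow> ('r, 'm, 'x) module_scheme \<Rightarrow> ('r, 'n, 'y) module_scheme \<Rightarrow> ('m, 'n) tens" where
  "tensor_null R M N = generate (free_Abelian_group (carrier M \<times> carrier N))
    ({frag_of (x \<oplus>\<^bsub>M\<^esub> x', y) - frag_of (x, y) - frag_of (x', y) | x x' y.
        x \<in> carrier M \<and> x' \<in> carrier M \<and> y \<in> carrier N} \<union>
     {frag_of (x, y \<oplus>\<^bsub>N\<^esub> y') - frag_of (x, y) - frag_of (x, y') | x y y'.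
        x \<in> carrier M \<and> y \<in> carrier N \<and> y' \<in> carrier N} \<union>
     {frag_of (r \<odot>\<^bsub>M\<^esub> x, y) - frag_of (x, r \<odot>\<^bsub>N\<^esub> y) | r x y.
        r \<in> carrier R \<and> x \<in> carrier M \<and> y \<in> carrier N})"

definition tensor_group ::
  "('r, 'z) ring_scheme \<Rightarrow> ('r, 'm, 'x) module_scheme \<Rightarrow> ('r, 'n, 'y) module_scheme \<Rightarrow>
   ('m, 'n) tens monoid" where
  "tensor_group R M N = free_Abelian_group (carrier M \<times> carrier N) Mod tensor_null R M N"

definition pure ::
  "('r, 'z) ring_scheme \<Rightarrow> ('r, 'm, 'x) module_scheme \<Rightarrow> ('r, 'n, 'y) module_scheme \<Rightarrow>
   'm \<Rightarrow> 'n \<Rightarrow> ('m, 'n) tens" where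
  "pure R M N x y = tensor_null R M N #>\<^bsub>free_Abelian_group (carrier M \<times> carrier N)\<^esub> frag_of (x, y)"

text \<open>
  The additive map from the tensor product to the abelian group \<open>P\<close> (written multiplicatively)
  induced by \<open>f\<close>.  It is evaluated on an arbitrary representative and is therefore
  meaningful only if \<open>f\<close> is balanced (see \<open>tensor_lift_pure\<close> below).
\<close>

definition tensor_lift ::
  "('p, 'z) monoid_scheme \<Rightarrow> ('m \<Rightarrow> 'n \<Rightarrow> 'p) \<Rightarrow> ('m, 'n) tens \<Rightarrow> 'p" where
  "tensor_lift P f C = (let c = SOME c. c \<in> C in
     finprod P (\<lambda>z. f (fst z) (snd z) [^]\<^bsub>P\<^esub> Poly_Mapping.lookup c z) (Poly_Mapping.keys c))"

text \<open>The ring structure is relevant only if \<open>M\<close> and \<open>N\<close> are algebras.\<close>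

definition tensor ::
  "('r, 'z) ring_scheme \<Rightarrow> ('r, 'm, 'x) module_scheme \<Rightarrow> ('r, 'n, 'y) module_scheme \<Rightarrow>
   ('r, ('m, 'n) tens) module" where
  "tensor R M N = \<lparr>carrier = carrier (tensor_group R M N),
     monoid.mult = (\<lambda>u v. tensor_lift (tensor_group R M N) (\<lambda>x y.
       tensor_lift (tensor_group R M N) (\<lambda>x' y'. pure R M N (x \<otimes>\<^bsub>M\<^esub> x') (y \<otimes>\<^bsub>N\<^esub> y')) v) u),
     one = pure R M N \<one>\<^bsub>M\<^esub> \<one>\<^bsub>N\<^esub>,
     ring.zero = \<one>\<^bsub>tensor_group R M N\<^esub>,
     ring.add = monoid.mult (tensor_group R M N),
     smult = (\<lambda>r. tensor_lift (tensor_group R M N) (\<lambda>x y. pure R M N (r \<odot>\<^bsub>M\<^esub> x) y))\<rparr>"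

lemma tensor_lift_pure:
  assumes P: "comm_group P"
    and M: "abelian_group M" and N: "abelian_group N"
    and sM: "\<And>r x. \<lbrakk>r \<in> carrier R; x \<in> carrier M\<rbrakk> \<Longrightarrow> r \<odot>\<^bsub>M\<^esub> x \<in> carrier M"
    and sN: "\<And>r y. \<lbrakk>r \<in> carrier R; y \<in> carrier N\<rbrakk> \<Longrightarrow> r \<odot>\<^bsub>N\<^esub> y \<in> carrier N"
    and cl: "\<And>x y. \<lbrakk>x \<in> carrier M; y \<in> carrier N\<rbrakk> \<Longrightarrow> f x y \<in> carrier P"
    and l: "\<And>x x' y. \<lbrakk>x \<in> carrier M; x' \<in> carrier M; y \<in> carrier N\<rbrakk> \<Longrightarrow>
      f (x \<oplus>\<^bsub>M\<^esub> x') y = f x y \<otimes>\<^bsub>P\<^esub> f x' y"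
    and r: "\<And>x y y'. \<lbrakk>x \<in> carrier M; y \<in> carrier N; y' \<in> carrier N\<rbrakk> \<Longrightarrow>
      f x (y \<oplus>\<^bsub>N\<^esub> y') = f x y \<otimes>\<^bsub>P\<^esub> f x y'"
    and b: "\<And>r x y. \<lbrakk>r \<in> carrier R; x \<in> carrier M; y \<in> carrier N\<rbrakk> \<Longrightarrow>
      f (r \<odot>\<^bsub>M\<^esub> x) y = f x (r \<odot>\<^bsub>N\<^esub> y)"
  shows "tensor_lift P f \<in> hom (tensor_group R M N) P"
    and "\<And>x y. \<lbrakk>x \<in> carrier M; y \<in> carrier N\<rbrakk> \<Longrightarrow> tensor_lift P f (pure R M N x y) = f x y"
proof -
  interpret P: comm_group P by fact
  interpret M: abelian_group M by fact
  interpret N: abelian_group N by fact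
  let ?S = "carrier M \<times> carrier N"
  let ?F = "free_Abelian_group ?S"
  let ?H = "tensor_null R M N"
  interpret F: comm_group ?F by (rule abelian_free_Abelian_group)
  define ff where "ff z = f (fst z) (snd z)" for z
  define h where "h c = finprod P (\<lambda>z. ff z [^]\<^bsub>P\<^esub> Poly_Mapping.lookup c z) (Poly_Mapping.keys c)" for c :: "_ \<Rightarrow>\<^sub>0 int"
  have fS: "ff z \<in> carrier P" if "z \<in> ?S" for z using that cl by (auto simp: ff_def)
  have pow: "ff z [^]\<^bsub>P\<^esub> (n::int) \<in> carrier P" if "z \<in> ?S" for z n
    using fS[OF that] by simp
  have h_sup: "h c = finprod P (\<lambda>z. ff z [^]\<^bsub>P\<^esub> Poly_Mapping.lookup c z) T"
    if "Poly_Mapping.keys c \<subseteq> T" "finite T" "T \<subseteq> ?S" for c T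
    unfolding h_def
  proof (rule P.finprod_mono_neutral_cong_left)
    show "ff z [^]\<^bsub>P\<^esub> Poly_Mapping.lookup c z = \<one>\<^bsub>P\<^esub>" if "z \<in> T - Poly_Mapping.keys c" for z
      using that by (simp add: in_keys_iff)
  qed (use that pow in auto)
  have hhom: "h \<in> hom ?F P"
  proof (rule homI)
    fix c assume "c \<in> carrier ?F"
    then show "h c \<in> carrier P" unfolding h_def using pow by (intro P.finprod_closed) auto
  next
    fix c d assume c: "c \<in> carrier ?F" and d: "d \<in> carrier ?F"
    let ?T = "Poly_Mapping.keys c \<union> Poly_Mapping.keys d"
    have T: "finite ?T" "?T \<subseteq> ?S" using c d by auto
    have "h (c + d) = finprod P (\<lambda>z. ff z [^]\<^bsub>P\<^esub> Poly_Mapping.lookup (c + d) z) ?T"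
      by (rule h_sup) (use T Poly_Mapping.keys_add[of c d] in auto)
    also have "\<dots> = finprod P (\<lambda>z. ff z [^]\<^bsub>P\<^esub> Poly_Mapping.lookup c z \<otimes>\<^bsub>P\<^esub> ff z [^]\<^bsub>P\<^esub> Poly_Mapping.lookup d z) ?T"
      using T pow fS by (intro P.finprod_cong') (auto simp: lookup_add P.int_pow_mult)
    also have "\<dots> = finprod P (\<lambda>z. ff z [^]\<^bsub>P\<^esub> Poly_Mapping.lookup c z) ?T \<otimes>\<^bsub>P\<^esub>
        finprod P (\<lambda>z. ff z [^]\<^bsub>P\<^esub> Poly_Mapping.lookup d z) ?T"
      using T pow by (intro P.finprod_multf) auto
    also have "\<dots> = h c \<otimes>\<^bsub>P\<^esub> h d"
      using T h_sup[of c ?T] h_sup[of d ?T] by simp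
    finally show "h (c \<otimes>\<^bsub>?F\<^esub> d) = h c \<otimes>\<^bsub>P\<^esub> h d" by simp
  qed
  interpret h: group_hom ?F P h by (intro group_hom.intro group_hom_axioms.intro hhom) auto
  have h_of: "h (frag_of z) = ff z" if "z \<in> ?S" for z
    using fS[OF that] by (simp add: h_def keys_frag_of)
  have h_diff: "h (frag_of a - frag_of b - frag_of c) = ff a \<otimes>\<^bsub>P\<^esub> inv\<^bsub>P\<^esub> ff b \<otimes>\<^bsub>P\<^esub> inv\<^bsub>P\<^esub> ff c"
    if "a \<in> ?S" "b \<in> ?S" "c \<in> ?S" for a b c
  proof -
    have m: "frag_of a \<in> carrier ?F" "- frag_of b \<in> carrier ?F" "- frag_of c \<in> carrier ?F"
      using that by (auto simp: keys_frag_of)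
    have i: "h (- frag_of z) = inv\<^bsub>P\<^esub> ff z" if "z \<in> ?S" for z
      using h.hom_inv[of "frag_of z"] that h_of by (simp add: keys_frag_of)
    have "h ((frag_of a + (- frag_of b)) + (- frag_of c)) = h (frag_of a) \<otimes>\<^bsub>P\<^esub> h (- frag_of b) \<otimes>\<^bsub>P\<^esub> h (- frag_of c)"
      using h.hom_mult[OF F.m_closed[OF m(1,2)] m(3)] h.hom_mult[OF m(1,2)] by simp
    then show ?thesis using i that h_of by simp
  qed
  have h_diff2: "h (frag_of a - frag_of b) = ff a \<otimes>\<^bsub>P\<^esub> inv\<^bsub>P\<^esub> ff b"
    if "a \<in> ?S" "b \<in> ?S" for a b
  proof -
    have m: "frag_of a \<in> carrier ?F" "- frag_of b \<in> carrier ?F"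
      using that by (auto simp: keys_frag_of)
    have i: "h (- frag_of b) = inv\<^bsub>P\<^esub> ff b"
      using h.hom_inv[of "frag_of b"] that h_of by (simp add: keys_frag_of)
    have "h (frag_of a + (- frag_of b)) = h (frag_of a) \<otimes>\<^bsub>P\<^esub> h (- frag_of b)"
      using h.hom_mult[OF m] by simp
    then show ?thesis using i that h_of by simp
  qed
  let ?rel = "{frag_of (x \<oplus>\<^bsub>M\<^esub> x', y) - frag_of (x, y) - frag_of (x', y) | x x' y.
        x \<in> carrier M \<and> x' \<in> carrier M \<and> y \<in> carrier N} \<union>
     {frag_of (x, y \<oplus>\<^bsub>N\<^esub> y') - frag_of (x, y) - frag_of (x, y') | x y y'.
        x \<in> carrier M \<and> y \<in> carrier N \<and> y' \<in> carrier N} \<union>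
     {frag_of (r \<odot>\<^bsub>M\<^esub> x, y) - frag_of (x, r \<odot>\<^bsub>N\<^esub> y) | r x y.
        r \<in> carrier R \<and> x \<in> carrier M \<and> y \<in> carrier N}"
  have keys_diff: "Poly_Mapping.keys (a - b) \<subseteq> ?S"
    if "Poly_Mapping.keys a \<subseteq> ?S" "Poly_Mapping.keys b \<subseteq> ?S" for a b :: "_ \<Rightarrow>\<^sub>0 int"
    using that Poly_Mapping.keys_diff[of a b] by blast
  have relF: "?rel \<subseteq> carrier ?F"
  proof -
    have n1: "frag_of (x \<oplus>\<^bsub>M\<^esub> x', y) - frag_of (x, y) - frag_of (x', y) \<in> carrier ?F"
      if "x \<in> carrier M" "x' \<in> carrier M" "y \<in> carrier N" for x x' y
      using that by (simp add: keys_diff keys_frag_of)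
    have n2: "frag_of (x, y \<oplus>\<^bsub>N\<^esub> y') - frag_of (x, y) - frag_of (x, y') \<in> carrier ?F"
      if "x \<in> carrier M" "y \<in> carrier N" "y' \<in> carrier N" for x y y'
      using that by (simp add: keys_diff keys_frag_of)
    have n3: "frag_of (r \<odot>\<^bsub>M\<^esub> x, y) - frag_of (x, r \<odot>\<^bsub>N\<^esub> y) \<in> carrier ?F"
      if "r \<in> carrier R" "x \<in> carrier M" "y \<in> carrier N" for r x y
      using that by (simp add: keys_diff keys_frag_of sM sN)
    show ?thesis
      by (intro Un_least subsetI; elim CollectE exE conjE; hypsubst; rule n1 n2 n3; assumption)
  qed
  have relK: "?rel \<subseteq> kernel ?F P h"
  proof -
    have inv2: "u \<otimes>\<^bsub>P\<^esub> v \<otimes>\<^bsub>P\<^esub> inv\<^bsub>P\<^esub> u \<otimes>\<^bsub>P\<^esub> inv\<^bsub>P\<^esub> v = \<one>\<^bsub>P\<^esub>"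
      if "u \<in> carrier P" "v \<in> carrier P" for u v
      using that P.inv_mult[of u v] P.r_inv[of "u \<otimes>\<^bsub>P\<^esub> v"] by (simp add: P.m_assoc)
    have n1: "h (frag_of (x \<oplus>\<^bsub>M\<^esub> x', y) - frag_of (x, y) - frag_of (x', y)) = \<one>\<^bsub>P\<^esub>"
      if "x \<in> carrier M" "x' \<in> carrier M" "y \<in> carrier N" for x x' y
      using that by (simp add: h_diff ff_def l cl inv2)
    have n2: "h (frag_of (x, y \<oplus>\<^bsub>N\<^esub> y') - frag_of (x, y) - frag_of (x, y')) = \<one>\<^bsub>P\<^esub>"
      if "x \<in> carrier M" "y \<in> carrier N" "y' \<in> carrier N" for x y y'
      using that by (simp add: h_diff ff_def r cl inv2)
    have n3: "h (frag_of (r \<odot>\<^bsub>M\<^esub> x, y) - frag_of (x, r \<odot>\<^bsub>N\<^esub> y)) = \<one>\<^bsub>P\<^esub>"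
      if "r \<in> carrier R" "x \<in> carrier M" "y \<in> carrier N" for r x y
      using that by (simp add: h_diff2 ff_def b cl sM sN)
    have k: "?rel \<subseteq> {z. h z = \<one>\<^bsub>P\<^esub>}"
      by (intro Un_least subsetI CollectI; elim CollectE exE conjE; hypsubst; rule n1 n2 n3; assumption)
    show ?thesis
    proof
      fix z assume z: "z \<in> ?rel"
      have "h z = \<one>\<^bsub>P\<^esub>" using subsetD[OF k z] by (rule CollectD)
      then show "z \<in> kernel ?F P h"
        unfolding kernel_def by (intro CollectI conjI subsetD[OF relF z])
    qed
  qed
  have H: "?H \<lhd> ?F"
    unfolding tensor_null_def using F.generate_is_subgroup[OF relF] by (rule F.subgroup_imp_normal)
  interpret H: normal ?H ?F by (rule H)
  have HK: "h c = \<one>\<^bsub>P\<^esub>" if "c \<in> ?H" for c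
    using subsetD[OF F.generate_subgroup_incl[OF relK h.subgroup_kernel, folded tensor_null_def] that]
    by (simp add: kernel_def)
  have lift: "tensor_lift P f (?H #>\<^bsub>?F\<^esub> c) = h c" if c: "c \<in> carrier ?F" for c
  proof -
    define d where "d = (SOME d. d \<in> ?H #>\<^bsub>?F\<^esub> c)"
    have "d \<in> ?H #>\<^bsub>?F\<^esub> c"
      unfolding d_def by (rule someI[of _ c]) (rule F.rcos_self[OF c H.subgroup_axioms])
    then obtain e where e: "e \<in> ?H" "d = e \<otimes>\<^bsub>?F\<^esub> c" unfolding r_coset_def by blast
    have "h d = h e \<otimes>\<^bsub>P\<^esub> h c" unfolding e(2) using H.mem_carrier[OF e(1)] c by (rule h.hom_mult)
    then have "h d = h c" using HK[OF e(1)] h.hom_closed[OF c] by simp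
    then show ?thesis unfolding tensor_lift_def d_def[symmetric] by (simp add: h_def ff_def)
  qed
  show "tensor_lift P f (pure R M N x y) = f x y" if "x \<in> carrier M" "y \<in> carrier N" for x y
    unfolding pure_def using that by (subst lift) (auto simp: keys_frag_of h_of ff_def)
  show "tensor_lift P f \<in> hom (tensor_group R M N) P"
  proof (rule homI)
    fix C assume "C \<in> carrier (tensor_group R M N)"
    then obtain c where "c \<in> carrier ?F" "C = ?H #>\<^bsub>?F\<^esub> c"
      unfolding tensor_group_def carrier_FactGroup by blast
    then show "tensor_lift P f C \<in> carrier P" using lift h.hom_closed by simp
  next
    fix C D assume "C \<in> carrier (tensor_group R M N)" "D \<in> carrier (tensor_group R M N)"
    then obtain c d where c: "c \<in> carrier ?F" "C = ?H #>\<^bsub>?F\<^esub> c" and d: "d \<in> carrier ?F" "D = ?H #>\<^bsub>?F\<^esub> d"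
      unfolding tensor_group_def carrier_FactGroup by blast
    have "C \<otimes>\<^bsub>tensor_group R M N\<^esub> D = ?H #>\<^bsub>?F\<^esub> (c \<otimes>\<^bsub>?F\<^esub> d)"
      unfolding tensor_group_def c(2) d(2) using c(1) d(1) by (simp add: FactGroup_def H.rcos_sum)
    then show "tensor_lift P f (C \<otimes>\<^bsub>tensor_group R M N\<^esub> D) = tensor_lift P f C \<otimes>\<^bsub>P\<^esub> tensor_lift P f D"
      using lift[OF c(1)] lift[OF d(1)] lift[OF F.m_closed[OF c(1) d(1)]] c(2) d(2) h.hom_mult[OF c(1) d(1)]
      by metis
  qed
qed

text \<open>
  Flatness of \<open>M\<close>.  The test modules live on the type \<^typ>\<open>nat \<Rightarrow> 'r\<close>, which accommodates every
  countably generated \<open>R\<close>-module; inclusions of ideals into \<open>R\<close> already suffice to test flatness.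
\<close>

definition flat :: "('r, 'z) ring_scheme \<Rightarrow> ('r, 'm, 'y) module_scheme \<Rightarrow> bool" where
  "flat R M \<longleftrightarrow> (\<forall>(L :: ('r, nat \<Rightarrow> 'r) module) (N :: ('r, nat \<Rightarrow> 'r) module) f.
     module R L \<and> module R N \<and> f \<in> lmod_hom R L N \<and> inj_on f (carrier L) \<longrightarrow>
     inj_on (tensor_lift (tensor_group R N M) (\<lambda>x m. pure R N M (f x) m)) (carrier (tensor R L M)))"


section \<open>Finite group schemes and their group algebras\<close>

text \<open>A finite group scheme is given by its coordinate Hopf algebra.\<close>

record ('k, 'a) hopf = "('k, 'a) module" +
  comul :: "'a \<Rightarrow> ('a, 'a) tens"
  counit :: "'a \<Rightarrow> 'k"
  antipode :: "'a \<Rightarrow> 'a"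

definition self_module :: "('k, 'z) ring_scheme \<Rightarrow> ('k, 'k) module" where
  "self_module k = with_smult k (monoid.mult k)"

definition alg_hom ::
  "('k, 'z) ring_scheme \<Rightarrow> ('k, 'a, 'x) module_scheme \<Rightarrow> ('k, 'b, 'y) module_scheme \<Rightarrow> ('a \<Rightarrow> 'b) set" where
  "alg_hom k A B = ring_hom A B \<inter> lmod_hom k A B"

locale finite_group_scheme = base?: field k + algebra k A
  for k :: "('k, 'z) ring_scheme" (structure) and A :: "('k, 'a, 'y) hopf_scheme" (structure) +
  assumes finite_dim: "fin_gen k A"
    and comul_hom: "comul A \<in> alg_hom k A (tensor k A A)"
    and counit_hom: "counit A \<in> alg_hom k A (self_module k)"
    and antipode_hom: "antipode A \<in> lmod_hom k A A"
    and coassoc: "a \<in> carrier A \<Longrightarrow>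
      tensor_lift (tensor_group k A (tensor k A A)) (\<lambda>x y.
        tensor_lift (tensor_group k A (tensor k A A)) (\<lambda>x\<^sub>1 x\<^sub>2.
          pure k A (tensor k A A) x\<^sub>1 (pure k A A x\<^sub>2 y)) (comul A x)) (comul A a) =
      tensor_lift (tensor_group k A (tensor k A A)) (\<lambda>x y.
        pure k A (tensor k A A) x (comul A y)) (comul A a)"
    and counit_left: "a \<in> carrier A \<Longrightarrow>
      tensor_lift (add_monoid A) (\<lambda>x y. counit A x \<odot>\<^bsub>A\<^esub> y) (comul A a) = a"
    and counit_right: "a \<in> carrier A \<Longrightarrow>
      tensor_lift (add_monoid A) (\<lambda>x y. counit A y \<odot>\<^bsub>A\<^esub> x) (comul A a) = a"
    and antipode_left: "a \<in> carrier A \<Longrightarrow>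
      tensor_lift (add_monoid A) (\<lambda>x y. antipode A x \<otimes>\<^bsub>A\<^esub> y) (comul A a) = counit A a \<odot>\<^bsub>A\<^esub> \<one>\<^bsub>A\<^esub>"
    and antipode_right: "a \<in> carrier A \<Longrightarrow>
      tensor_lift (add_monoid A) (\<lambda>x y. x \<otimes>\<^bsub>A\<^esub> antipode A y) (comul A a) = counit A a \<odot>\<^bsub>A\<^esub> \<one>\<^bsub>A\<^esub>"

text \<open>The linear dual of the coordinate algebra, with the convolution product.\<close>

definition group_algebra ::
  "('k, 'z) ring_scheme \<Rightarrow> ('k, 'a, 'y) hopf_scheme \<Rightarrow> ('k, 'a \<Rightarrow> 'k) module" where
  "group_algebra k A = \<lparr>carrier = lmod_hom k A (self_module k) \<inter> extensional (carrier A),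
     monoid.mult = (\<lambda>\<phi> \<psi>. \<lambda>a\<in>carrier A.
       tensor_lift (add_monoid k) (\<lambda>x y. \<phi> x \<otimes>\<^bsub>k\<^esub> \<psi> y) (comul A a)),
     one = (\<lambda>a\<in>carrier A. counit A a),
     ring.zero = (\<lambda>a\<in>carrier A. \<zero>\<^bsub>k\<^esub>),
     ring.add = (\<lambda>\<phi> \<psi>. \<lambda>a\<in>carrier A. \<phi> a \<oplus>\<^bsub>k\<^esub> \<psi> a),
     smult = (\<lambda>c \<phi>. \<lambda>a\<in>carrier A. c \<otimes>\<^bsub>k\<^esub> \<phi> a)\<rparr>"

definition abelian_scheme :: "('k, 'z) ring_scheme \<Rightarrow> ('k, 'a, 'y) hopf_scheme \<Rightarrow> bool" where
  "abelian_scheme k A \<longleftrightarrow> (\<forall>a\<in>carrier A.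
     tensor_lift (tensor_group k A A) (\<lambda>x y. pure k A A y x) (comul A a) = comul A a)"

text \<open>
  A finite group scheme is unipotent if every nonzero representation has a nonzero fixed vector,
  i.e. one on which the group algebra acts through its augmentation \<open>\<phi> \<mapsto> \<phi> 1\<close>.  The type
  \<^typ>\<open>nat \<Rightarrow> 'k\<close> accommodates all finite dimensional representations, and every representation
  is a union of finite dimensional ones.
\<close>

definition unipotent_scheme :: "('k, 'z) ring_scheme \<Rightarrow> ('k, 'a, 'y) hopf_scheme \<Rightarrow> bool" where
  "unipotent_scheme k A \<longleftrightarrow> (\<forall>V :: ('a \<Rightarrow> 'k, nat \<Rightarrow> 'k) module.
     left_module (group_algebra k A) V \<and> carrier V \<noteq> {\<zero>\<^bsub>V\<^esub>} \<longrightarrow>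
     (\<exists>v\<in>carrier V. v \<noteq> \<zero>\<^bsub>V\<^esub> \<and> (\<forall>\<phi>\<in>carrier (group_algebra k A).
        \<phi> \<odot>\<^bsub>V\<^esub> v = (\<phi> \<one>\<^bsub>A\<^esub> \<odot>\<^bsub>group_algebra k A\<^esub> \<one>\<^bsub>group_algebra k A\<^esub>) \<odot>\<^bsub>V\<^esub> v)))"

text \<open>
  \<open>\<pi>\<close> is the surjection of Hopf algebras \<open>k[G] \<rightarrow> k[H]\<close> dual to a closed immersion of group schemes
  \<open>H \<rightarrow> G\<close>.  It induces the inclusion \<open>kH \<rightarrow> kG\<close>.
\<close>

definition closed_immersion ::
  "('k, 'z) ring_scheme \<Rightarrow> ('k, 'a, 'x) hopf_scheme \<Rightarrow> ('k, 'b, 'y) hopf_scheme \<Rightarrow> ('a \<Rightarrow> 'b) \<Rightarrow> bool" where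
  "closed_immersion k A B \<pi> \<longleftrightarrow> \<pi> \<in> alg_hom k A B \<and> \<pi> ` carrier A = carrier B \<and>
     (\<forall>a\<in>carrier A. counit B (\<pi> a) = counit A a \<and>
        comul B (\<pi> a) = tensor_lift (tensor_group k B B) (\<lambda>x y. pure k B B (\<pi> x) (\<pi> y)) (comul A a))"

definition subgroup_algebra_map ::
  "('k, 'a, 'x) hopf_scheme \<Rightarrow> ('a \<Rightarrow> 'b) \<Rightarrow> ('b \<Rightarrow> 'k) \<Rightarrow> ('a \<Rightarrow> 'k)" where
  "subgroup_algebra_map A \<pi> \<psi> = (\<lambda>a\<in>carrier A. \<psi> (\<pi> a))"


section \<open>Base change\<close>

text \<open>A field extension \<open>K/k\<close> is a ring homomorphism \<open>\<iota> : k \<rightarrow> K\<close> of fields.\<close>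

definition ext_module :: "('l, 'w) ring_scheme \<Rightarrow> ('k \<Rightarrow> 'l) \<Rightarrow> ('k, 'l) module" where
  "ext_module K \<iota> = with_smult K (\<lambda>c x. \<iota> c \<otimes>\<^bsub>K\<^esub> x)"

definition base_change_alg ::
  "('k, 'z) ring_scheme \<Rightarrow> ('l, 'w) ring_scheme \<Rightarrow> ('k \<Rightarrow> 'l) \<Rightarrow> ('k, 'a, 'y) module_scheme \<Rightarrow>
   ('l, ('l, 'a) tens) module" where
  "base_change_alg k K \<iota> A = with_smult (tensor k (ext_module K \<iota>) A)
     (\<lambda>c. tensor_lift (tensor_group k (ext_module K \<iota>) A)
            (\<lambda>x a. pure k (ext_module K \<iota>) A (c \<otimes>\<^bsub>K\<^esub> x) a))"

definition base_change ::
  "('k, 'z) ring_scheme \<Rightarrow> ('l, 'w) ring_scheme \<Rightarrow> ('k \<Rightarrow> 'l) \<Rightarrow> ('k, 'a, 'y) hopf_scheme \<Rightarrow>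
   ('l, ('l, 'a) tens) hopf" where
  "base_change k K \<iota> A =
    (let B = base_change_alg k K \<iota> A; p = pure k (ext_module K \<iota>) A in
     module.extend B \<lparr>
       comul = tensor_lift (tensor_group K B B) (\<lambda>c a.
         tensor_lift (tensor_group K B B) (\<lambda>x y. pure K B B (p c x) (p \<one>\<^bsub>K\<^esub> y)) (comul A a)),
       counit = tensor_lift (add_monoid K) (\<lambda>c a. c \<otimes>\<^bsub>K\<^esub> \<iota> (counit A a)),
       antipode = tensor_lift (add_monoid B) (\<lambda>c a. p c (antipode A a))\<rparr>)"

text \<open>
  The canonical map \<open>kG \<rightarrow> KG = Hom\<^sub>K(K \<otimes>\<^sub>k k[G], K)\<close> (\<open>K\<close>-linear extension of functionals), which
  identifies \<open>KG\<close> with \<open>K \<otimes>\<^sub>k kG\<close>.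
\<close>

definition group_algebra_ext ::
  "('k, 'z) ring_scheme \<Rightarrow> ('l, 'w) ring_scheme \<Rightarrow> ('k \<Rightarrow> 'l) \<Rightarrow> ('k, 'a, 'y) hopf_scheme \<Rightarrow>
   ('a \<Rightarrow> 'k) \<Rightarrow> (('l, 'a) tens \<Rightarrow> 'l)" where
  "group_algebra_ext k K \<iota> A \<phi> = (\<lambda>u\<in>carrier (base_change k K \<iota> A).
     tensor_lift (add_monoid K) (\<lambda>c a. c \<otimes>\<^bsub>K\<^esub> \<iota> (\<phi> a)) u)"


section \<open>\<open>\<pi>\<close>-points\<close>

text \<open>The \<open>K\<close>-algebra \<open>K[t]/(t\<^sup>p)\<close>.\<close>

definition trunc_poly :: "('l, 'w) ring_scheme \<Rightarrow> nat \<Rightarrow> ('l, (nat \<Rightarrow> 'l) set) module" where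
  "trunc_poly K p =
    (let P = UP K; I = genideal P {monom P \<one>\<^bsub>K\<^esub> p} in
     with_smult (P Quot I) (\<lambda>c C. (I +>\<^bsub>P\<^esub> monom P c 0) \<otimes>\<^bsub>P Quot I\<^esub> C))"

text \<open>The \<open>K[t]/(t\<^sup>p)\<close>-module \<open>K\<close> on which \<open>t\<close> acts as zero (for \<open>p > 0\<close>).\<close>

definition residue_module :: "('l, 'w) ring_scheme \<Rightarrow> ((nat \<Rightarrow> 'l) set, 'l) module" where
  "residue_module K = with_smult K (\<lambda>C x. coeff (UP K) (SOME f. f \<in> C) 0 \<otimes>\<^bsub>K\<^esub> x)"

text \<open>
  The subgroup scheme is given by its coordinate algebra \<open>B\<close>.  Being a quotient of \<open>K[G]\<close>, it can
  be realised on the type underlying \<open>K[G]\<close>.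
\<close>

definition pi_point ::
  "('k, 'z) ring_scheme \<Rightarrow> nat \<Rightarrow> ('k, 'a, 'y) hopf_scheme \<Rightarrow> ('l, 'w) ring_scheme \<Rightarrow> ('k \<Rightarrow> 'l) \<Rightarrow>
   ((nat \<Rightarrow> 'l) set \<Rightarrow> (('l, 'a) tens \<Rightarrow> 'l)) \<Rightarrow> bool" where
  "pi_point k p G K \<iota> \<alpha> \<longleftrightarrow>
    (let GK = base_change k K \<iota> G; KG = group_algebra K GK; T = trunc_poly K p in
     \<alpha> \<in> alg_hom K T KG \<and>
     (\<exists>(B :: ('l, ('l, 'a) tens) hopf) \<pi> \<beta>.
        finite_group_scheme K B \<and> closed_immersion K GK B \<pi> \<and>
        unipotent_scheme K B \<and> abelian_scheme K B \<and>
        \<beta> \<in> alg_hom K T (group_algebra K B) \<and>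
        (\<forall>r\<in>carrier T. \<alpha> r = subgroup_algebra_map GK \<pi> (\<beta> r))) \<and>
     flat T (with_smult KG (\<lambda>r x. \<alpha> r \<otimes>\<^bsub>KG\<^esub> x)))"

text \<open>
  \<open>\<alpha>\<^sub>*(K) = KG \<otimes>\<^bsub>K[t]/(t^p)\<^esub> K\<close>, where \<open>KG\<close> is a right \<open>K[t]/(t\<^sup>p)\<close>-module via \<open>\<alpha>\<close> and \<open>KG\<close> acts
  on the tensor product by left multiplication.
\<close>

definition induced_module ::
  "nat \<Rightarrow> ('l, 'w) ring_scheme \<Rightarrow> ('l, 'b, 'y) module_scheme \<Rightarrow> ((nat \<Rightarrow> 'l) set \<Rightarrow> 'b) \<Rightarrow>
   ('b, ('b, 'l) tens) module" where
  "induced_module p K KG \<alpha> =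
    (let T = trunc_poly K p; L = with_smult KG (\<lambda>r x. x \<otimes>\<^bsub>KG\<^esub> \<alpha> r); N = residue_module K in
     with_smult (tensor T L N)
       (\<lambda>g. tensor_lift (tensor_group T L N) (\<lambda>x c. pure T L N (g \<otimes>\<^bsub>KG\<^esub> x) c)))"

definition point_module ::
  "('k, 'z) ring_scheme \<Rightarrow> nat \<Rightarrow> ('k, 'a, 'y) hopf_scheme \<Rightarrow> ('l, 'w) ring_scheme \<Rightarrow> ('k \<Rightarrow> 'l) \<Rightarrow>
   ((nat \<Rightarrow> 'l) set \<Rightarrow> (('l, 'a) tens \<Rightarrow> 'l)) \<Rightarrow>
   ('a \<Rightarrow> 'k, (('l, 'a) tens \<Rightarrow> 'l, 'l) tens) module" where
  "point_module k p G K \<iota> \<alpha> =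
    (let M = induced_module p K (group_algebra K (base_change k K \<iota> G)) \<alpha> in
     with_smult M (\<lambda>\<phi> x. group_algebra_ext k K \<iota> G \<phi> \<odot>\<^bsub>M\<^esub> x))"

definition has_characteristic :: "('k, 'z) ring_scheme \<Rightarrow> nat \<Rightarrow> bool" where
  "has_characteristic k p \<longleftrightarrow> (\<forall>n::nat. [n] \<cdot>\<^bsub>k\<^esub> \<one>\<^bsub>k\<^esub> = \<zero>\<^bsub>k\<^esub> \<longleftrightarrow> p dvd n)"

end

theory Submission
  imports Defs
begin

text \<open>
  The point module is a finite dimensional \<open>K\<close>-vector space \<open>V\<close> on which \<open>kG\<close> acts \<open>K\<close>-linearly.
  Endomorphism-stable subgroups of \<open>V\<close> are \<open>K\<close>-subspaces, so \<open>V\<close> is endofinite.  Moreover \<open>V\<^sup>I = K\<^sup>I \<otimes>\<^sub>K V\<close> and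
  \<open>V\<^bsup>(I)\<^esup> = K\<^bsup>(I)\<^esup> \<otimes>\<^sub>K V\<close>, so every \<open>K\<close>-linear map between (restricted) powers of \<open>K\<close> induces a
  \<open>kG\<close>-linear map between the corresponding powers of \<open>V\<close>.  The subspace \<open>K\<^bsup>(I)\<^esup>\<close> has a complement in
  \<open>K\<^sup>I\<close>, and \<open>K\<^sup>I\<close>, like every vector space, is a summand of some \<open>K\<^bsup>(B)\<^esup>\<close>; hence
  \<open>V\<^bsup>(I)\<^esup>\<close> is a summand of \<open>V\<^sup>I\<close> and \<open>V\<^sup>I\<close> is a summand of \<open>V\<^bsup>(B)\<^esup>\<close>.
\<close>

section \<open>Linear algebra over a field\<close>

text \<open>Finite dimensionality enters as a finite family e with functionals s_e such that every v
  is the sum of the s_e(v) e. Such a family is a K-linear section of K^(S) \<rightarrow> V for a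
  finite spanning set S, with no independence asked for. It makes every element of V^I a finite sum
  of vectors c \<otimes> x with c in K^I; for infinite dimensional V and infinite I this fails. The
  obstacle on the other side is that \<open>KG\<close> is the convolution dual of the base change K
  \<otimes> A, whose comultiplication is a lift nested in a lift. Its ring laws are therefore proved
  for k-linear maps A \<rightarrow> K, where the Hopf axioms of A apply directly, and carried over
  by K-linear extension of functionals. On the point module, K acts through the right-hand factor of
  KG \<otimes> K and so commutes with left multiplication by \<open>KG\<close>. A constant
  polynomial acts by the same scalar on both factors, so scaling x in x \<otimes> 1 is this same
  action; hence the x \<otimes> 1 with x in a finite spanning set of \<open>KG\<close>
  generate.\<close>

lemma with_smult_simps [simp]:
  "carrier (with_smult M s) = carrier M" "\<zero>\<^bsub>with_smult M s\<^esub> = \<zero>\<^bsub>M\<^esub>"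
  "ring.add (with_smult M s) = ring.add M" "smult (with_smult M s) = s"
  "monoid.mult (with_smult M s) = monoid.mult M" "\<one>\<^bsub>with_smult M s\<^esub> = \<one>\<^bsub>M\<^esub>"
  by (simp_all add: with_smult_def)

lemma a_inv_with_smult [simp]: "\<ominus>\<^bsub>with_smult M s\<^esub> x = \<ominus>\<^bsub>M\<^esub> x"
  by (simp add: a_inv_def m_inv_def)

text \<open>Only these three record fields occur in the axioms. This moves group laws between
  records that share them, such as a tensor group and the additive group of a module built on
  it.\<close>

lemma comm_group_cong:
  assumes "carrier G = carrier H" "monoid.mult G = monoid.mult H" "one G = one H"
  shows "comm_group G \<longleftrightarrow> comm_group H"
  unfolding comm_group_def comm_monoid_def group_def group_axioms_def comm_monoid_axioms_def
    monoid_def Units_def assms ..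

lemma abelian_group_iff_comm_group: "abelian_group M \<longleftrightarrow> comm_group (add_monoid M)"
  using abelian_group.a_comm_group comm_group.axioms(1)
  by (auto simp: abelian_group_def abelian_monoid_def abelian_group_axioms_def)

lemma abelian_group_with_smult [simp]: "abelian_group (with_smult M s) \<longleftrightarrow> abelian_group M"
  unfolding abelian_group_iff_comm_group by (rule comm_group_cong) simp_all

lemma finsum_with_smult [simp]: "finsum (with_smult M s) f A = finsum M f A"
  by (simp add: finsum_def finprod_def)

context left_module
begin

lemma smult_l_null: "x \<in> carrier M \<Longrightarrow> \<zero>\<^bsub>R\<^esub> \<odot>\<^bsub>M\<^esub> x = \<zero>\<^bsub>M\<^esub>"
  using lm_l_distr[of "\<zero>\<^bsub>R\<^esub>" "\<zero>\<^bsub>R\<^esub>" x] lm_closed[of "\<zero>\<^bsub>R\<^esub>" x]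
  by (metis R.zero_closed R.l_zero M.add.l_cancel_one M.zero_closed)

lemma smult_r_null: "r \<in> carrier R \<Longrightarrow> r \<odot>\<^bsub>M\<^esub> \<zero>\<^bsub>M\<^esub> = \<zero>\<^bsub>M\<^esub>"
  by (rule left_module_smult_zero[OF left_module_axioms])

lemma smult_minus_one: 
  assumes "x \<in> carrier M"
  shows "(\<ominus>\<^bsub>R\<^esub> \<one>\<^bsub>R\<^esub>) \<odot>\<^bsub>M\<^esub> x = \<ominus>\<^bsub>M\<^esub> x"
proof -
  have "(\<ominus>\<^bsub>R\<^esub> \<one>\<^bsub>R\<^esub>) \<odot>\<^bsub>M\<^esub> x \<oplus>\<^bsub>M\<^esub> x = (\<ominus>\<^bsub>R\<^esub> \<one>\<^bsub>R\<^esub> \<oplus>\<^bsub>R\<^esub> \<one>\<^bsub>R\<^esub>) \<odot>\<^bsub>M\<^esub> x"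
    using assms by (simp add: lm_l_distr lm_one)
  also have "\<dots> = \<zero>\<^bsub>M\<^esub>" using assms by (simp add: R.l_neg smult_l_null)
  finally show ?thesis using assms lm_closed by (metis M.minus_equality R.a_inv_closed R.one_closed)
qed

text \<open>Negatives come from the scalar action, since -x is (-1) x.\<close>

lemma submodule_criterion:
  assumes "U \<subseteq> carrier M" "\<zero>\<^bsub>M\<^esub> \<in> U" "\<And>x y. \<lbrakk>x \<in> U; y \<in> U\<rbrakk> \<Longrightarrow> x \<oplus>\<^bsub>M\<^esub> y \<in> U"
    "\<And>r x. \<lbrakk>r \<in> carrier R; x \<in> U\<rbrakk> \<Longrightarrow> r \<odot>\<^bsub>M\<^esub> x \<in> U"
  shows "submodule U R M"
proof (intro submodule.intro subgroup.intro submodule_axioms.intro)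
  show "inv\<^bsub>add_monoid M\<^esub> x \<in> U" if "x \<in> U" for x
    using assms(1) assms(4)[of "\<ominus>\<^bsub>R\<^esub> \<one>\<^bsub>R\<^esub>" x] that smult_minus_one[of x] by (auto simp: a_inv_def)
qed (use assms in auto)

lemma submodule_carrier: "submodule (carrier M) R M"
  by (rule submodule_criterion) (auto simp: lm_closed)

lemma submodule_null: "submodule {\<zero>\<^bsub>M\<^esub>} R M"
  by (rule submodule_criterion) (auto simp: smult_r_null)

lemma finsum_smult:
  assumes "finite A" "f \<in> A \<rightarrow> carrier M" "r \<in> carrier R"
  shows "r \<odot>\<^bsub>M\<^esub> finsum M f A = finsum M (\<lambda>i. r \<odot>\<^bsub>M\<^esub> f i) A"
  using assms
proof (induction A)
  case empty
  then show ?case by (simp add: smult_r_null)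
next
  case (insert a A)
  then have "(\<lambda>i. r \<odot>\<^bsub>M\<^esub> f i) \<in> A \<rightarrow> carrier M" "r \<odot>\<^bsub>M\<^esub> f a \<in> carrier M" "f \<in> A \<rightarrow> carrier M" "f a \<in> carrier M"
    by (auto intro!: lm_closed)
  with insert show ?case by (simp add: lm_r_distr finsum_closed del: Pi_split_insert_domain)
qed

end

lemma lmod_hom_finsum:
  assumes "f \<in> lmod_hom R M N" "abelian_group M" "abelian_group N" "finite A" "g \<in> A \<rightarrow> carrier M"
  shows "f (finsum M g A) = finsum N (\<lambda>a. f (g a)) A"
proof -
  interpret M: abelian_group M by fact
  interpret N: abelian_group N by fact
  show ?thesis using assms(4,5)
  proof (induction A)
    case empty
    show ?case using lmod_hom_zero[OF assms(1-3)] by simp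
  next
    case (insert a A)
    then have "(\<lambda>a. f (g a)) \<in> A \<rightarrow> carrier N" "f (g a) \<in> carrier N"
      using lmod_homD(1)[OF assms(1)] by auto
    with insert show ?case using lmod_homD(2)[OF assms(1)] by (simp add: Pi_iff)
  qed
qed

lemma lmod_hom_comp:
  "\<lbrakk>f \<in> lmod_hom R M N; g \<in> lmod_hom R N P\<rbrakk> \<Longrightarrow> (\<lambda>x. g (f x)) \<in> lmod_hom R M P"
  by (rule lmod_homI) (simp_all add: lmod_homD)

lemma lmod_hom_finsum_hom:
  assumes "left_module R M" "left_module R N" "finite A"
    and "\<And>a. a \<in> A \<Longrightarrow> f a \<in> lmod_hom R M N"
  shows "(\<lambda>x. finsum N (\<lambda>a. f a x) A) \<in> lmod_hom R M N"
proof -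
  interpret M: left_module R M by fact
  interpret N: left_module R N by fact
  note D = lmod_homD[OF assms(4)]
  show ?thesis
  proof (rule lmod_homI)
    show "finsum N (\<lambda>a. f a (x \<oplus>\<^bsub>M\<^esub> y)) A = finsum N (\<lambda>a. f a x) A \<oplus>\<^bsub>N\<^esub> finsum N (\<lambda>a. f a y) A"
      if "x \<in> carrier M" "y \<in> carrier M" for x y
    proof -
      have "finsum N (\<lambda>a. f a (x \<oplus>\<^bsub>M\<^esub> y)) A = finsum N (\<lambda>a. f a x \<oplus>\<^bsub>N\<^esub> f a y) A"
        using that D by (intro N.M.finsum_cong') auto
      then show ?thesis using that D by (simp add: N.M.finsum_addf Pi_iff)
    qed
    show "finsum N (\<lambda>a. f a (r \<odot>\<^bsub>M\<^esub> x)) A = r \<odot>\<^bsub>N\<^esub> finsum N (\<lambda>a. f a x) A"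
      if "x \<in> carrier M" "r \<in> carrier R" for r x
    proof -
      have "finsum N (\<lambda>a. f a (r \<odot>\<^bsub>M\<^esub> x)) A = finsum N (\<lambda>a. r \<odot>\<^bsub>N\<^esub> f a x) A"
        using that D by (intro N.M.finsum_cong') (auto simp: N.lm_closed)
      then show ?thesis using that D assms(3) by (simp add: N.finsum_smult Pi_iff)
    qed
  qed (use D in \<open>auto intro!: N.M.finsum_closed\<close>)
qed

text \<open>Zorn's lemma gives a submodule Z maximal among those meeting Y trivially. If v were
  outside Y + Z, then X = Z + K v would still meet Y trivially, so X = Z by maximality and v lies in
  Z after all. The map \<rho> is the projection onto Y along Z.\<close>

lemma submodule_retraction:
  assumes K: "field K" and V: "left_module K V" and Y: "submodule Y K V"
  shows "\<exists>\<rho>\<in>lmod_hom K V V. \<rho> ` carrier V \<subseteq> Y \<and> (\<forall>y\<in>Y. \<rho> y = y)"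
proof -
  interpret K: field K by fact
  interpret V: left_module K V by fact
  note Yc = subsetD[OF submodule_subset[OF Y]]
  define \<A> where "\<A> = {Z. submodule Z K V \<and> Z \<inter> Y = {\<zero>\<^bsub>V\<^esub>}}"
  have "{\<zero>\<^bsub>V\<^esub>} \<in> \<A>"
    using submodule_zero[OF Y] V.submodule_null by (auto simp: \<A>_def)
  moreover have "\<Union>\<C> \<in> \<A>" if "\<C> \<noteq> {}" and C: "subset.chain \<A> \<C>" for \<C>
  proof -
    have sub: "submodule Z K V" and int: "Z \<inter> Y = {\<zero>\<^bsub>V\<^esub>}" if "Z \<in> \<C>" for Z
      using C that by (auto simp: subset_chain_def \<A>_def)
    have "submodule (\<Union>\<C>) K V"
    proof (rule V.submodule_criterion)
      show "\<Union>\<C> \<subseteq> carrier V" using submodule_subset[OF sub] by blast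
      show "\<zero>\<^bsub>V\<^esub> \<in> \<Union>\<C>" using \<open>\<C> \<noteq> {}\<close> submodule_zero[OF sub] by blast
      show "r \<odot>\<^bsub>V\<^esub> x \<in> \<Union>\<C>" if "r \<in> carrier K" "x \<in> \<Union>\<C>" for r x
        using that submodule.smult_closed[OF sub] by blast
      show "x \<oplus>\<^bsub>V\<^esub> y \<in> \<Union>\<C>" if xy: "x \<in> \<Union>\<C>" "y \<in> \<Union>\<C>" for x y
      proof -
        obtain X Z where "X \<in> \<C>" "Z \<in> \<C>" "x \<in> X" "y \<in> Z" using xy by blast
        moreover then have "X \<subseteq> Z \<or> Z \<subseteq> X" using C by (auto simp: subset_chain_def)
        ultimately show ?thesis using submodule_add[OF sub] by blast
      qed
    qed
    moreover have "\<Union>\<C> \<inter> Y = {\<zero>\<^bsub>V\<^esub>}" using int \<open>\<C> \<noteq> {}\<close> by blast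
    ultimately show ?thesis by (simp add: \<A>_def)
  qed
  ultimately obtain Z where "Z \<in> \<A>" and max: "\<And>X. \<lbrakk>X \<in> \<A>; Z \<subseteq> X\<rbrakk> \<Longrightarrow> X = Z"
    using subset_Zorn_nonempty[of \<A>] by blast
  then have Z: "submodule Z K V" and ZY: "Z \<inter> Y = {\<zero>\<^bsub>V\<^esub>}" by (auto simp: \<A>_def)
  note Zc = subsetD[OF submodule_subset[OF Z]]
  have decomp: "\<exists>y\<in>Y. \<exists>z\<in>Z. v = y \<oplus>\<^bsub>V\<^esub> z" if v: "v \<in> carrier V" for v
  proof (rule ccontr)
    assume no: "\<not> ?thesis"
    define X where "X = {z \<oplus>\<^bsub>V\<^esub> c \<odot>\<^bsub>V\<^esub> v | z c. z \<in> Z \<and> c \<in> carrier K}"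
    have "submodule X K V"
    proof (rule V.submodule_criterion)
      show "X \<subseteq> carrier V" using Zc v by (auto simp: X_def V.lm_closed)
      show "\<zero>\<^bsub>V\<^esub> \<in> X"
        unfolding X_def using submodule_zero[OF Z] V.smult_l_null[OF v] by force
      show "x \<oplus>\<^bsub>V\<^esub> y \<in> X" if xy: "x \<in> X" "y \<in> X" for x y
      proof -
        obtain z c z' c' where *: "z \<in> Z" "c \<in> carrier K" "z' \<in> Z" "c' \<in> carrier K"
          "x = z \<oplus>\<^bsub>V\<^esub> c \<odot>\<^bsub>V\<^esub> v" "y = z' \<oplus>\<^bsub>V\<^esub> c' \<odot>\<^bsub>V\<^esub> v" using xy by (auto simp: X_def)
        then have "x \<oplus>\<^bsub>V\<^esub> y = (z \<oplus>\<^bsub>V\<^esub> z') \<oplus>\<^bsub>V\<^esub> (c \<oplus>\<^bsub>K\<^esub> c') \<odot>\<^bsub>V\<^esub> v"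
          using v Zc by (simp add: V.lm_l_distr V.lm_closed V.M.a_ac)
        then show ?thesis using * submodule_add[OF Z] unfolding X_def by blast
      qed
      show "r \<odot>\<^bsub>V\<^esub> x \<in> X" if r: "r \<in> carrier K" and x: "x \<in> X" for r x
      proof -
        obtain z c where *: "z \<in> Z" "c \<in> carrier K" "x = z \<oplus>\<^bsub>V\<^esub> c \<odot>\<^bsub>V\<^esub> v" using x by (auto simp: X_def)
        then have "r \<odot>\<^bsub>V\<^esub> x = r \<odot>\<^bsub>V\<^esub> z \<oplus>\<^bsub>V\<^esub> (r \<otimes>\<^bsub>K\<^esub> c) \<odot>\<^bsub>V\<^esub> v"
          using v Zc r by (simp add: V.lm_r_distr V.lm_closed V.lm_assoc)
        then show ?thesis using * r submodule.smult_closed[OF Z] unfolding X_def by blast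
      qed
    qed
    moreover have "X \<inter> Y = {\<zero>\<^bsub>V\<^esub>}"
    proof
      show "{\<zero>\<^bsub>V\<^esub>} \<subseteq> X \<inter> Y"
        using submodule_zero[OF \<open>submodule X K V\<close>] submodule_zero[OF Y] by blast
      show "X \<inter> Y \<subseteq> {\<zero>\<^bsub>V\<^esub>}"
      proof
        fix y assume "y \<in> X \<inter> Y"
        then obtain z c where *: "z \<in> Z" "c \<in> carrier K" "y = z \<oplus>\<^bsub>V\<^esub> c \<odot>\<^bsub>V\<^esub> v" and y: "y \<in> Y"
          by (auto simp: X_def)
        show "y \<in> {\<zero>\<^bsub>V\<^esub>}"
        proof (cases "c = \<zero>\<^bsub>K\<^esub>")
          case True
          then have "y = z" using * v Zc by (simp add: V.smult_l_null)
          then show ?thesis using y * ZY by blast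
        next
          case False
          \<comment> \<open>This is where K must be a field: dividing y = z + c v by c would write v
            as an element of Y + Z.\<close>
          then have u: "c \<in> Units K" using * K.field_Units by blast
          have cv: "c \<odot>\<^bsub>V\<^esub> v = y \<oplus>\<^bsub>V\<^esub> \<ominus>\<^bsub>V\<^esub> z"
          proof -
            have "y \<oplus>\<^bsub>V\<^esub> \<ominus>\<^bsub>V\<^esub> z = c \<odot>\<^bsub>V\<^esub> v \<oplus>\<^bsub>V\<^esub> (z \<oplus>\<^bsub>V\<^esub> \<ominus>\<^bsub>V\<^esub> z)"
              unfolding *(3) using Zc[OF *(1)] V.lm_closed[OF *(2) v] by (simp add: V.M.a_ac)
            then show ?thesis using Zc[OF *(1)] V.lm_closed[OF *(2) v] by (simp add: V.M.r_neg)
          qed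
          have iv: "inv\<^bsub>K\<^esub> c \<odot>\<^bsub>V\<^esub> (c \<odot>\<^bsub>V\<^esub> v) = inv\<^bsub>K\<^esub> c \<odot>\<^bsub>V\<^esub> y \<oplus>\<^bsub>V\<^esub> inv\<^bsub>K\<^esub> c \<odot>\<^bsub>V\<^esub> (\<ominus>\<^bsub>V\<^esub> z)"
            unfolding cv by (rule V.lm_r_distr) (use u Zc[OF *(1)] Yc[OF y] in auto)
          have "v = (inv\<^bsub>K\<^esub> c \<otimes>\<^bsub>K\<^esub> c) \<odot>\<^bsub>V\<^esub> v"
            unfolding K.Units_l_inv[OF u] by (rule V.lm_one[OF v, symmetric])
          also have "\<dots> = inv\<^bsub>K\<^esub> c \<odot>\<^bsub>V\<^esub> (c \<odot>\<^bsub>V\<^esub> v)"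
            by (rule V.lm_assoc[OF K.Units_inv_closed[OF u] *(2) v])
          also note iv
          finally have "v = inv\<^bsub>K\<^esub> c \<odot>\<^bsub>V\<^esub> y \<oplus>\<^bsub>V\<^esub> inv\<^bsub>K\<^esub> c \<odot>\<^bsub>V\<^esub> (\<ominus>\<^bsub>V\<^esub> z)" .
          moreover have "inv\<^bsub>K\<^esub> c \<odot>\<^bsub>V\<^esub> y \<in> Y"
            by (rule submodule.smult_closed[OF Y K.Units_inv_closed[OF u] y])
          moreover have "inv\<^bsub>K\<^esub> c \<odot>\<^bsub>V\<^esub> (\<ominus>\<^bsub>V\<^esub> z) \<in> Z"
            by (rule submodule.smult_closed[OF Z K.Units_inv_closed[OF u] submodule_minus[OF Z *(1)]])
          ultimately have False using no by blast
          then show ?thesis ..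
        qed
      qed
    qed
    ultimately have "X \<in> \<A>" by (simp add: \<A>_def)
    moreover have "Z \<subseteq> X"
    proof
      fix z assume "z \<in> Z"
      moreover then have "z = z \<oplus>\<^bsub>V\<^esub> \<zero>\<^bsub>K\<^esub> \<odot>\<^bsub>V\<^esub> v" using Zc v by (simp add: V.smult_l_null)
      ultimately show "z \<in> X" unfolding X_def by blast
    qed
    ultimately have "X = Z" by (rule max)
    moreover have "\<zero>\<^bsub>V\<^esub> \<oplus>\<^bsub>V\<^esub> \<one>\<^bsub>K\<^esub> \<odot>\<^bsub>V\<^esub> v \<in> X"
      using submodule_zero[OF Z] by (auto simp: X_def)
    ultimately have "v \<in> Z" using v by (simp add: V.lm_one)
    then show False using no submodule_zero[OF Y] v V.M.l_zero by metis
  qed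
  have unique: "y = y'" if "y \<in> Y" "y' \<in> Y" "z \<in> Z" "z' \<in> Z" "y \<oplus>\<^bsub>V\<^esub> z = y' \<oplus>\<^bsub>V\<^esub> z'" for y y' z z'
  proof -
    note c = Yc[OF that(1)] Yc[OF that(2)] Zc[OF that(3)] Zc[OF that(4)]
    have "y \<oplus>\<^bsub>V\<^esub> \<ominus>\<^bsub>V\<^esub> y' = (y \<oplus>\<^bsub>V\<^esub> z) \<oplus>\<^bsub>V\<^esub> (\<ominus>\<^bsub>V\<^esub> y' \<oplus>\<^bsub>V\<^esub> \<ominus>\<^bsub>V\<^esub> z)"
      using c by (simp add: V.M.a_ac V.M.r_neg)
    also have "\<dots> = z' \<oplus>\<^bsub>V\<^esub> \<ominus>\<^bsub>V\<^esub> z" unfolding that(5)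
    proof -
      have "(y' \<oplus>\<^bsub>V\<^esub> z') \<oplus>\<^bsub>V\<^esub> (\<ominus>\<^bsub>V\<^esub> y' \<oplus>\<^bsub>V\<^esub> \<ominus>\<^bsub>V\<^esub> z) = (y' \<oplus>\<^bsub>V\<^esub> \<ominus>\<^bsub>V\<^esub> y') \<oplus>\<^bsub>V\<^esub> (z' \<oplus>\<^bsub>V\<^esub> \<ominus>\<^bsub>V\<^esub> z)"
        using c by (simp add: V.M.a_ac)
      then show "(y' \<oplus>\<^bsub>V\<^esub> z') \<oplus>\<^bsub>V\<^esub> (\<ominus>\<^bsub>V\<^esub> y' \<oplus>\<^bsub>V\<^esub> \<ominus>\<^bsub>V\<^esub> z) = z' \<oplus>\<^bsub>V\<^esub> \<ominus>\<^bsub>V\<^esub> z"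
        using c by (simp add: V.M.r_neg)
    qed
    finally have eq: "y \<oplus>\<^bsub>V\<^esub> \<ominus>\<^bsub>V\<^esub> y' = z' \<oplus>\<^bsub>V\<^esub> \<ominus>\<^bsub>V\<^esub> z" .
    have "y \<oplus>\<^bsub>V\<^esub> \<ominus>\<^bsub>V\<^esub> y' \<in> Y"
      using that by (intro submodule_add[OF Y] submodule_minus[OF Y])
    moreover have "y \<oplus>\<^bsub>V\<^esub> \<ominus>\<^bsub>V\<^esub> y' \<in> Z"
      unfolding eq using that by (intro submodule_add[OF Z] submodule_minus[OF Z])
    ultimately have "y \<oplus>\<^bsub>V\<^esub> \<ominus>\<^bsub>V\<^esub> y' \<in> Z \<inter> Y" by blast
    then have "y \<oplus>\<^bsub>V\<^esub> \<ominus>\<^bsub>V\<^esub> y' = \<zero>\<^bsub>V\<^esub>" using ZY by blast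
    then show ?thesis using c by (metis V.M.minus_equality V.M.minus_minus V.M.a_inv_closed)
  qed
  define \<rho> where "\<rho> v = (SOME y. y \<in> Y \<and> (\<exists>z\<in>Z. v = y \<oplus>\<^bsub>V\<^esub> z))" for v
  have \<rho>: "\<rho> (y \<oplus>\<^bsub>V\<^esub> z) = y" if "y \<in> Y" "z \<in> Z" for y z
    unfolding \<rho>_def by (rule some_equality) (use that unique in blast)+
  have "\<rho> \<in> lmod_hom K V V"
  proof (rule lmod_homI)
    fix v assume "v \<in> carrier V"
    with decomp \<rho> Yc show "\<rho> v \<in> carrier V" by metis
  next
    fix v w assume "v \<in> carrier V" "w \<in> carrier V"
    then obtain y z y' z' where *: "y \<in> Y" "z \<in> Z" "v = y \<oplus>\<^bsub>V\<^esub> z" "y' \<in> Y" "z' \<in> Z" "w = y' \<oplus>\<^bsub>V\<^esub> z'"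
      using decomp by metis
    have "v \<oplus>\<^bsub>V\<^esub> w = (y \<oplus>\<^bsub>V\<^esub> y') \<oplus>\<^bsub>V\<^esub> (z \<oplus>\<^bsub>V\<^esub> z')"
      using * Yc Zc by (simp add: V.M.a_ac)
    then show "\<rho> (v \<oplus>\<^bsub>V\<^esub> w) = \<rho> v \<oplus>\<^bsub>V\<^esub> \<rho> w"
      using * \<rho> submodule_add[OF Y] submodule_add[OF Z] by simp
  next
    fix r v assume r: "r \<in> carrier K" and "v \<in> carrier V"
    then obtain y z where *: "y \<in> Y" "z \<in> Z" "v = y \<oplus>\<^bsub>V\<^esub> z" using decomp by metis
    have "r \<odot>\<^bsub>V\<^esub> v = r \<odot>\<^bsub>V\<^esub> y \<oplus>\<^bsub>V\<^esub> r \<odot>\<^bsub>V\<^esub> z" using * r Yc Zc by (simp add: V.lm_r_distr)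
    then show "\<rho> (r \<odot>\<^bsub>V\<^esub> v) = r \<odot>\<^bsub>V\<^esub> \<rho> v"
      using * r \<rho> submodule.smult_closed[OF Y] submodule.smult_closed[OF Z] by simp
  qed
  moreover have "\<rho> ` carrier V \<subseteq> Y"
  proof
    fix x assume "x \<in> \<rho> ` carrier V"
    then obtain v where "v \<in> carrier V" "x = \<rho> v" by (rule imageE)
    moreover then obtain y z where "y \<in> Y" "z \<in> Z" "v = y \<oplus>\<^bsub>V\<^esub> z" using decomp by metis
    ultimately show "x \<in> Y" using \<rho> by simp
  qed
  moreover have "\<rho> y = y" if "y \<in> Y" for y
    using \<rho>[OF that submodule_zero[OF Z]] Yc[OF that] by simp
  ultimately show ?thesis by blast
qed

text \<open>The kernel is taken inside a submodule U because
  \<open>finite_spanning_if_separated\<close> cuts a subspace down by one functional at a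
  time.\<close>

lemma submodule_kernel:
  assumes f: "f \<in> lmod_hom R M N" and M: "left_module R M" and N: "left_module R N"
    and U: "submodule U R M"
  shows "submodule {x \<in> U. f x = \<zero>\<^bsub>N\<^esub>} R M"
proof -
  interpret M: left_module R M by fact
  interpret N: left_module R N by fact
  note Uc = subsetD[OF submodule_subset[OF U]]
  show ?thesis
    by (rule M.submodule_criterion)
      (use lmod_homD[OF f] Uc lmod_hom_zero[OF f M.abelian_group_axioms N.abelian_group_axioms]
        submodule_zero[OF U] submodule_add[OF U] submodule.smult_closed[OF U] N.smult_r_null in auto)
qed

text \<open>With \<rho> a retraction onto the kernel of q, the map T = id - \<rho> kills that
  kernel, so T w depends only on q w. The section sends q w to T w.\<close>

lemma surjection_splits:
  assumes K: "field K" and W: "left_module K W" and V: "left_module K V"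
    and q: "q \<in> lmod_hom K W V" and surj: "carrier V \<subseteq> q ` carrier W"
  shows "\<exists>s\<in>lmod_hom K V W. \<forall>v\<in>carrier V. q (s v) = v"
proof -
  interpret V: left_module K V by fact
  interpret W: left_module K W by fact
  define Y where "Y = {w \<in> carrier W. q w = \<zero>\<^bsub>V\<^esub>}"
  have "submodule Y K W" unfolding Y_def by (rule submodule_kernel[OF q W V W.submodule_carrier])
  then obtain \<rho> where \<rho>: "\<rho> \<in> lmod_hom K W W" and \<rho>Y: "\<And>w. w \<in> carrier W \<Longrightarrow> \<rho> w \<in> Y"
    and \<rho>id: "\<And>y. y \<in> Y \<Longrightarrow> \<rho> y = y"
    using submodule_retraction[OF K W] by blast
  note D = lmod_homD[OF \<rho>] and qD = lmod_homD[OF q]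
  note qm = lmod_hom_minus[OF q W.abelian_group_axioms V.abelian_group_axioms]
  note \<rho>m = lmod_hom_minus[OF \<rho> W.abelian_group_axioms W.abelian_group_axioms]
  define T where "T w = w \<oplus>\<^bsub>W\<^esub> \<ominus>\<^bsub>W\<^esub> \<rho> w" for w
  have T: "T w \<in> carrier W" if "w \<in> carrier W" for w using that D by (simp add: T_def)
  have qT: "q (T w) = q w" if "w \<in> carrier W" for w
    using that D \<rho>Y[OF that] by (simp add: T_def qD qm Y_def)
  have Tadd: "T (w \<oplus>\<^bsub>W\<^esub> w') = T w \<oplus>\<^bsub>W\<^esub> T w'" if "w \<in> carrier W" "w' \<in> carrier W" for w w'
    using that by (simp add: T_def D W.M.a_ac W.M.minus_add)
  have Tsmult: "T (r \<odot>\<^bsub>W\<^esub> w) = r \<odot>\<^bsub>W\<^esub> T w" if "r \<in> carrier K" "w \<in> carrier W" for r w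
  proof -
    have "\<ominus>\<^bsub>W\<^esub> (r \<odot>\<^bsub>W\<^esub> \<rho> w) = r \<odot>\<^bsub>W\<^esub> (\<ominus>\<^bsub>W\<^esub> \<rho> w)"
      using that D W.lm_closed W.lm_r_distr[of r "\<rho> w" "\<ominus>\<^bsub>W\<^esub> \<rho> w"] W.smult_r_null[of r]
      by (metis W.M.a_comm W.M.a_inv_closed W.M.minus_equality W.M.r_neg)
    then show ?thesis using that D by (simp add: T_def W.lm_r_distr)
  qed
  have T0: "T y = \<zero>\<^bsub>W\<^esub>" if "y \<in> Y" for y
    using that \<rho>id[OF that] by (simp add: T_def Y_def W.M.r_neg)
  have Tq: "T w = T w'" if "w \<in> carrier W" "w' \<in> carrier W" "q w = q w'" for w w'
  proof -
    have y: "w \<oplus>\<^bsub>W\<^esub> \<ominus>\<^bsub>W\<^esub> w' \<in> Y" using that by (simp add: Y_def qD qm V.M.r_neg)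
    have "w = (w \<oplus>\<^bsub>W\<^esub> \<ominus>\<^bsub>W\<^esub> w') \<oplus>\<^bsub>W\<^esub> w'" using that by (simp add: W.M.a_assoc W.M.l_neg)
    then have "T w = T (w \<oplus>\<^bsub>W\<^esub> \<ominus>\<^bsub>W\<^esub> w') \<oplus>\<^bsub>W\<^esub> T w'" using Tadd that by (metis W.M.a_closed W.M.a_inv_closed)
    then show ?thesis using T0[OF y] T that by simp
  qed
  \<comment> \<open>Any preimage will do: by \<open>Tq\<close> the value of T does not depend on the
    choice, and linearity of s follows from that of T.\<close>
  define s where "s v = T (SOME w. w \<in> carrier W \<and> q w = v)" for v
  have s: "s (q w) = T w" if w: "w \<in> carrier W" for w
  proof -
    have "(SOME w'. w' \<in> carrier W \<and> q w' = q w) \<in> carrier W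
      \<and> q (SOME w'. w' \<in> carrier W \<and> q w' = q w) = q w" by (rule someI[of _ w]) (use w in simp)
    then show ?thesis unfolding s_def using Tq w by blast
  qed
  have lift: "\<exists>w\<in>carrier W. v = q w" if "v \<in> carrier V" for v using surj that by blast
  have "s \<in> lmod_hom K V W"
  proof (rule lmod_homI)
    fix v assume "v \<in> carrier V"
    with lift s T show "s v \<in> carrier W" by metis
  next
    fix v v' assume "v \<in> carrier V" "v' \<in> carrier V"
    then obtain w w' where "w \<in> carrier W" "w' \<in> carrier W" "v = q w" "v' = q w'" using lift by metis
    then show "s (v \<oplus>\<^bsub>V\<^esub> v') = s v \<oplus>\<^bsub>W\<^esub> s v'" using s Tadd qD(2) by (metis W.M.a_closed)
  next
    fix r v assume "r \<in> carrier K" "v \<in> carrier V"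
    moreover then obtain w where "w \<in> carrier W" "v = q w" using lift by metis
    ultimately show "s (r \<odot>\<^bsub>V\<^esub> v) = r \<odot>\<^bsub>W\<^esub> s v" using s Tsmult qD(3) by (metis W.lm_closed)
  qed
  moreover have "q (s v) = v" if "v \<in> carrier V" for v
    using lift[OF that] s qT by metis
  ultimately show ?thesis by blast
qed

section \<open>Coordinate spaces over a field and linear combinations\<close>

lemma left_module_self: "ring K \<Longrightarrow> left_module K (self_module K)"
  unfolding left_module_def self_module_def left_module_axioms_def
  by (auto simp: ring.ring_simprules ring.is_abelian_group)

lemma self_module_simps [simp]:
  "carrier (self_module K) = carrier K" "\<zero>\<^bsub>self_module K\<^esub> = \<zero>\<^bsub>K\<^esub>"
  "ring.add (self_module K) = ring.add K" "smult (self_module K) = monoid.mult K"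
  by (simp_all add: self_module_def)

lemma direct_powerD:
  assumes "x \<in> carrier (direct_power fin I M)"
  shows "i \<in> I \<Longrightarrow> x i \<in> carrier M" "fin \<Longrightarrow> finite {i \<in> I. x i \<noteq> \<zero>\<^bsub>M\<^esub>}"
  using assms by (auto simp: direct_power_simps)

lemma restrict_in_direct_power:
  assumes "\<And>i. i \<in> I \<Longrightarrow> f i \<in> carrier M" "fin \<Longrightarrow> finite {i \<in> I. f i \<noteq> \<zero>\<^bsub>M\<^esub>}"
  shows "(\<lambda>i\<in>I. f i) \<in> carrier (direct_power fin I M)"
proof -
  have "{i \<in> I. (\<lambda>i\<in>I. f i) i \<noteq> \<zero>\<^bsub>M\<^esub>} = {i \<in> I. f i \<noteq> \<zero>\<^bsub>M\<^esub>}" by auto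
  then show ?thesis using assms by (auto simp: direct_power_simps)
qed

lemma direct_power_eqI:
  assumes "x \<in> carrier (direct_power fin I M)" "y \<in> carrier (direct_power fin' I M)"
    "\<And>i. i \<in> I \<Longrightarrow> x i = y i"
  shows "x = y"
  using assms by (auto simp: direct_power_simps intro: PiE_ext)

lemma direct_power_projection: "i \<in> I \<Longrightarrow> (\<lambda>x. x i) \<in> lmod_hom R (direct_power fin I M) M"
  by (rule lmod_homI) (auto simp: direct_power_simps)

text \<open>The sum runs over the support of c because \<open>finsum\<close> over an infinite set
  returns zero by default, and B may be as large as all of K^I.\<close>

definition lincomb ::
  "('r, 'z) ring_scheme \<Rightarrow> ('r, 'm, 'y) module_scheme \<Rightarrow> ('b \<Rightarrow> 'm) \<Rightarrow> 'b set \<Rightarrow> ('b \<Rightarrow> 'r) \<Rightarrow> 'm" where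
  "lincomb R V e B c = finsum V (\<lambda>b. c b \<odot>\<^bsub>V\<^esub> e b) {b \<in> B. c b \<noteq> \<zero>\<^bsub>R\<^esub>}"

text \<open>The supports of two coefficient families and of their sum differ, so linearity can be
  checked only after all sums are extended by zero terms to a common finite set T.\<close>

lemma (in left_module) lincomb_superset:
  assumes "c \<in> carrier (direct_power fin B (self_module R))" "e \<in> B \<rightarrow> carrier M"
    "finite T" "{b \<in> B. c b \<noteq> \<zero>\<^bsub>R\<^esub>} \<subseteq> T" "T \<subseteq> B"
  shows "lincomb R M e B c = finsum M (\<lambda>b. c b \<odot>\<^bsub>M\<^esub> e b) T"
  unfolding lincomb_def using assms direct_powerD(1)[OF assms(1)]
  by (intro M.add.finprod_mono_neutral_cong_left) (auto intro!: lm_closed smult_l_null)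

lemma (in left_module) lincomb_hom:
  assumes e: "e \<in> B \<rightarrow> carrier M"
  shows "(\<lambda>c. lincomb R M e B c) \<in> lmod_hom R (direct_power True B (self_module R)) M"
proof -
  let ?P = "direct_power True B (self_module R)"
  interpret P: left_module R ?P by (intro left_module_direct_power left_module_self R.ring_axioms)
  have fin: "finite {b \<in> B. c b \<noteq> \<zero>\<^bsub>R\<^esub>}" if "c \<in> carrier ?P" for c
    using direct_powerD(2)[OF that] by simp
  have cc: "c b \<in> carrier R" "c b \<odot>\<^bsub>M\<^esub> e b \<in> carrier M" if "c \<in> carrier ?P" "b \<in> B" for c b
    using direct_powerD(1)[OF that] e that(2) by (auto intro: lm_closed)
  show ?thesis
  proof (rule lmod_homI)
    show "lincomb R M e B c \<in> carrier M" if "c \<in> carrier ?P" for c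
      unfolding lincomb_def using cc that by (intro M.finsum_closed) auto
    show "lincomb R M e B (c \<oplus>\<^bsub>?P\<^esub> d) = lincomb R M e B c \<oplus>\<^bsub>M\<^esub> lincomb R M e B d"
      if c: "c \<in> carrier ?P" and d: "d \<in> carrier ?P" for c d
    proof -
      let ?T = "{b \<in> B. c b \<noteq> \<zero>\<^bsub>R\<^esub>} \<union> {b \<in> B. d b \<noteq> \<zero>\<^bsub>R\<^esub>}"
      have "lincomb R M e B (c \<oplus>\<^bsub>?P\<^esub> d) = finsum M (\<lambda>b. (c \<oplus>\<^bsub>?P\<^esub> d) b \<odot>\<^bsub>M\<^esub> e b) ?T"
        by (rule lincomb_superset[OF P.M.a_closed[OF c d] e])
          (use fin[OF c] fin[OF d] in \<open>auto simp: direct_power_simps\<close>)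
      also have "\<dots> = finsum M (\<lambda>b. c b \<odot>\<^bsub>M\<^esub> e b \<oplus>\<^bsub>M\<^esub> d b \<odot>\<^bsub>M\<^esub> e b) ?T"
        by (rule M.finsum_cong')
          (use cc[OF c] cc[OF d] e in \<open>auto simp: direct_power_simps(2) intro!: lm_l_distr\<close>)
      also have "\<dots> = finsum M (\<lambda>b. c b \<odot>\<^bsub>M\<^esub> e b) ?T \<oplus>\<^bsub>M\<^esub> finsum M (\<lambda>b. d b \<odot>\<^bsub>M\<^esub> e b) ?T"
        using cc[OF c] cc[OF d] by (intro M.finsum_addf) auto
      also have "\<dots> = lincomb R M e B c \<oplus>\<^bsub>M\<^esub> lincomb R M e B d"
        using lincomb_superset[OF c e, of ?T] lincomb_superset[OF d e, of ?T] fin[OF c] fin[OF d] by auto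
      finally show ?thesis .
    qed
    show "lincomb R M e B (r \<odot>\<^bsub>?P\<^esub> c) = r \<odot>\<^bsub>M\<^esub> lincomb R M e B c"
      if r: "r \<in> carrier R" and c: "c \<in> carrier ?P" for r c
    proof -
      let ?T = "{b \<in> B. c b \<noteq> \<zero>\<^bsub>R\<^esub>}"
      have "lincomb R M e B (r \<odot>\<^bsub>?P\<^esub> c) = finsum M (\<lambda>b. (r \<odot>\<^bsub>?P\<^esub> c) b \<odot>\<^bsub>M\<^esub> e b) ?T"
        by (rule lincomb_superset[OF P.lm_closed[OF r c] e])
          (use fin[OF c] r in \<open>auto simp: direct_power_simps\<close>)
      also have "\<dots> = finsum M (\<lambda>b. r \<odot>\<^bsub>M\<^esub> (c b \<odot>\<^bsub>M\<^esub> e b)) ?T"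
        by (rule M.finsum_cong')
          (use cc[OF c] e r in \<open>auto simp: direct_power_simps(4) intro!: lm_assoc lm_closed\<close>)
      also have "\<dots> = r \<odot>\<^bsub>M\<^esub> lincomb R M e B c"
        unfolding lincomb_def using cc[OF c] r fin[OF c] by (intro finsum_smult[symmetric]) auto
      finally show ?thesis .
    qed
  qed
qed

lemma lmod_hom_image_submodule:
  assumes f: "f \<in> lmod_hom R M N" and M: "left_module R M" and N: "left_module R N"
  shows "submodule (f ` carrier M) R N"
proof -
  interpret M: left_module R M by fact
  interpret N: left_module R N by fact
  note D = lmod_homD[OF f]
  show ?thesis
  proof (rule N.submodule_criterion)
    show "\<zero>\<^bsub>N\<^esub> \<in> f ` carrier M"
      using lmod_hom_zero[OF f M.abelian_group_axioms N.abelian_group_axioms] by (metis M.M.zero_closed imageI)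
    show "x \<oplus>\<^bsub>N\<^esub> y \<in> f ` carrier M" if "x \<in> f ` carrier M" "y \<in> f ` carrier M" for x y
      using that by (auto simp flip: D(2) intro!: imageI)
    show "r \<odot>\<^bsub>N\<^esub> x \<in> f ` carrier M" if "r \<in> carrier R" "x \<in> f ` carrier M" for r x
      using that by (auto simp flip: D(3) intro!: imageI M.lm_closed)
  qed (use D in auto)
qed

text \<open>The image of the linear combination map is a submodule containing B, hence everything,
  and a surjection of vector spaces splits. B is just a spanning set here, which allows both a
  finite generating set of V and the whole of K^I.\<close>

lemma dual_basis:
  assumes K: "field K" and V: "left_module K V" and B: "B \<subseteq> carrier V"
    and span: "\<And>U. \<lbrakk>submodule U K V; B \<subseteq> U\<rbrakk> \<Longrightarrow> U = carrier V"
  shows "\<exists>s\<in>lmod_hom K V (direct_power True B (self_module K)).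
    \<forall>v\<in>carrier V. lincomb K V (\<lambda>b. b) B (s v) = v"
proof (rule surjection_splits[OF K _ V])
  interpret K: field K by fact
  interpret V: left_module K V by fact
  let ?P = "direct_power True B (self_module K)"
  let ?q = "\<lambda>c. lincomb K V (\<lambda>b. b) B c"
  show P: "left_module K ?P" by (intro left_module_direct_power left_module_self K.ring_axioms)
  show q: "?q \<in> lmod_hom K ?P V" by (rule V.lincomb_hom) (use B in auto)
  have "B \<subseteq> ?q ` carrier ?P"
  proof
    fix b assume b: "b \<in> B"
    define d where "d = (\<lambda>x\<in>B. if x = b then \<one>\<^bsub>K\<^esub> else \<zero>\<^bsub>K\<^esub>)"
    have d: "d \<in> carrier ?P"
      unfolding d_def by (rule restrict_in_direct_power) (auto intro: finite_subset[of _ "{b}"])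
    have "?q d = finsum V (\<lambda>x. d x \<odot>\<^bsub>V\<^esub> x) {b}"
      by (rule V.lincomb_superset[OF d]) (use B b in \<open>auto simp: d_def\<close>)
    also have "\<dots> = b" using b B by (auto simp: d_def V.lm_one)
    finally show "b \<in> ?q ` carrier ?P" using d by (metis imageI)
  qed
  then show "carrier V \<subseteq> ?q ` carrier ?P"
    using span[OF lmod_hom_image_submodule[OF q P V]] by simp
qed

section \<open>Modules that are finite dimensional over a field of endomorphisms\<close>

text \<open>The record M already carries the action of R, so the field acts by a separate function
  \<open>sc\<close>. In the application R is kG, M the point module and \<open>sc\<close> the action
  \<open>scal\<close> of K.\<close>

locale fd_bimodule = left_module R M + K: field K + V: left_module K "with_smult M sc"
  for R :: "('r, 'z) ring_scheme" and M :: "('r, 'm) module" and K :: "('l, 'w) ring_scheme"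
    and sc :: "'l \<Rightarrow> 'm \<Rightarrow> 'm" +
  assumes smult_commute: "\<lbrakk>r \<in> carrier R; c \<in> carrier K; x \<in> carrier M\<rbrakk> \<Longrightarrow>
      r \<odot>\<^bsub>M\<^esub> sc c x = sc c (r \<odot>\<^bsub>M\<^esub> x)"
    and finite_dimensional: "fin_gen K (with_smult M sc)"
begin

abbreviation V where "V \<equiv> with_smult M sc"
abbreviation k_power where "k_power fin I \<equiv> direct_power fin I (self_module K)"

text \<open>As S is finite, the sum over the support of \<open>s v\<close> may be replaced by one
  over all of S, whose index set does not depend on v. The maps sending v to \<open>s v e\<close>
  are the coordinate functionals.\<close>

lemma finite_dual_basis:
  obtains S s where "finite S" "S \<subseteq> carrier M" "s \<in> lmod_hom K V (k_power True S)"
    "\<And>v. v \<in> carrier M \<Longrightarrow> finsum M (\<lambda>e. sc (s v e) e) S = v"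
proof -
  obtain S where S: "finite S" "S \<subseteq> carrier V" "\<And>U. \<lbrakk>submodule U K V; S \<subseteq> U\<rbrakk> \<Longrightarrow> U = carrier V"
    using finite_dimensional unfolding fin_gen_def by metis
  obtain s where s: "s \<in> lmod_hom K V (k_power True S)"
    "\<And>v. v \<in> carrier V \<Longrightarrow> lincomb K V (\<lambda>b. b) S (s v) = v"
    using dual_basis[OF K.field_axioms V.left_module_axioms S(2,3)] by blast
  have "finsum M (\<lambda>e. sc (s v e) e) S = v" if v: "v \<in> carrier M" for v
    using s(2)[of v] V.lincomb_superset[OF lmod_homD(1)[OF s(1)], of v "\<lambda>b. b" S] S(1,2) v by (auto simp: subset_iff)
  with S(1,2) s(1) that show ?thesis by simp
qed

text \<open>The element \<open>c \<otimes> x\<close> of \<open>K\<^sup>I \<otimes>\<^sub>K V = V\<^sup>I\<close>.\<close>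

definition tensor_vec :: "'i set \<Rightarrow> ('i \<Rightarrow> 'l) \<Rightarrow> 'm \<Rightarrow> 'i \<Rightarrow> 'm" where
  "tensor_vec I c x = (\<lambda>i\<in>I. sc (c i) x)"

lemma left_module_k_power: "left_module K (k_power fin I)"
  by (intro left_module_direct_power left_module_self K.ring_axioms)

lemma left_module_V_power: "left_module K (direct_power fin I V)"
  by (intro left_module_direct_power V.left_module_axioms)

lemma V_power_simps:
  "carrier (direct_power fin I V) = carrier (direct_power fin I M)"
  "ring.add (direct_power fin I V) = ring.add (direct_power fin I M)"
  "\<zero>\<^bsub>direct_power fin I V\<^esub> = \<zero>\<^bsub>direct_power fin I M\<^esub>"
  by (auto simp: direct_power_simps fun_eq_iff)

lemma tensor_vec_hom:
  assumes x: "x \<in> carrier M"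
  shows "(\<lambda>c. tensor_vec I c x) \<in> lmod_hom K (k_power fin I) (direct_power fin I V)"
proof (rule lmod_homI)
  fix c assume c: "c \<in> carrier (k_power fin I)"
  note D = direct_powerD[OF c]
  show "tensor_vec I c x \<in> carrier (direct_power fin I V)"
    unfolding tensor_vec_def
  proof (rule restrict_in_direct_power)
    show "finite {i \<in> I. sc (c i) x \<noteq> \<zero>\<^bsub>V\<^esub>}" if fin
      by (rule finite_subset[OF _ D(2)[OF that]]) (use V.smult_l_null x in auto)
  qed (use D V.lm_closed x in auto)
next
  fix c d assume "c \<in> carrier (k_power fin I)" "d \<in> carrier (k_power fin I)"
  note D = direct_powerD(1)[OF this(1)] direct_powerD(1)[OF this(2)]
  show "tensor_vec I (c \<oplus>\<^bsub>k_power fin I\<^esub> d) x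
      = tensor_vec I c x \<oplus>\<^bsub>direct_power fin I V\<^esub> tensor_vec I d x"
    using D x V.lm_l_distr by (auto simp: tensor_vec_def direct_power_simps fun_eq_iff)
next
  fix r c assume "r \<in> carrier K" "c \<in> carrier (k_power fin I)"
  note D = this(1) direct_powerD(1)[OF this(2)]
  show "tensor_vec I (r \<odot>\<^bsub>k_power fin I\<^esub> c) x = r \<odot>\<^bsub>direct_power fin I V\<^esub> tensor_vec I c x"
    using D x V.lm_assoc by (auto simp: tensor_vec_def direct_power_simps fun_eq_iff)
qed

text \<open>One functional of V is applied in every position. It sends zero to zero, so finite
  supports are preserved and the same formula serves for sums and for products.\<close>

lemma coordinate_hom:
  assumes s: "s \<in> lmod_hom K V (k_power True S)" and e: "e \<in> S"
  shows "(\<lambda>v. \<lambda>i\<in>I. s (v i) e) \<in> lmod_hom K (direct_power fin I V) (k_power fin I)"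
proof -
  note D = lmod_homD[OF s]
  interpret S: left_module K "k_power True S" by (rule left_module_k_power)
  have s0: "s \<zero>\<^bsub>M\<^esub> e = \<zero>\<^bsub>K\<^esub>"
    using lmod_hom_zero[OF s V.abelian_group_axioms S.abelian_group_axioms] e by (simp add: direct_power_simps)
  show ?thesis
  proof (rule lmod_homI)
    fix v assume v: "v \<in> carrier (direct_power fin I V)"
    note vD = direct_powerD[OF v]
    show "(\<lambda>i\<in>I. s (v i) e) \<in> carrier (k_power fin I)"
    proof (rule restrict_in_direct_power)
      show "s (v i) e \<in> carrier (self_module K)" if "i \<in> I" for i
        using vD(1)[OF that] D(1)[of "v i"] direct_powerD(1)[of "s (v i)" True S "self_module K" e] e by simp
      show "finite {i \<in> I. s (v i) e \<noteq> \<zero>\<^bsub>self_module K\<^esub>}" if fin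
        by (rule finite_subset[OF _ vD(2)[OF that]]) (use s0 in auto)
    qed
  next
    fix v w assume "v \<in> carrier (direct_power fin I V)" "w \<in> carrier (direct_power fin I V)"
    note vD = direct_powerD(1)[OF this(1)] direct_powerD(1)[OF this(2)]
    show "(\<lambda>i\<in>I. s ((v \<oplus>\<^bsub>direct_power fin I V\<^esub> w) i) e) =
        (\<lambda>i\<in>I. s (v i) e) \<oplus>\<^bsub>k_power fin I\<^esub> (\<lambda>i\<in>I. s (w i) e)"
      using vD D(2) e by (auto simp: direct_power_simps fun_eq_iff)
  next
    fix r v assume "r \<in> carrier K" "v \<in> carrier (direct_power fin I V)"
    note vD = this(1) direct_powerD(1)[OF this(2)]
    show "(\<lambda>i\<in>I. s ((r \<odot>\<^bsub>direct_power fin I V\<^esub> v) i) e) = r \<odot>\<^bsub>k_power fin I\<^esub> (\<lambda>i\<in>I. s (v i) e)"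
      using vD D(3) e by (auto simp: direct_power_simps fun_eq_iff)
  qed
qed

text \<open>Expanding each v i in the finite dual basis shows that v is the sum over e in S of c_e
  \<otimes> e, where c_e lists the e-th coordinates of the v i. Thus finitely many vectors c
  \<otimes> x suffice even in an infinite product.\<close>

lemma V_power_hom_eqI:
  assumes f: "f \<in> lmod_hom K (direct_power fin I V) W" and g: "g \<in> lmod_hom K (direct_power fin I V) W"
    and W: "left_module K W"
    and eq: "\<And>c x. \<lbrakk>c \<in> carrier (k_power fin I); x \<in> carrier M\<rbrakk> \<Longrightarrow> f (tensor_vec I c x) = g (tensor_vec I c x)"
    and v: "v \<in> carrier (direct_power fin I V)"
  shows "f v = g v"
proof -
  interpret P: left_module K "direct_power fin I V" by (rule left_module_V_power)
  interpret W: left_module K W by fact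
  obtain S s where S: "finite S" "S \<subseteq> carrier M" and s: "s \<in> lmod_hom K V (k_power True S)"
    and sum: "\<And>v. v \<in> carrier M \<Longrightarrow> finsum M (\<lambda>e. sc (s v e) e) S = v"
    using finite_dual_basis by blast
  let ?c = "\<lambda>e. \<lambda>i\<in>I. s (v i) e"
  have c: "?c e \<in> carrier (k_power fin I)" if "e \<in> S" for e
    using lmod_homD(1)[OF coordinate_hom[OF s that] v] .
  have t: "tensor_vec I (?c e) e \<in> carrier (direct_power fin I V)" if "e \<in> S" for e
    using lmod_homD(1)[OF tensor_vec_hom c[OF that]] S that by blast
  have "finsum (direct_power fin I V) (\<lambda>e. tensor_vec I (?c e) e) S = v"
  proof (rule direct_power_eqI)
    show "finsum (direct_power fin I V) (\<lambda>e. tensor_vec I (?c e) e) S \<in> carrier (direct_power fin I V)"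
      using t by (intro P.M.finsum_closed) auto
    fix i assume i: "i \<in> I"
    have "finsum (direct_power fin I V) (\<lambda>e. tensor_vec I (?c e) e) S i
        = finsum V (\<lambda>e. tensor_vec I (?c e) e i) S"
      by (rule lmod_hom_finsum[OF direct_power_projection[OF i] P.abelian_group_axioms V.abelian_group_axioms S(1)])
        (use t in auto)
    also have "\<dots> = v i"
      using i sum[of "v i"] direct_powerD(1)[OF v i] by (simp add: tensor_vec_def)
    finally show "finsum (direct_power fin I V) (\<lambda>e. tensor_vec I (?c e) e) S i = v i" .
  qed (rule v)
  moreover have "f (finsum (direct_power fin I V) (\<lambda>e. tensor_vec I (?c e) e) S)
      = g (finsum (direct_power fin I V) (\<lambda>e. tensor_vec I (?c e) e) S)"
    using lmod_hom_finsum[OF f P.abelian_group_axioms W.abelian_group_axioms S(1), of "\<lambda>e. tensor_vec I (?c e) e"]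
      lmod_hom_finsum[OF g P.abelian_group_axioms W.abelian_group_axioms S(1), of "\<lambda>e. tensor_vec I (?c e) e"]
      t c S(2) eq lmod_homD(1)[OF g t]
    by (auto intro!: W.M.finsum_cong' simp: subset_iff)
  ultimately show ?thesis by simp
qed

text \<open>F is \<sigma> \<otimes> id: split v as the sum of c_e \<otimes> e and apply \<sigma> to
  each c_e. Since S may be linearly dependent, the value at c \<otimes> x is checked separately: its
  coordinates are s_e(x) c, and \<sigma>(c) \<otimes> x is recovered by summing s_e(x) e back to
  x.\<close>

lemma V_power_extend:
  assumes \<sigma>: "\<sigma> \<in> lmod_hom K (k_power fin I) (k_power fin' J)"
  shows "\<exists>F\<in>lmod_hom K (direct_power fin I V) (direct_power fin' J V).
    \<forall>c\<in>carrier (k_power fin I). \<forall>x\<in>carrier M. F (tensor_vec I c x) = tensor_vec J (\<sigma> c) x"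
proof -
  interpret P: left_module K "direct_power fin I V" by (rule left_module_V_power)
  interpret Q: left_module K "direct_power fin' J V" by (rule left_module_V_power)
  obtain S s where S: "finite S" "S \<subseteq> carrier M" and s: "s \<in> lmod_hom K V (k_power True S)"
    and sum: "\<And>v. v \<in> carrier M \<Longrightarrow> finsum M (\<lambda>e. sc (s v e) e) S = v"
    using finite_dual_basis by blast
  define F where "F v = finsum (direct_power fin' J V)
    (\<lambda>e. tensor_vec J (\<sigma> (\<lambda>i\<in>I. s (v i) e)) e) S" for v
  have term_hom: "(\<lambda>v. tensor_vec J (\<sigma> (\<lambda>i\<in>I. s (v i) e)) e) \<in>
      lmod_hom K (direct_power fin I V) (direct_power fin' J V)" if "e \<in> S" for e
    using lmod_hom_comp[OF lmod_hom_comp[OF coordinate_hom[OF s that] \<sigma>] tensor_vec_hom] S(2) that by blast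
  have "F \<in> lmod_hom K (direct_power fin I V) (direct_power fin' J V)"
    unfolding F_def
    by (rule lmod_hom_finsum_hom[OF P.left_module_axioms Q.left_module_axioms S(1) term_hom])
  moreover have "F (tensor_vec I c x) = tensor_vec J (\<sigma> c) x"
    if c: "c \<in> carrier (k_power fin I)" and x: "x \<in> carrier M" for c x
  proof -
    note \<sigma>c = lmod_homD(1)[OF \<sigma> c]
    have sx: "s x e \<in> carrier K" if "e \<in> S" for e
      using lmod_homD(1)[OF s, of x] x that direct_powerD(1)[of "s x" True S "self_module K" e] by simp
    have t: "tensor_vec I c x \<in> carrier (direct_power fin I V)" using lmod_homD(1)[OF tensor_vec_hom[OF x] c] .
    note term_c = lmod_homD(1)[OF term_hom t]
    \<comment> \<open>The coordinate of c \<otimes> x appears with s_e(x) on the right;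
      commutativity of K puts it in front as a scalar, where linearity of \<sigma> can use
      it.\<close>
    have coord: "(\<lambda>i\<in>I. s (tensor_vec I c x i) e) = s x e \<odot>\<^bsub>k_power fin I\<^esub> c" if "e \<in> S" for e
    proof -
      have "s (sc (c i) x) e = c i \<otimes>\<^bsub>K\<^esub> s x e" if "i \<in> I" for i
        using lmod_homD(3)[OF s, of "c i" x] direct_powerD(1)[OF c that] x \<open>e \<in> S\<close>
        by (simp add: direct_power_simps)
      then show ?thesis
        using sx[OF that] direct_powerD(1)[OF c]
        by (auto simp: tensor_vec_def direct_power_simps fun_eq_iff K.m_comm)
    qed
    show ?thesis
    proof (rule direct_power_eqI)
      show "F (tensor_vec I c x) \<in> carrier (direct_power fin' J V)"
        unfolding F_def using term_c by (intro Q.M.finsum_closed) auto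
      show "tensor_vec J (\<sigma> c) x \<in> carrier (direct_power fin' J V)"
        using lmod_homD(1)[OF tensor_vec_hom[OF x] \<sigma>c] .
      fix j assume j: "j \<in> J"
      have \<sigma>cj: "\<sigma> c j \<in> carrier K" using direct_powerD(1)[OF \<sigma>c j] by simp
      have "F (tensor_vec I c x) j = finsum V (\<lambda>e. tensor_vec J (\<sigma> (\<lambda>i\<in>I. s (tensor_vec I c x i) e)) e j) S"
        unfolding F_def
        by (rule lmod_hom_finsum[OF direct_power_projection[OF j] Q.abelian_group_axioms V.abelian_group_axioms S(1)])
          (use term_c in auto)
      also have "\<dots> = finsum V (\<lambda>e. sc (\<sigma> c j) (sc (s x e) e)) S"
      proof (rule V.M.finsum_cong')
        show "(\<lambda>e. sc (\<sigma> c j) (sc (s x e) e)) \<in> S \<rightarrow> carrier V"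
          using V.lm_closed \<sigma>cj sx S(2) by auto
        fix e assume e: "e \<in> S"
        have "\<sigma> (\<lambda>i\<in>I. s (tensor_vec I c x i) e) j = s x e \<otimes>\<^bsub>K\<^esub> \<sigma> c j"
          unfolding coord[OF e] using lmod_homD(3)[OF \<sigma> sx[OF e] c] j by (simp add: direct_power_simps)
        then show "tensor_vec J (\<sigma> (\<lambda>i\<in>I. s (tensor_vec I c x i) e)) e j = sc (\<sigma> c j) (sc (s x e) e)"
          using j V.lm_assoc[OF \<sigma>cj sx[OF e], of e] S(2) e sx[OF e] \<sigma>cj
          by (auto simp: tensor_vec_def K.m_comm)
      qed simp
      also have "\<dots> = sc (\<sigma> c j) (finsum V (\<lambda>e. sc (s x e) e) S)"
        using V.finsum_smult[OF S(1), of "\<lambda>e. sc (s x e) e" "\<sigma> c j"] V.lm_closed sx S(2) \<sigma>cj by (auto simp: subset_iff)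
      also have "\<dots> = tensor_vec J (\<sigma> c) x j" using sum[OF x] j by (simp add: tensor_vec_def)
      finally show "F (tensor_vec I c x) j = tensor_vec J (\<sigma> c) x j" .
    qed
  qed
  ultimately show ?thesis by blast
qed

lemma smult_V_power_hom:
  assumes r: "r \<in> carrier R"
  shows "(\<lambda>v. r \<odot>\<^bsub>direct_power fin I M\<^esub> v) \<in> lmod_hom K (direct_power fin I V) (direct_power fin I V)"
proof -
  interpret P: left_module R "direct_power fin I M" by (rule left_module_direct_power[OF left_module_axioms])
  show ?thesis
  proof (rule lmod_homI)
    show "r \<odot>\<^bsub>direct_power fin I M\<^esub> (c \<odot>\<^bsub>direct_power fin I V\<^esub> v)
        = c \<odot>\<^bsub>direct_power fin I V\<^esub> (r \<odot>\<^bsub>direct_power fin I M\<^esub> v)"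
      if "c \<in> carrier K" "v \<in> carrier (direct_power fin I V)" for c v
      using that r direct_powerD(1)[OF that(2)] smult_commute by (auto simp: direct_power_simps fun_eq_iff)
  qed (use r P.lm_closed P.lm_r_distr in \<open>simp_all add: V_power_simps\<close>)
qed

text \<open>R acts on the factor x and \<sigma> on the factor c. Applying r before or after F gives
  two K-linear maps that both send c \<otimes> x to \<sigma>(c) \<otimes> (r x), so
  \<open>V_power_hom_eqI\<close> identifies them.\<close>

lemma V_power_hom_R_linear:
  assumes F: "F \<in> lmod_hom K (direct_power fin I V) (direct_power fin' J V)"
    and \<sigma>: "\<sigma> \<in> lmod_hom K (k_power fin I) (k_power fin' J)"
    and F\<sigma>: "\<And>c x. \<lbrakk>c \<in> carrier (k_power fin I); x \<in> carrier M\<rbrakk> \<Longrightarrow> F (tensor_vec I c x) = tensor_vec J (\<sigma> c) x"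
  shows "F \<in> lmod_hom R (direct_power fin I M) (direct_power fin' J M)"
proof (rule lmod_homI)
  note D = lmod_homD[OF F]
  show "F x \<in> carrier (direct_power fin' J M)" if "x \<in> carrier (direct_power fin I M)" for x
    using D(1)[of x] that by (simp add: V_power_simps)
  show "F (x \<oplus>\<^bsub>direct_power fin I M\<^esub> y) = F x \<oplus>\<^bsub>direct_power fin' J M\<^esub> F y"
    if "x \<in> carrier (direct_power fin I M)" "y \<in> carrier (direct_power fin I M)" for x y
    using D(2)[of x y] that by (simp add: V_power_simps)
  show "F (r \<odot>\<^bsub>direct_power fin I M\<^esub> v) = r \<odot>\<^bsub>direct_power fin' J M\<^esub> F v"
    if r: "r \<in> carrier R" and v: "v \<in> carrier (direct_power fin I M)" for r v
  proof (rule V_power_hom_eqI[OF lmod_hom_comp[OF smult_V_power_hom[OF r] F]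
        lmod_hom_comp[OF F smult_V_power_hom[OF r]] left_module_V_power])
    show "v \<in> carrier (direct_power fin I V)" using v by (simp add: V_power_simps)
    fix c x assume c: "c \<in> carrier (k_power fin I)" and x: "x \<in> carrier M"
    have *: "r \<odot>\<^bsub>direct_power f L M\<^esub> tensor_vec L d x = tensor_vec L d (r \<odot>\<^bsub>M\<^esub> x)"
      if "d \<in> carrier (k_power f L)" for f L and d :: "'x \<Rightarrow> 'l"
      using direct_powerD(1)[OF that] r x smult_commute
      by (auto simp: direct_power_simps tensor_vec_def fun_eq_iff)
    show "F (r \<odot>\<^bsub>direct_power fin I M\<^esub> tensor_vec I c x) = r \<odot>\<^bsub>direct_power fin' J M\<^esub> F (tensor_vec I c x)"
      using *[OF c] *[OF lmod_homD(1)[OF \<sigma> c]] F\<sigma>[OF c] x r lm_closed by simp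
  qed
qed

text \<open>The maps \<sigma> \<otimes> id and \<tau> \<otimes> id compose to the identity on
  vectors c \<otimes> x, hence everywhere, so one power of M is a retract of the other. Comparing
  powers of M is thereby reduced to comparing powers of K.\<close>

lemma direct_power_summand_transfer:
  assumes N: "left_module R N" and sub: "direct_summand R N (direct_power fin I M)"
    and \<sigma>: "\<sigma> \<in> lmod_hom K (k_power fin I) (k_power fin' J)"
    and \<tau>: "\<tau> \<in> lmod_hom K (k_power fin' J) (k_power fin I)"
    and \<tau>\<sigma>: "\<And>c. c \<in> carrier (k_power fin I) \<Longrightarrow> \<tau> (\<sigma> c) = c"
  shows "direct_summand R N (direct_power fin' J M)"
proof -
  note retract = direct_summand_iff_retract[OF N left_module_direct_power[OF left_module_axioms]]
  obtain f g where f: "f \<in> lmod_hom R N (direct_power fin I M)" and g: "g \<in> lmod_hom R (direct_power fin I M) N"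
    and gf: "\<And>x. x \<in> carrier N \<Longrightarrow> g (f x) = x" using sub[unfolded retract] by blast
  obtain F where F: "F \<in> lmod_hom K (direct_power fin I V) (direct_power fin' J V)"
    and F\<sigma>: "\<And>c x. \<lbrakk>c \<in> carrier (k_power fin I); x \<in> carrier M\<rbrakk> \<Longrightarrow> F (tensor_vec I c x) = tensor_vec J (\<sigma> c) x"
    using V_power_extend[OF \<sigma>] by blast
  obtain G where G: "G \<in> lmod_hom K (direct_power fin' J V) (direct_power fin I V)"
    and G\<tau>: "\<And>c x. \<lbrakk>c \<in> carrier (k_power fin' J); x \<in> carrier M\<rbrakk> \<Longrightarrow> G (tensor_vec J c x) = tensor_vec I (\<tau> c) x"
    using V_power_extend[OF \<tau>] by blast
  have "(\<lambda>v. v) \<in> lmod_hom K (direct_power fin I V) (direct_power fin I V)" by (rule lmod_homI) auto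
  then have "G (F v) = v" if "v \<in> carrier (direct_power fin I V)" for v
    by (rule V_power_hom_eqI[OF lmod_hom_comp[OF F G] _ left_module_V_power])
      (use F\<sigma> G\<tau> \<tau>\<sigma> lmod_homD(1)[OF \<sigma>] that in auto)
  then have "g (G (F (f x))) = x" if "x \<in> carrier N" for x
    using gf[OF that] lmod_homD(1)[OF f that] by (simp add: V_power_simps)
  then show ?thesis
    unfolding retract using lmod_hom_comp[OF f V_power_hom_R_linear[OF F \<sigma> F\<sigma>]]
      lmod_hom_comp[OF V_power_hom_R_linear[OF G \<tau> G\<tau>] g] by (intro bexI ballI) auto
qed

theorem Add_eq_Prod: "(Add R M :: ('r, 'n) module set) = Prod R M"
proof (intro subset_antisym subsetI)
  fix N :: "('r, 'n) module"
  assume "N \<in> Add R M"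
  then obtain I :: "('n \<Rightarrow> 'm) set" where N: "left_module R N" and I: "direct_summand R N (direct_power True I M)"
    by (auto simp: Add_def direct_power_def)
  interpret P: left_module K "k_power True I" by (rule left_module_k_power)
  interpret Q: left_module K "k_power False I" by (rule left_module_k_power)
  have "submodule (carrier (k_power True I)) K (k_power False I)"
    by (rule Q.submodule_criterion)
      (use P.M.zero_closed P.M.a_closed P.lm_closed in \<open>auto simp: direct_power_simps\<close>)
  then obtain \<rho> where \<rho>: "\<rho> \<in> lmod_hom K (k_power False I) (k_power False I)"
    "\<And>c. c \<in> carrier (k_power False I) \<Longrightarrow> \<rho> c \<in> carrier (k_power True I)"
    "\<And>c. c \<in> carrier (k_power True I) \<Longrightarrow> \<rho> c = c"
    using submodule_retraction[OF K.field_axioms Q.left_module_axioms] by blast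
  \<comment> \<open>Sum and product differ only in their carriers, so \<rho>, whose values have
    finite support, is also a linear map into the direct sum.\<close>
  have "\<rho> \<in> lmod_hom K (k_power False I) (k_power True I)"
    by (rule lmod_homI) (use \<rho>(2) lmod_homD(2,3)[OF \<rho>(1)] in \<open>auto simp: direct_power_simps\<close>)
  moreover have "(\<lambda>c. c) \<in> lmod_hom K (k_power True I) (k_power False I)"
    by (rule lmod_homI) (auto simp: direct_power_simps)
  ultimately have "direct_summand R N (direct_power False I M)"
    using direct_power_summand_transfer[OF N I] \<rho>(3) by blast
  then show "N \<in> Prod R M" using N by (auto simp: Prod_def direct_power_def)
next
  fix N :: "('r, 'n) module"
  assume "N \<in> Prod R M"
  then obtain I :: "('n \<Rightarrow> 'm) set" where N: "left_module R N" and I: "direct_summand R N (direct_power False I M)"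
    by (auto simp: Prod_def direct_power_def)
  interpret P: left_module K "k_power False I" by (rule left_module_k_power)
  \<comment> \<open>Taking every vector of K^I makes the spanning condition immediate, so no basis
    of K^I has to be chosen.\<close>
  define B where "B = carrier (k_power False I)"
  obtain s where "s \<in> lmod_hom K (k_power False I) (k_power True B)"
    "\<And>c. c \<in> carrier (k_power False I) \<Longrightarrow> lincomb K (k_power False I) (\<lambda>b. b) B (s c) = c"
    using dual_basis[OF K.field_axioms P.left_module_axioms, of B] submodule_subset unfolding B_def by blast
  moreover have "(\<lambda>c. lincomb K (k_power False I) (\<lambda>b. b) B c) \<in> lmod_hom K (k_power True B) (k_power False I)"
    by (rule P.lincomb_hom) (simp add: B_def)
  ultimately have "direct_summand R N (direct_power True B M)"
    using direct_power_summand_transfer[OF N I] by blast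
  \<comment> \<open>B is a set of functions on I, hence not of the index type fixed in
    \<open>Add\<close>; \<open>in_AddI\<close> absorbs the change of type.\<close>
  then show "N \<in> Add R M" using in_AddI[OF left_module_axioms N] by (simp add: direct_power_def)
qed

end

text \<open>The strictly monotone measure d plays the role of a dimension. Below a nonzero W choose
  a proper submodule X with d X as large as possible: nothing fits strictly between X and W, and
  induction on d supplies a series for X, to which W is appended.\<close>

lemma finite_lengthI:
  fixes d :: "'m set \<Rightarrow> nat" and M :: "('r, 'm, 'y) module_scheme"
  assumes null: "submodule {\<zero>\<^bsub>M\<^esub>} R M" and full: "submodule (carrier M) R M"
    and d: "\<And>U W. \<lbrakk>submodule U R M; submodule W R M; U \<subset> W\<rbrakk> \<Longrightarrow> d U < d W"
  shows "finite_length R M"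
proof -
  have "\<exists>(n::nat) U. U 0 = {\<zero>\<^bsub>M\<^esub>} \<and> U n = W \<and> (\<forall>i\<le>n. submodule (U i) R M) \<and>
     (\<forall>i<n. U i \<subset> U (Suc i) \<and> \<not> (\<exists>X. submodule X R M \<and> U i \<subset> X \<and> X \<subset> U (Suc i)))"
    if "submodule W R M" for W
    using that
  proof (induction "d W" arbitrary: W rule: less_induct)
    case less
    show ?case
    proof (cases "W = {\<zero>\<^bsub>M\<^esub>}")
      case True
      then show ?thesis using null by (intro exI[of _ 0] exI[of _ "\<lambda>_. {\<zero>\<^bsub>M\<^esub>}"]) auto
    next
      case False
      let ?P = "\<lambda>X. submodule X R M \<and> X \<subset> W"
      have "?P {\<zero>\<^bsub>M\<^esub>}" using False null submodule_zero[OF less.prems] by blast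
      moreover have "\<forall>X. ?P X \<longrightarrow> d X < d W" using d less.prems by blast
      ultimately obtain X where X: "?P X" and max: "\<And>Y. ?P Y \<Longrightarrow> d Y \<le> d X"
        using ex_has_greatest_nat[of ?P "{\<zero>\<^bsub>M\<^esub>}" d "d W"] by (metis less_imp_le)
      have gap: "\<not> (\<exists>Y. submodule Y R M \<and> X \<subset> Y \<and> Y \<subset> W)"
        using max d X by (meson leD)
      have "d X < d W" using d X less.prems by blast
      from less.hyps[OF this] X obtain n U where U: "U 0 = {\<zero>\<^bsub>M\<^esub>}" "U (n::nat) = X"
        "\<And>i. i \<le> n \<Longrightarrow> submodule (U i) R M"
        "\<And>i. i < n \<Longrightarrow> U i \<subset> U (Suc i) \<and> \<not> (\<exists>X. submodule X R M \<and> U i \<subset> X \<and> X \<subset> U (Suc i))"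
        by blast
      define U' where "U' i = (if i \<le> n then U i else W)" for i
      have "U' 0 = {\<zero>\<^bsub>M\<^esub>}" "U' (Suc n) = W" by (simp_all add: U'_def U)
      moreover have "submodule (U' i) R M" for i using U less.prems by (simp add: U'_def)
      moreover have "U' i \<subset> U' (Suc i) \<and> \<not> (\<exists>X. submodule X R M \<and> U' i \<subset> X \<and> X \<subset> U' (Suc i))"
        if "i < Suc n" for i
      proof (cases "i = n")
        case True
        then have "U' i = X" "U' (Suc i) = W" by (simp_all add: U'_def U)
        then show ?thesis using gap X by simp
      next
        case False
        then have "i < n" "U' i = U i" "U' (Suc i) = U (Suc i)" using that by (simp_all add: U'_def)
        then show ?thesis using U(4) by simp
      qed
      ultimately show ?thesis by blast
    qed
  qed
  from this[OF full] show ?thesis unfolding finite_length_def by blast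
qed

text \<open>The positions of the leading coordinates play the role of the dimension of a subspace.\<close>

definition leading_positions :: "('l, 'w) ring_scheme \<Rightarrow> nat \<Rightarrow> (nat \<Rightarrow> 'm \<Rightarrow> 'l) \<Rightarrow> 'm set \<Rightarrow> nat set" where
  "leading_positions K n lam U = {j. j < n \<and> (\<exists>u\<in>U. lam j u \<noteq> \<zero>\<^bsub>K\<^esub> \<and> (\<forall>i<j. lam i u = \<zero>\<^bsub>K\<^esub>))}"

text \<open>Gaussian elimination: if w in W has leading position j, some u in U has it too, and
  subtracting a multiple of u moves the leading position of w further to the right without affecting
  membership in U.\<close>

lemma subspace_eq_if_leading_positions:
  assumes K: "field K" and V: "left_module K V"
    and hom: "\<And>j. j < n \<Longrightarrow> lam j \<in> lmod_hom K V (self_module K)"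
    and sep: "\<And>v. \<lbrakk>v \<in> carrier V; \<And>j. j < n \<Longrightarrow> lam j v = \<zero>\<^bsub>K\<^esub>\<rbrakk> \<Longrightarrow> v = \<zero>\<^bsub>V\<^esub>"
    and U: "submodule U K V" and W: "submodule W K V" and "U \<subseteq> W"
    and lead: "leading_positions K n lam W \<subseteq> leading_positions K n lam U"
  shows "U = W"
proof -
  interpret K: field K by fact
  interpret V: left_module K V by fact
  note Wc = subsetD[OF submodule_subset[OF W]]
  \<comment> \<open>The induction descends from j = n, where all coordinates vanish and separation
    gives w = 0, to j = 0, where the condition is empty and the claim reads W \<subseteq> U.\<close>
  have "\<forall>w\<in>W. (\<forall>i<j. lam i w = \<zero>\<^bsub>K\<^esub>) \<longrightarrow> w \<in> U" if "j \<le> n" for j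
    using that
  proof (induction rule: inc_induct)
    case base
    show ?case using sep Wc submodule_zero[OF U] by metis
  next
    case (step j)
    show ?case
    proof (intro ballI impI)
      fix w assume w: "w \<in> W" and z: "\<forall>i<j. lam i w = \<zero>\<^bsub>K\<^esub>"
      show "w \<in> U"
      proof (cases "lam j w = \<zero>\<^bsub>K\<^esub>")
        case True
        then have "\<forall>i<Suc j. lam i w = \<zero>\<^bsub>K\<^esub>" using z less_Suc_eq by auto
        then show ?thesis using step.IH w by blast
      next
        case False
        then have "j \<in> leading_positions K n lam W"
          using w z step.hyps by (auto simp: leading_positions_def)
        then obtain u where u: "u \<in> U" "lam j u \<noteq> \<zero>\<^bsub>K\<^esub>" "\<forall>i<j. lam i u = \<zero>\<^bsub>K\<^esub>"
          using lead by (auto simp: leading_positions_def)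
        have uV: "u \<in> carrier V" and wV: "w \<in> carrier V" using Wc u(1) w \<open>U \<subseteq> W\<close> by auto
        have lc: "lam i v \<in> carrier K" if "i < n" "v \<in> carrier V" for i v
          using lmod_homD(1)[OF hom[OF that(1)] that(2)] by simp
        have "j < n" using step.hyps by simp
        have unit: "lam j u \<in> Units K" using lc[OF \<open>j < n\<close> uV] u(2) K.field_Units by blast
        \<comment> \<open>The factor that cancels coordinate j; the coordinates before j are zero
          for both w and u and stay zero.\<close>
        define c where "c = lam j w \<otimes>\<^bsub>K\<^esub> inv\<^bsub>K\<^esub> (lam j u)"
        have c: "c \<in> carrier K" using unit lc[OF \<open>j < n\<close> wV] by (simp add: c_def)
        have cu: "c \<odot>\<^bsub>V\<^esub> u \<in> U" using submodule.smult_closed[OF U c u(1)] .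
        have cuV: "c \<odot>\<^bsub>V\<^esub> u \<in> carrier V" using V.lm_closed[OF c uV] .
        define w' where "w' = w \<oplus>\<^bsub>V\<^esub> \<ominus>\<^bsub>V\<^esub> (c \<odot>\<^bsub>V\<^esub> u)"
        have w': "w' \<in> W"
          unfolding w'_def using w cu \<open>U \<subseteq> W\<close> by (intro submodule_add[OF W] submodule_minus[OF W]) auto
        have val: "lam i w' = lam i w \<oplus>\<^bsub>K\<^esub> \<ominus>\<^bsub>K\<^esub> (c \<otimes>\<^bsub>K\<^esub> lam i u)" if "i < n" for i
        proof -
          have "lam i (\<ominus>\<^bsub>V\<^esub> (c \<odot>\<^bsub>V\<^esub> u)) = \<ominus>\<^bsub>K\<^esub> (lam i (c \<odot>\<^bsub>V\<^esub> u))"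
            using lmod_hom_minus[OF hom[OF that] V.abelian_group_axioms _ cuV] K.is_abelian_group
            by (simp add: self_module_def)
          then show ?thesis
            using lmod_homD(2)[OF hom[OF that] wV V.M.a_inv_closed[OF cuV]]
              lmod_homD(3)[OF hom[OF that] c uV] by (simp add: w'_def)
        qed
        have "lam i w' = \<zero>\<^bsub>K\<^esub>" if "i < Suc j" for i
        proof (cases "i = j")
          case True
          have "c \<otimes>\<^bsub>K\<^esub> lam j u = lam j w"
            unfolding c_def using unit lc[OF \<open>j < n\<close> wV] lc[OF \<open>j < n\<close> uV] by (simp add: K.m_assoc)
          then show ?thesis using val[OF \<open>j < n\<close>] lc[OF \<open>j < n\<close> wV] True by (simp add: K.r_neg)
        next
          case False
          then have "i < j" using that by simp
          then show ?thesis using val[of i] z u(3) c \<open>j < n\<close> by simp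
        qed
        then have "w' \<in> U" using step.IH w' by blast
        moreover have "w = w' \<oplus>\<^bsub>V\<^esub> c \<odot>\<^bsub>V\<^esub> u"
          unfolding w'_def using wV cuV by (simp add: V.M.a_assoc V.M.l_neg)
        ultimately show ?thesis using submodule_add[OF U] cu by simp
      qed
    qed
  qed
  from this[of 0] show ?thesis using \<open>U \<subseteq> W\<close> by blast
qed

text \<open>By \<open>smult_commute\<close>, multiplication by a scalar of K is R-linear. Restricted
  to \<open>carrier M\<close>, it becomes an element of the endomorphism ring, whose members are
  extensional.\<close>

lemma (in fd_bimodule) submodule_End_ring:
  assumes U: "submodule U (End_ring R M) (with_smult M (\<lambda>f x. f x))"
  shows "submodule U K V"
proof (rule V.submodule_criterion)
  show "U \<subseteq> carrier V" "\<zero>\<^bsub>V\<^esub> \<in> U" using submodule_subset[OF U] submodule_zero[OF U] by simp_all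
  show "x \<oplus>\<^bsub>V\<^esub> y \<in> U" if "x \<in> U" "y \<in> U" for x y using submodule_add[OF U that] by simp
  show "c \<odot>\<^bsub>V\<^esub> x \<in> U" if c: "c \<in> carrier K" and x: "x \<in> U" for c x
  proof -
    have "(\<lambda>x\<in>carrier M. sc c x) \<in> lmod_hom R M M"
      by (rule lmod_homI)
        (use c V.lm_closed[of c] V.lm_r_distr[of c] smult_commute lm_closed in auto)
    then have "(\<lambda>x\<in>carrier M. sc c x) \<in> carrier (End_ring R M)" by (simp add: End_ring_def)
    then show ?thesis using submodule.smult_closed[OF U _ x] submodule_subset[OF U] x by fastforce
  qed
qed

theorem (in fd_bimodule) endofinite: "endofinite R M"
proof -
  obtain S s where S: "finite S" "S \<subseteq> carrier M" and s: "s \<in> lmod_hom K V (k_power True S)"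
    and sum: "\<And>v. v \<in> carrier M \<Longrightarrow> finsum M (\<lambda>e. sc (s v e) e) S = v"
    using finite_dual_basis by blast
  obtain h where h: "bij_betw h {0..<card S} S" using ex_bij_betw_nat_finite[OF S(1)] by blast
  define n where "n = card S"
  \<comment> \<open>The coordinate functionals of the dual basis in some enumeration of S. They
    separate points because v is recovered from its coordinates; the order is arbitrary but must be
    fixed for leading positions to make sense.\<close>
  define lam where "lam j v = s v (h j)" for j v
  have hS: "h j \<in> S" if "j < n" for j using h that unfolding n_def by (auto dest: bij_betwE)
  have hom: "lam j \<in> lmod_hom K V (self_module K)" if "j < n" for j
    unfolding lam_def by (rule lmod_hom_comp[OF s direct_power_projection[OF hS[OF that]]])
  have sep: "v = \<zero>\<^bsub>V\<^esub>" if v: "v \<in> carrier V" and z: "\<And>j. j < n \<Longrightarrow> lam j v = \<zero>\<^bsub>K\<^esub>" for v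
  proof -
    have "s v e = \<zero>\<^bsub>K\<^esub>" if "e \<in> S" for e
      using that h z unfolding n_def lam_def bij_betw_def by force
    then have "finsum M (\<lambda>e. sc (s v e) e) S = finsum M (\<lambda>e. \<zero>\<^bsub>M\<^esub>) S"
      using S(2) V.smult_l_null by (intro finsum_cong') auto
    then show ?thesis using sum v by simp
  qed
  let ?M = "with_smult M (\<lambda>f x. f x) :: ('m \<Rightarrow> 'm, 'm) module"
  \<comment> \<open>This is read off the definition of \<open>submodule\<close>, with negatives as a
    separate premise; \<open>submodule_criterion\<close> would first require a
    \<open>left_module\<close> over the endomorphism ring.\<close>
  have sub: "submodule X (End_ring R M) ?M"
    if "X \<subseteq> carrier M" "\<zero>\<^bsub>M\<^esub> \<in> X" "\<And>x y. \<lbrakk>x \<in> X; y \<in> X\<rbrakk> \<Longrightarrow> x \<oplus>\<^bsub>M\<^esub> y \<in> X" "\<And>x. x \<in> X \<Longrightarrow> \<ominus>\<^bsub>M\<^esub> x \<in> X"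
      "\<And>f x. \<lbrakk>f \<in> lmod_hom R M M; x \<in> X\<rbrakk> \<Longrightarrow> f x \<in> X" for X
    by (intro submodule.intro subgroup.intro submodule_axioms.intro)
      (use that in \<open>auto simp: End_ring_def a_inv_def m_inv_def\<close>)
  let ?d = "\<lambda>U. card (leading_positions K n lam U)"
  have "finite_length (End_ring R M) ?M"
  proof (rule finite_lengthI[where d = ?d])
    show "submodule {\<zero>\<^bsub>?M\<^esub>} (End_ring R M) ?M"
      using lmod_hom_zero[OF _ abelian_group_axioms abelian_group_axioms] by (auto intro!: sub)
    show "submodule (carrier ?M) (End_ring R M) ?M"
      using lmod_homD(1) by (auto intro!: sub)
    fix U W assume UW: "submodule U (End_ring R M) ?M" "submodule W (End_ring R M) ?M" "U \<subset> W"
    have "leading_positions K n lam U \<subset> leading_positions K n lam W"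
    proof
      show "leading_positions K n lam U \<subseteq> leading_positions K n lam W"
        using UW(3) unfolding leading_positions_def by blast
      show "leading_positions K n lam U \<noteq> leading_positions K n lam W"
        using subspace_eq_if_leading_positions[where n = n and lam = lam, OF K.field_axioms V.left_module_axioms hom sep
            submodule_End_ring[OF UW(1)] submodule_End_ring[OF UW(2)]] UW(3) by blast
    qed
    moreover have "finite (leading_positions K n lam W)" by (simp add: leading_positions_def)
    ultimately show "?d U < ?d W" by (rule psubset_card_mono[rotated])
  qed
  then show ?thesis by (simp add: endofinite_def)
qed

section \<open>Tensor products\<close>

text \<open>These are the conditions under which \<open>tensor_lift_pure\<close> makes
  \<open>tensor_lift\<close> meaningful. The target is written multiplicatively like
  \<open>tensor_group\<close>; additive targets enter through \<open>add_monoid\<close>.\<close>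

definition balanced ::
  "('r, 'z) ring_scheme \<Rightarrow> ('r, 'm, 'x) module_scheme \<Rightarrow> ('r, 'n, 'y) module_scheme \<Rightarrow>
   ('p, 'w) monoid_scheme \<Rightarrow> ('m \<Rightarrow> 'n \<Rightarrow> 'p) \<Rightarrow> bool" where
  "balanced R M N P f \<longleftrightarrow>
     (\<forall>x\<in>carrier M. \<forall>y\<in>carrier N. f x y \<in> carrier P) \<and>
     (\<forall>x\<in>carrier M. \<forall>x'\<in>carrier M. \<forall>y\<in>carrier N. f (x \<oplus>\<^bsub>M\<^esub> x') y = f x y \<otimes>\<^bsub>P\<^esub> f x' y) \<and>
     (\<forall>x\<in>carrier M. \<forall>y\<in>carrier N. \<forall>y'\<in>carrier N. f x (y \<oplus>\<^bsub>N\<^esub> y') = f x y \<otimes>\<^bsub>P\<^esub> f x y') \<and>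
     (\<forall>r\<in>carrier R. \<forall>x\<in>carrier M. \<forall>y\<in>carrier N. f (r \<odot>\<^bsub>M\<^esub> x) y = f x (r \<odot>\<^bsub>N\<^esub> y))"

lemma balancedI:
  assumes "\<And>x y. \<lbrakk>x \<in> carrier M; y \<in> carrier N\<rbrakk> \<Longrightarrow> f x y \<in> carrier P"
    and "\<And>x x' y. \<lbrakk>x \<in> carrier M; x' \<in> carrier M; y \<in> carrier N\<rbrakk> \<Longrightarrow>
      f (x \<oplus>\<^bsub>M\<^esub> x') y = f x y \<otimes>\<^bsub>P\<^esub> f x' y"
    and "\<And>x y y'. \<lbrakk>x \<in> carrier M; y \<in> carrier N; y' \<in> carrier N\<rbrakk> \<Longrightarrow>
      f x (y \<oplus>\<^bsub>N\<^esub> y') = f x y \<otimes>\<^bsub>P\<^esub> f x y'"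
    and "\<And>r x y. \<lbrakk>r \<in> carrier R; x \<in> carrier M; y \<in> carrier N\<rbrakk> \<Longrightarrow> f (r \<odot>\<^bsub>M\<^esub> x) y = f x (r \<odot>\<^bsub>N\<^esub> y)"
  shows "balanced R M N P f"
  using assms by (simp add: balanced_def)

lemma balancedD:
  assumes "balanced R M N P f"
  shows "\<And>x y. \<lbrakk>x \<in> carrier M; y \<in> carrier N\<rbrakk> \<Longrightarrow> f x y \<in> carrier P"
    and "\<And>x x' y. \<lbrakk>x \<in> carrier M; x' \<in> carrier M; y \<in> carrier N\<rbrakk> \<Longrightarrow>
      f (x \<oplus>\<^bsub>M\<^esub> x') y = f x y \<otimes>\<^bsub>P\<^esub> f x' y"
    and "\<And>x y y'. \<lbrakk>x \<in> carrier M; y \<in> carrier N; y' \<in> carrier N\<rbrakk> \<Longrightarrow>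
      f x (y \<oplus>\<^bsub>N\<^esub> y') = f x y \<otimes>\<^bsub>P\<^esub> f x y'"
    and "\<And>r x y. \<lbrakk>r \<in> carrier R; x \<in> carrier M; y \<in> carrier N\<rbrakk> \<Longrightarrow> f (r \<odot>\<^bsub>M\<^esub> x) y = f x (r \<odot>\<^bsub>N\<^esub> y)"
  using assms by (simp_all add: balanced_def)

lemma balanced_comp:
  assumes "balanced R M N P f" and "h \<in> hom P Q"
  shows "balanced R M N Q (\<lambda>x y. h (f x y))"
  using balancedD[OF assms(1)] assms(2) by (auto simp: balanced_def hom_mult hom_in_carrier)

lemma tensor_simps [simp]:
  "carrier (tensor R M N) = carrier (tensor_group R M N)"
  "ring.add (tensor R M N) = monoid.mult (tensor_group R M N)"
  "\<zero>\<^bsub>tensor R M N\<^esub> = \<one>\<^bsub>tensor_group R M N\<^esub>"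
  by (simp_all add: tensor_def)

text \<open>Asking only for additive groups with closed scalar actions allows the locale to be
  entered before the module laws are established for factors such as \<open>tensor k A A\<close>,
  \<open>ext_module\<close> or \<open>KG\<close> with its right action through \<alpha>.\<close>

locale tensor_pair =
  fixes R :: "('r, 'z) ring_scheme" and M :: "('r, 'm, 'x) module_scheme"
    and N :: "('r, 'n, 'y) module_scheme"
  assumes abelian_M: "abelian_group M" and abelian_N: "abelian_group N"
    and smult_M: "\<And>r x. \<lbrakk>r \<in> carrier R; x \<in> carrier M\<rbrakk> \<Longrightarrow> r \<odot>\<^bsub>M\<^esub> x \<in> carrier M"
    and smult_N: "\<And>r y. \<lbrakk>r \<in> carrier R; y \<in> carrier N\<rbrakk> \<Longrightarrow> r \<odot>\<^bsub>N\<^esub> y \<in> carrier N"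
begin

sublocale M: abelian_group M by (rule abelian_M)
sublocale N: abelian_group N by (rule abelian_N)

abbreviation "F \<equiv> free_Abelian_group (carrier M \<times> carrier N)"
abbreviation "H \<equiv> tensor_null R M N"
abbreviation "T \<equiv> tensor_group R M N"
abbreviation "p \<equiv> pure R M N"

sublocale F: comm_group F by (rule abelian_free_Abelian_group)

lemma frag_diff_closed: "\<lbrakk>a \<in> carrier F; b \<in> carrier F\<rbrakk> \<Longrightarrow> a - b \<in> carrier F"
  using Poly_Mapping.keys_diff[of a b] by auto

lemma frag_of_closed: "\<lbrakk>x \<in> carrier M; y \<in> carrier N\<rbrakk> \<Longrightarrow> frag_of (x, y) \<in> carrier F"
  by (simp add: keys_frag_of)

lemma subgroup_H: "subgroup H F"
  unfolding tensor_null_def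
proof (rule F.generate_is_subgroup, intro Un_least subsetI; elim CollectE exE conjE; hypsubst)
qed (intro frag_diff_closed frag_of_closed; simp add: smult_M smult_N)+

sublocale H: normal H F by (rule F.subgroup_imp_normal[OF subgroup_H])

sublocale T: comm_group T
  unfolding tensor_group_def by (rule F.abelian_FactGroup[OF subgroup_H])

lemma proj_hom: "(\<lambda>c. H #>\<^bsub>F\<^esub> c) \<in> hom F T"
  unfolding tensor_group_def by (rule H.r_coset_hom_Mod)

lemma pure_closed [simp]: "\<lbrakk>x \<in> carrier M; y \<in> carrier N\<rbrakk> \<Longrightarrow> p x y \<in> carrier T"
  unfolding pure_def using hom_in_carrier[OF proj_hom] frag_of_closed by blast

lemma proj_diff:
  assumes "a \<in> carrier F" "b \<in> carrier F"
  shows "H #>\<^bsub>F\<^esub> (a - b) = (H #>\<^bsub>F\<^esub> a) \<otimes>\<^bsub>T\<^esub> inv\<^bsub>T\<^esub> (H #>\<^bsub>F\<^esub> b)"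
proof -
  interpret h: group_hom F T "\<lambda>c. H #>\<^bsub>F\<^esub> c"
    by (intro group_hom.intro group_hom_axioms.intro proj_hom F.is_group T.is_group)
  have "a - b = a \<otimes>\<^bsub>F\<^esub> inv\<^bsub>F\<^esub> b" using assms by simp
  then show ?thesis using h.hom_mult[of a "inv\<^bsub>F\<^esub> b"] h.hom_inv[OF assms(2)] assms F.inv_closed by presburger
qed

text \<open>The cases follow \<open>frag_induction\<close>: the free abelian group is exhausted from
  zero and the generators by differences, so one case covers both sums and negatives.\<close>

lemma tensor_induct [consumes 1, case_names one pure diff]:
  assumes "u \<in> carrier T" "Q \<one>\<^bsub>T\<^esub>" "\<And>x y. \<lbrakk>x \<in> carrier M; y \<in> carrier N\<rbrakk> \<Longrightarrow> Q (p x y)"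
    and diff: "\<And>u v. \<lbrakk>u \<in> carrier T; v \<in> carrier T; Q u; Q v\<rbrakk> \<Longrightarrow> Q (u \<otimes>\<^bsub>T\<^esub> inv\<^bsub>T\<^esub> v)"
  shows "Q u"
proof -
  obtain c where c: "c \<in> carrier F" "u = H #>\<^bsub>F\<^esub> c"
    using assms(1) unfolding tensor_group_def carrier_FactGroup by blast
  have "Poly_Mapping.keys c \<subseteq> carrier M \<times> carrier N" using c(1) by simp
  then have "c \<in> carrier F \<and> Q (H #>\<^bsub>F\<^esub> c)"
  proof (induction rule: frag_induction)
    case zero
    then show ?case using assms(2) hom_one[OF proj_hom F.is_group T.is_group] by simp
  next
    case (one z)
    then show ?case using assms(3) by (cases z) (auto simp: pure_def keys_frag_of)
  next
    case (diff a b)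
    then show ?case
      using frag_diff_closed[of a b] proj_diff[of a b] hom_in_carrier[OF proj_hom] assms(4) by simp
  qed
  then show ?thesis using c(2) by simp
qed

lemma hom_eqI:
  assumes h: "h \<in> hom T P" and h': "h' \<in> hom T P" and P: "group P"
    and eq: "\<And>x y. \<lbrakk>x \<in> carrier M; y \<in> carrier N\<rbrakk> \<Longrightarrow> h (p x y) = h' (p x y)" and u: "u \<in> carrier T"
  shows "h u = h' u"
  using u
proof (induction rule: tensor_induct)
  interpret h: group_hom T P h by (intro group_hom.intro group_hom_axioms.intro h P T.is_group)
  interpret h': group_hom T P h' by (intro group_hom.intro group_hom_axioms.intro h' P T.is_group)
  case one
  show ?case by simp
next
  interpret h: group_hom T P h by (intro group_hom.intro group_hom_axioms.intro h P T.is_group)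
  interpret h': group_hom T P h' by (intro group_hom.intro group_hom_axioms.intro h' P T.is_group)
  case (diff u v)
  then show ?case by simp
qed (rule eq)

lemma lift_hom: "\<lbrakk>comm_group P; balanced R M N P f\<rbrakk> \<Longrightarrow> tensor_lift P f \<in> hom T P"
  by (rule tensor_lift_pure(1)[OF _ abelian_M abelian_N smult_M smult_N]) (auto dest: balancedD)

lemma lift_pure:
  "\<lbrakk>comm_group P; balanced R M N P f; x \<in> carrier M; y \<in> carrier N\<rbrakk> \<Longrightarrow> tensor_lift P f (p x y) = f x y"
  by (rule tensor_lift_pure(2)[OF _ abelian_M abelian_N smult_M smult_N]) (auto dest: balancedD)

lemma lift_closed: "\<lbrakk>comm_group P; balanced R M N P f; u \<in> carrier T\<rbrakk> \<Longrightarrow> tensor_lift P f u \<in> carrier P"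
  using lift_hom hom_in_carrier by metis

lemma lift_mult:
  "\<lbrakk>comm_group P; balanced R M N P f; u \<in> carrier T; v \<in> carrier T\<rbrakk> \<Longrightarrow>
    tensor_lift P f (u \<otimes>\<^bsub>T\<^esub> v) = tensor_lift P f u \<otimes>\<^bsub>P\<^esub> tensor_lift P f v"
  using lift_hom hom_mult by metis

lemma lift_unique:
  assumes "comm_group P" "balanced R M N P f" "h \<in> hom T P"
    "\<And>x y. \<lbrakk>x \<in> carrier M; y \<in> carrier N\<rbrakk> \<Longrightarrow> h (p x y) = f x y" "u \<in> carrier T"
  shows "h u = tensor_lift P f u"
  by (rule hom_eqI[OF assms(3) lift_hom[OF assms(1,2)] comm_group.axioms(2)[OF assms(1)] _ assms(5)])
    (use assms in \<open>auto simp: lift_pure\<close>)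

text \<open>All arguments in the bilinearity laws stay in the carriers, so g is balanced as well,
  and uniqueness of the lift applies. This permits rewriting under \<open>tensor_lift\<close>, whose
  definition picks an arbitrary representative.\<close>

lemma lift_cong:
  assumes "comm_group P" "balanced R M N P f"
    "\<And>x y. \<lbrakk>x \<in> carrier M; y \<in> carrier N\<rbrakk> \<Longrightarrow> g x y = f x y" "u \<in> carrier T"
  shows "tensor_lift P g u = tensor_lift P f u"
proof -
  have g: "balanced R M N P g"
    by (rule balancedI) (use balancedD[OF assms(2)] assms(3) smult_M smult_N in auto)
  show ?thesis
    by (rule lift_unique[OF assms(1,2) lift_hom[OF assms(1) g] _ assms(4)])
      (use assms(3) lift_pure[OF assms(1) g] in simp)
qed

text \<open>Both sides are homomorphisms with the same values on pure tensors. Together with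
  \<open>lift_cong\<close> this takes the place of Sweedler notation: a homomorphism is moved inside
  a sum over tensor terms, and the terms are then rewritten.\<close>

lemma lift_comp:
  assumes "comm_group P" "comm_group Q" "balanced R M N P f" "h \<in> hom P Q" "u \<in> carrier T"
  shows "h (tensor_lift P f u) = tensor_lift Q (\<lambda>x y. h (f x y)) u"
proof (rule lift_unique[OF assms(2) balanced_comp[OF assms(3,4)] _ _ assms(5)])
  show "(\<lambda>u. h (tensor_lift P f u)) \<in> hom T Q"
    using hom_compose[OF lift_hom[OF assms(1,3)] assms(4)] by (simp add: comp_def)
  show "h (tensor_lift P f (p x y)) = h (f x y)" if "x \<in> carrier M" "y \<in> carrier N" for x y
    using lift_pure[OF assms(1,3)] that by simp
qed

lemma lift_add:
  assumes P: "comm_group P" and f: "balanced R M N P f" and g: "balanced R M N P g" and u: "u \<in> carrier T"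
  shows "tensor_lift P (\<lambda>x y. f x y \<otimes>\<^bsub>P\<^esub> g x y) u = tensor_lift P f u \<otimes>\<^bsub>P\<^esub> tensor_lift P g u"
proof -
  interpret P: comm_group P by fact
  note D = balancedD[OF f] balancedD[OF g]
  have "balanced R M N P (\<lambda>x y. f x y \<otimes>\<^bsub>P\<^esub> g x y)"
    by (rule balancedI) (use D in \<open>simp_all add: P.m_ac smult_M smult_N\<close>)
  then show ?thesis
    by (intro lift_unique[OF P _ _ _ u, symmetric])
      (auto simp: hom_def lift_closed[OF P] lift_mult[OF P] lift_pure[OF P] f g P.m_ac)
qed

text \<open>Every defining relation lies in \<open>tensor_null\<close>, so its coset is trivial. The
  facts \<open>eq\<close> and \<open>eq2\<close> turn relations with two and three terms into
  equations between cosets.\<close>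

lemma balanced_pure: "balanced R M N T p"
proof -
  let ?rel = "{frag_of (x \<oplus>\<^bsub>M\<^esub> x', y) - frag_of (x, y) - frag_of (x', y) | x x' y.
        x \<in> carrier M \<and> x' \<in> carrier M \<and> y \<in> carrier N} \<union>
     {frag_of (x, y \<oplus>\<^bsub>N\<^esub> y') - frag_of (x, y) - frag_of (x, y') | x y y'.
        x \<in> carrier M \<and> y \<in> carrier N \<and> y' \<in> carrier N} \<union>
     {frag_of (r \<odot>\<^bsub>M\<^esub> x, y) - frag_of (x, r \<odot>\<^bsub>N\<^esub> y) | r x y.
        r \<in> carrier R \<and> x \<in> carrier M \<and> y \<in> carrier N}"
  have rel: "H #>\<^bsub>F\<^esub> c = \<one>\<^bsub>T\<^esub>" if "c \<in> ?rel" for c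
  proof -
    have "c \<in> generate F ?rel" using that by (rule generate.incl)
    then have c: "c \<in> H" unfolding tensor_null_def .
    have "H #>\<^bsub>F\<^esub> c = H" by (rule F.coset_join2[OF H.mem_carrier[OF c] subgroup_H c])
    then show ?thesis by (simp add: tensor_group_def)
  qed
  have eq: "H #>\<^bsub>F\<^esub> a = H #>\<^bsub>F\<^esub> b" if "a \<in> carrier F" "b \<in> carrier F" "a - b \<in> ?rel" for a b
  proof -
    have "(H #>\<^bsub>F\<^esub> a) \<otimes>\<^bsub>T\<^esub> inv\<^bsub>T\<^esub> (H #>\<^bsub>F\<^esub> b) = \<one>\<^bsub>T\<^esub>"
      using rel[OF that(3)] proj_diff[OF that(1,2)] by simp
    moreover have "H #>\<^bsub>F\<^esub> a \<in> carrier T" "H #>\<^bsub>F\<^esub> b \<in> carrier T"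
      using hom_in_carrier[OF proj_hom] that(1,2) by blast+
    ultimately show ?thesis
      using T.inv_equality[of "H #>\<^bsub>F\<^esub> a" "inv\<^bsub>T\<^esub> (H #>\<^bsub>F\<^esub> b)"] by simp
  qed
  have eq2: "H #>\<^bsub>F\<^esub> a = (H #>\<^bsub>F\<^esub> b) \<otimes>\<^bsub>T\<^esub> (H #>\<^bsub>F\<^esub> c)"
    if "a \<in> carrier F" "b \<in> carrier F" "c \<in> carrier F" "a - b - c \<in> ?rel" for a b c
  proof -
    have "a - b - c = a - (b + c)" by simp
    then have "H #>\<^bsub>F\<^esub> a = H #>\<^bsub>F\<^esub> (b \<otimes>\<^bsub>F\<^esub> c)"
      using eq[of a "b + c"] that F.m_closed[OF that(2,3)] unfolding mult_free_Abelian_group by metis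
    then show ?thesis using hom_mult[OF proj_hom that(2,3)] by simp
  qed
  show ?thesis
    unfolding pure_def
  proof (rule balancedI)
    show "H #>\<^bsub>F\<^esub> frag_of (x, y) \<in> carrier T" if "x \<in> carrier M" "y \<in> carrier N" for x y
      using hom_in_carrier[OF proj_hom frag_of_closed[OF that]] .
    show "H #>\<^bsub>F\<^esub> frag_of (x \<oplus>\<^bsub>M\<^esub> x', y) = (H #>\<^bsub>F\<^esub> frag_of (x, y)) \<otimes>\<^bsub>T\<^esub> (H #>\<^bsub>F\<^esub> frag_of (x', y))"
      if "x \<in> carrier M" "x' \<in> carrier M" "y \<in> carrier N" for x x' y
      by (rule eq2) (use that in \<open>auto intro!: frag_of_closed simp del: carrier_free_Abelian_group_iff\<close>)
    show "H #>\<^bsub>F\<^esub> frag_of (x, y \<oplus>\<^bsub>N\<^esub> y') = (H #>\<^bsub>F\<^esub> frag_of (x, y)) \<otimes>\<^bsub>T\<^esub> (H #>\<^bsub>F\<^esub> frag_of (x, y'))"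
      if "x \<in> carrier M" "y \<in> carrier N" "y' \<in> carrier N" for x y y'
      by (rule eq2) (use that in \<open>auto intro!: frag_of_closed simp del: carrier_free_Abelian_group_iff\<close>)
    show "H #>\<^bsub>F\<^esub> frag_of (r \<odot>\<^bsub>M\<^esub> x, y) = H #>\<^bsub>F\<^esub> frag_of (x, r \<odot>\<^bsub>N\<^esub> y)"
      if "r \<in> carrier R" "x \<in> carrier M" "y \<in> carrier N" for r x y
      by (rule eq) (use that in \<open>auto intro!: frag_of_closed smult_M smult_N simp del: carrier_free_Abelian_group_iff\<close>)
  qed
qed

lemma abelian_group_tensor: "abelian_group (tensor R M N)"
  unfolding abelian_group_iff_comm_group
  using comm_group_cong[of "add_monoid (tensor R M N)" T] T.comm_group_axioms by simp

end

section \<open>Convolution algebras\<close>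

lemma ext_module_simps [simp]:
  "carrier (ext_module K \<iota>) = carrier K" "\<zero>\<^bsub>ext_module K \<iota>\<^esub> = \<zero>\<^bsub>K\<^esub>"
  "ring.add (ext_module K \<iota>) = ring.add K" "r \<odot>\<^bsub>ext_module K \<iota>\<^esub> x = \<iota> r \<otimes>\<^bsub>K\<^esub> x"
  by (simp_all add: ext_module_def)

lemma tensor_smult:
  "r \<odot>\<^bsub>tensor R M N\<^esub> u = tensor_lift (tensor_group R M N) (\<lambda>x y. pure R M N (r \<odot>\<^bsub>M\<^esub> x) y) u"
  by (simp add: tensor_def)

lemma (in ring) mult_left_hom: "c \<in> carrier R \<Longrightarrow> (\<lambda>x. c \<otimes> x) \<in> hom (add_monoid R) (add_monoid R)"
  by (auto simp: hom_def r_distr)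

lemma (in ring) mult_right_hom: "c \<in> carrier R \<Longrightarrow> (\<lambda>x. x \<otimes> c) \<in> hom (add_monoid R) (add_monoid R)"
  by (auto simp: hom_def l_distr)

text \<open>
  A more tractable form of the group algebra of the base change: a \<open>K\<close>-linear functional on
  \<open>K \<otimes>\<^sub>k A\<close> is the same as a \<open>k\<close>-linear map \<open>A \<rightarrow> K\<close>.
\<close>

definition conv_algebra ::
  "('k, 'z) ring_scheme \<Rightarrow> ('l, 'w) ring_scheme \<Rightarrow> ('k \<Rightarrow> 'l) \<Rightarrow> ('k, 'a, 'y) hopf_scheme \<Rightarrow> ('l, 'a \<Rightarrow> 'l) module" where
  "conv_algebra k K \<iota> A = \<lparr>carrier = lmod_hom k A (ext_module K \<iota>) \<inter> extensional (carrier A),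
     monoid.mult = (\<lambda>\<phi> \<psi>. \<lambda>a\<in>carrier A.
       tensor_lift (add_monoid K) (\<lambda>x y. \<phi> x \<otimes>\<^bsub>K\<^esub> \<psi> y) (comul A a)),
     one = (\<lambda>a\<in>carrier A. \<iota> (counit A a)),
     ring.zero = (\<lambda>a\<in>carrier A. \<zero>\<^bsub>K\<^esub>),
     ring.add = (\<lambda>\<phi> \<psi>. \<lambda>a\<in>carrier A. \<phi> a \<oplus>\<^bsub>K\<^esub> \<psi> a),
     smult = (\<lambda>c \<phi>. \<lambda>a\<in>carrier A. c \<otimes>\<^bsub>K\<^esub> \<phi> a)\<rparr>"

text \<open>The case of the trivial extension, so that a single proof of the ring laws serves both
  kG and \<open>KG\<close>.\<close>

lemma group_algebra_eq_conv_algebra: "group_algebra k A = conv_algebra k k id A"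
  by (simp add: group_algebra_def conv_algebra_def ext_module_def self_module_def)

locale base_extension = finite_group_scheme k A + K: field K
  for k :: "('k, 'z) ring_scheme" and A :: "('k, 'a, 'y) hopf_scheme" and K :: "('l, 'w) ring_scheme" +
  fixes \<iota> :: "'k \<Rightarrow> 'l"
  assumes ring_hom_\<iota>: "\<iota> \<in> ring_hom k K"
begin

abbreviation E where "E \<equiv> ext_module K \<iota>"
abbreviation C where "C \<equiv> conv_algebra k K \<iota> A"

lemma \<iota>_closed [simp]: "r \<in> carrier k \<Longrightarrow> \<iota> r \<in> carrier K"
  using ring_hom_\<iota> by (auto simp: ring_hom_def)

lemma \<iota>_mult: "\<lbrakk>r \<in> carrier k; s \<in> carrier k\<rbrakk> \<Longrightarrow> \<iota> (r \<otimes>\<^bsub>k\<^esub> s) = \<iota> r \<otimes>\<^bsub>K\<^esub> \<iota> s"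
  and \<iota>_add: "\<lbrakk>r \<in> carrier k; s \<in> carrier k\<rbrakk> \<Longrightarrow> \<iota> (r \<oplus>\<^bsub>k\<^esub> s) = \<iota> r \<oplus>\<^bsub>K\<^esub> \<iota> s"
  and \<iota>_one: "\<iota> \<one>\<^bsub>k\<^esub> = \<one>\<^bsub>K\<^esub>"
  using ring_hom_\<iota> by (auto simp: ring_hom_def)

lemma module_A: "module k A" ..

sublocale AA: tensor_pair k A A
  by unfold_locales (auto intro: smult_closed)

lemma comm_group_K: "comm_group (add_monoid K)"
  by (rule K.a_comm_group)

lemma smult_tensor_balanced:
  assumes r: "r \<in> carrier k"
  shows "balanced k A A AA.T (\<lambda>x y. AA.p (r \<odot>\<^bsub>A\<^esub> x) y)"
proof -
  note D = balancedD[OF AA.balanced_pure]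
  have "r \<odot>\<^bsub>A\<^esub> (s \<odot>\<^bsub>A\<^esub> x) = s \<odot>\<^bsub>A\<^esub> (r \<odot>\<^bsub>A\<^esub> x)" if "s \<in> carrier k" "x \<in> carrier A" for s x
    using that r by (metis smult_assoc1 base.m_comm)
  then show ?thesis
    by (intro balancedI) (use r D smult_closed smult_r_distr in simp_all)
qed

lemma smult_tensor_pure:
  "\<lbrakk>r \<in> carrier k; x \<in> carrier A; y \<in> carrier A\<rbrakk> \<Longrightarrow>
    r \<odot>\<^bsub>tensor k A A\<^esub> AA.p x y = AA.p (r \<odot>\<^bsub>A\<^esub> x) y"
  unfolding tensor_smult by (rule AA.lift_pure[OF AA.T.comm_group_axioms smult_tensor_balanced])

lemma smult_tensor_closed: "\<lbrakk>r \<in> carrier k; u \<in> carrier AA.T\<rbrakk> \<Longrightarrow> r \<odot>\<^bsub>tensor k A A\<^esub> u \<in> carrier AA.T"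
  unfolding tensor_smult by (rule AA.lift_closed[OF AA.T.comm_group_axioms smult_tensor_balanced])

sublocale AAA: tensor_pair k A "tensor k A A"
  by (intro tensor_pair.intro AA.abelian_M AA.abelian_group_tensor smult_closed)
    (auto intro: smult_tensor_closed)

lemma comul_lmod_hom: "comul A \<in> lmod_hom k A (tensor k A A)"
  using comul_hom by (simp add: alg_hom_def)

lemma comul_closed: "a \<in> carrier A \<Longrightarrow> comul A a \<in> carrier AA.T"
  using lmod_homD(1)[OF comul_lmod_hom] by simp

lemma comul_add:
  "\<lbrakk>a \<in> carrier A; b \<in> carrier A\<rbrakk> \<Longrightarrow> comul A (a \<oplus>\<^bsub>A\<^esub> b) = comul A a \<otimes>\<^bsub>AA.T\<^esub> comul A b"
  using lmod_homD(2)[OF comul_lmod_hom] by simp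

lemma comul_smult:
  "\<lbrakk>r \<in> carrier k; a \<in> carrier A\<rbrakk> \<Longrightarrow>
    comul A (r \<odot>\<^bsub>A\<^esub> a) = tensor_lift AA.T (\<lambda>x y. AA.p (r \<odot>\<^bsub>A\<^esub> x) y) (comul A a)"
  using lmod_homD(3)[OF comul_lmod_hom] by (simp add: tensor_smult)

text \<open>The comultiplication is k-linear and a scalar acts on \<open>tensor k A A\<close>
  through the first factor, so r can be moved onto the first leg under any lift.\<close>

lemma lift_comul_smult:
  assumes P: "comm_group P" and f: "balanced k A A P f" and r: "r \<in> carrier k" and a: "a \<in> carrier A"
  shows "tensor_lift P f (comul A (r \<odot>\<^bsub>A\<^esub> a)) = tensor_lift P (\<lambda>x y. f (r \<odot>\<^bsub>A\<^esub> x) y) (comul A a)"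
proof -
  have "tensor_lift P f (comul A (r \<odot>\<^bsub>A\<^esub> a)) =
      tensor_lift P (\<lambda>x y. tensor_lift P f (AA.p (r \<odot>\<^bsub>A\<^esub> x) y)) (comul A a)"
    unfolding comul_smult[OF r a]
    by (rule AA.lift_comp[OF AA.T.comm_group_axioms P smult_tensor_balanced[OF r] AA.lift_hom[OF P f] comul_closed[OF a]])
  also have "\<dots> = tensor_lift P (\<lambda>x y. f (r \<odot>\<^bsub>A\<^esub> x) y) (comul A a)"
  proof (rule AA.lift_cong[OF P _ _ comul_closed[OF a]])
    show "balanced k A A P (\<lambda>x y. f (r \<odot>\<^bsub>A\<^esub> x) y)"
      using balanced_comp[OF smult_tensor_balanced[OF r] AA.lift_hom[OF P f]] AA.lift_pure[OF P f] r
      by (auto simp: balanced_def smult_closed)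
  qed (use AA.lift_pure[OF P f] r smult_closed in simp)
  finally show ?thesis .
qed

lemma functional_closed: "\<lbrakk>f \<in> lmod_hom k A E; a \<in> carrier A\<rbrakk> \<Longrightarrow> f a \<in> carrier K"
  using lmod_homD(1) by fastforce

lemma functional_add:
  "\<lbrakk>f \<in> lmod_hom k A E; a \<in> carrier A; b \<in> carrier A\<rbrakk> \<Longrightarrow> f (a \<oplus>\<^bsub>A\<^esub> b) = f a \<oplus>\<^bsub>K\<^esub> f b"
  using lmod_homD(2) by fastforce

lemma functional_smult:
  "\<lbrakk>f \<in> lmod_hom k A E; r \<in> carrier k; a \<in> carrier A\<rbrakk> \<Longrightarrow> f (r \<odot>\<^bsub>A\<^esub> a) = \<iota> r \<otimes>\<^bsub>K\<^esub> f a"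
  using lmod_homD(3) by fastforce

lemma balanced_mult:
  assumes f: "f \<in> lmod_hom k A E" and g: "g \<in> lmod_hom k A E"
  shows "balanced k A A (add_monoid K) (\<lambda>x y. f x \<otimes>\<^bsub>K\<^esub> g y)"
  by (rule balancedI)
    (use functional_closed[OF f] functional_closed[OF g] functional_add[OF f] functional_add[OF g]
      functional_smult[OF f] functional_smult[OF g]
      in \<open>simp_all add: K.l_distr K.r_distr K.m_ac\<close>)

text \<open>The product of \<open>conv_algebra\<close> before restriction to
  \<open>carrier A\<close>; calculating with it keeps extensionality out of the way.\<close>

definition conv :: "('a \<Rightarrow> 'l) \<Rightarrow> ('a \<Rightarrow> 'l) \<Rightarrow> 'a \<Rightarrow> 'l" where
  "conv f g a = tensor_lift (add_monoid K) (\<lambda>x y. f x \<otimes>\<^bsub>K\<^esub> g y) (comul A a)"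

lemma conv_cong:
  assumes "f \<in> lmod_hom k A E" "g \<in> lmod_hom k A E" "a \<in> carrier A"
    "\<And>x. x \<in> carrier A \<Longrightarrow> f' x = f x" "\<And>x. x \<in> carrier A \<Longrightarrow> g' x = g x"
  shows "conv f' g' a = conv f g a"
  unfolding conv_def
  by (rule AA.lift_cong[OF comm_group_K balanced_mult[OF assms(1,2)] _ comul_closed[OF assms(3)]])
    (use assms in simp)

lemma conv_hom:
  assumes f: "f \<in> lmod_hom k A E" and g: "g \<in> lmod_hom k A E"
  shows "conv f g \<in> lmod_hom k A E"
proof (rule lmod_homI)
  note bal = balanced_mult[OF f g]
  show "conv f g a \<in> carrier E" if "a \<in> carrier A" for a
    using AA.lift_closed[OF comm_group_K bal comul_closed[OF that]] by (simp add: conv_def)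
  show "conv f g (a \<oplus>\<^bsub>A\<^esub> b) = conv f g a \<oplus>\<^bsub>E\<^esub> conv f g b" if "a \<in> carrier A" "b \<in> carrier A" for a b
    using AA.lift_mult[OF comm_group_K bal comul_closed comul_closed] that by (simp add: conv_def comul_add)
  show "conv f g (r \<odot>\<^bsub>A\<^esub> a) = r \<odot>\<^bsub>E\<^esub> conv f g a" if r: "r \<in> carrier k" and a: "a \<in> carrier A" for r a
  proof -
    have h: "(\<lambda>x. \<iota> r \<otimes>\<^bsub>K\<^esub> x) \<in> hom (add_monoid K) (add_monoid K)" using r by (intro K.mult_left_hom) simp
    have "conv f g (r \<odot>\<^bsub>A\<^esub> a) = tensor_lift (add_monoid K) (\<lambda>x y. f (r \<odot>\<^bsub>A\<^esub> x) \<otimes>\<^bsub>K\<^esub> g y) (comul A a)"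
      unfolding conv_def by (rule lift_comul_smult[OF comm_group_K bal r a])
    also have "\<dots> = tensor_lift (add_monoid K) (\<lambda>x y. \<iota> r \<otimes>\<^bsub>K\<^esub> (f x \<otimes>\<^bsub>K\<^esub> g y)) (comul A a)"
      by (rule AA.lift_cong[OF comm_group_K balanced_comp[OF bal h] _ comul_closed[OF a]])
        (use functional_closed[OF f] functional_closed[OF g] functional_smult[OF f] r in \<open>simp add: K.m_assoc\<close>)
    also have "\<dots> = \<iota> r \<otimes>\<^bsub>K\<^esub> conv f g a"
      unfolding conv_def by (rule AA.lift_comp[OF comm_group_K comm_group_K bal h comul_closed[OF a], symmetric])
    finally show ?thesis by simp
  qed
qed

lemma add_hom:
  "\<lbrakk>f \<in> lmod_hom k A E; g \<in> lmod_hom k A E\<rbrakk> \<Longrightarrow> (\<lambda>a. f a \<oplus>\<^bsub>K\<^esub> g a) \<in> lmod_hom k A E"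
  by (rule lmod_homI) (simp_all add: functional_closed functional_add functional_smult K.a_ac K.r_distr)

lemma conv_add_left:
  assumes f: "f \<in> lmod_hom k A E" and f': "f' \<in> lmod_hom k A E" and g: "g \<in> lmod_hom k A E" and a: "a \<in> carrier A"
  shows "conv (\<lambda>a. f a \<oplus>\<^bsub>K\<^esub> f' a) g a = conv f g a \<oplus>\<^bsub>K\<^esub> conv f' g a"
proof -
  have "conv (\<lambda>a. f a \<oplus>\<^bsub>K\<^esub> f' a) g a =
      tensor_lift (add_monoid K) (\<lambda>x y. (f x \<otimes>\<^bsub>K\<^esub> g y) \<otimes>\<^bsub>add_monoid K\<^esub> (f' x \<otimes>\<^bsub>K\<^esub> g y)) (comul A a)"
    unfolding conv_def
    by (rule AA.lift_cong[symmetric, OF comm_group_K balanced_mult[OF add_hom[OF f f'] g] _ comul_closed[OF a]])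
      (simp add: K.l_distr functional_closed f f' g)
  also have "\<dots> = conv f g a \<oplus>\<^bsub>K\<^esub> conv f' g a"
    using AA.lift_add[OF comm_group_K balanced_mult[OF f g] balanced_mult[OF f' g] comul_closed[OF a]]
    by (simp add: conv_def)
  finally show ?thesis .
qed

lemma conv_add_right:
  assumes f: "f \<in> lmod_hom k A E" and g: "g \<in> lmod_hom k A E" and g': "g' \<in> lmod_hom k A E" and a: "a \<in> carrier A"
  shows "conv f (\<lambda>a. g a \<oplus>\<^bsub>K\<^esub> g' a) a = conv f g a \<oplus>\<^bsub>K\<^esub> conv f g' a"
proof -
  have "conv f (\<lambda>a. g a \<oplus>\<^bsub>K\<^esub> g' a) a =
      tensor_lift (add_monoid K) (\<lambda>x y. (f x \<otimes>\<^bsub>K\<^esub> g y) \<otimes>\<^bsub>add_monoid K\<^esub> (f x \<otimes>\<^bsub>K\<^esub> g' y)) (comul A a)"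
    unfolding conv_def
    by (rule AA.lift_cong[symmetric, OF comm_group_K balanced_mult[OF f add_hom[OF g g']] _ comul_closed[OF a]])
      (simp add: K.r_distr functional_closed f g g')
  also have "\<dots> = conv f g a \<oplus>\<^bsub>K\<^esub> conv f g' a"
    using AA.lift_add[OF comm_group_K balanced_mult[OF f g] balanced_mult[OF f g'] comul_closed[OF a]]
    by (simp add: conv_def)
  finally show ?thesis .
qed

lemma counit_lmod_hom: "counit A \<in> lmod_hom k A (self_module k)"
  using counit_hom by (simp add: alg_hom_def)

lemma counit_closed: "a \<in> carrier A \<Longrightarrow> counit A a \<in> carrier k"
  using lmod_homD(1)[OF counit_lmod_hom] by simp

lemma unit_hom: "(\<lambda>a. \<iota> (counit A a)) \<in> lmod_hom k A E"
  by (rule lmod_homI)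
    (use lmod_homD(2,3)[OF counit_lmod_hom] counit_closed in \<open>simp_all add: \<iota>_mult \<iota>_add\<close>)

lemma comm_group_A: "comm_group (add_monoid A)"
  by (rule M.a_comm_group)

lemma functional_group_hom: "f \<in> lmod_hom k A E \<Longrightarrow> f \<in> hom (add_monoid A) (add_monoid K)"
  by (simp add: hom_def functional_closed functional_add)

text \<open>This is f applied to the axiom \<open>counit_left\<close>: k-linearity of f turns the
  scalar \<open>counit A x\<close> into multiplication by its image in K.\<close>

lemma conv_unit_left:
  assumes f: "f \<in> lmod_hom k A E" and a: "a \<in> carrier A"
  shows "conv (\<lambda>a. \<iota> (counit A a)) f a = f a"
proof -
  have bal: "balanced k A A (add_monoid A) (\<lambda>x y. counit A x \<odot>\<^bsub>A\<^esub> y)"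
  proof (rule balancedI)
    show "counit A (r \<odot>\<^bsub>A\<^esub> x) \<odot>\<^bsub>A\<^esub> y = counit A x \<odot>\<^bsub>A\<^esub> (r \<odot>\<^bsub>A\<^esub> y)"
      if "r \<in> carrier k" "x \<in> carrier A" "y \<in> carrier A" for r x y
      using lmod_homD(3)[OF counit_lmod_hom that(1,2)] counit_closed[OF that(2)] that smult_assoc1 base.m_comm
      by simp metis
  qed (use lmod_homD(2)[OF counit_lmod_hom] counit_closed in
      \<open>simp_all add: smult_closed smult_l_distr smult_r_distr\<close>)
  have "f a = f (tensor_lift (add_monoid A) (\<lambda>x y. counit A x \<odot>\<^bsub>A\<^esub> y) (comul A a))"
    using counit_left[OF a] by simp
  also have "\<dots> = tensor_lift (add_monoid K) (\<lambda>x y. f (counit A x \<odot>\<^bsub>A\<^esub> y)) (comul A a)"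
    by (rule AA.lift_comp[OF comm_group_A comm_group_K bal functional_group_hom[OF f] comul_closed[OF a]])
  also have "\<dots> = conv (\<lambda>a. \<iota> (counit A a)) f a"
    unfolding conv_def
    by (rule AA.lift_cong[OF comm_group_K balanced_mult[OF unit_hom f] _ comul_closed[OF a]])
      (simp add: functional_smult[OF f] counit_closed)
  finally show ?thesis by simp
qed

lemma conv_unit_right:
  assumes f: "f \<in> lmod_hom k A E" and a: "a \<in> carrier A"
  shows "conv f (\<lambda>a. \<iota> (counit A a)) a = f a"
proof -
  have bal: "balanced k A A (add_monoid A) (\<lambda>x y. counit A y \<odot>\<^bsub>A\<^esub> x)"
  proof (rule balancedI)
    show "counit A y \<odot>\<^bsub>A\<^esub> (r \<odot>\<^bsub>A\<^esub> x) = counit A (r \<odot>\<^bsub>A\<^esub> y) \<odot>\<^bsub>A\<^esub> x"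
      if "r \<in> carrier k" "x \<in> carrier A" "y \<in> carrier A" for r x y
      using lmod_homD(3)[OF counit_lmod_hom that(1,3)] counit_closed[OF that(3)] that smult_assoc1 base.m_comm
      by simp metis
  qed (use lmod_homD(2)[OF counit_lmod_hom] counit_closed in
      \<open>simp_all add: smult_closed smult_l_distr smult_r_distr\<close>)
  have "f a = f (tensor_lift (add_monoid A) (\<lambda>x y. counit A y \<odot>\<^bsub>A\<^esub> x) (comul A a))"
    using counit_right[OF a] by simp
  also have "\<dots> = tensor_lift (add_monoid K) (\<lambda>x y. f (counit A y \<odot>\<^bsub>A\<^esub> x)) (comul A a)"
    by (rule AA.lift_comp[OF comm_group_A comm_group_K bal functional_group_hom[OF f] comul_closed[OF a]])
  also have "\<dots> = conv f (\<lambda>a. \<iota> (counit A a)) a"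
    unfolding conv_def
    by (rule AA.lift_cong[OF comm_group_K balanced_mult[OF f unit_hom] _ comul_closed[OF a]])
      (simp add: functional_smult[OF f] counit_closed functional_closed[OF f] K.m_comm)
  finally show ?thesis by simp
qed

text \<open>Both sides are values of one functional \<open>Tr\<close>, namely f \<otimes> (g
  \<otimes> h) on A \<otimes> (A \<otimes> A), at the two sides of \<open>coassoc\<close>. The work
  lies in showing that all the intermediate maps are balanced, so that \<open>Tr\<close> may be
  moved inside the lifts.\<close>

lemma conv_assoc:
  assumes f: "f \<in> lmod_hom k A E" and g: "g \<in> lmod_hom k A E" and h: "h \<in> lmod_hom k A E" and a: "a \<in> carrier A"
  shows "conv (conv f g) h a = conv f (conv g h) a"
proof -
  let ?P = "add_monoid K"
  let ?gh = "tensor_lift ?P (\<lambda>y z. g y \<otimes>\<^bsub>K\<^esub> h z)"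
  note bal_gh = balanced_mult[OF g h] and bal_fg = balanced_mult[OF f g]
  note gh_hom = AA.lift_hom[OF comm_group_K bal_gh]
  have gh_closed: "?gh w \<in> carrier K" if "w \<in> carrier AA.T" for w
    using AA.lift_closed[OF comm_group_K bal_gh that] by simp
  have gh_smult: "?gh (r \<odot>\<^bsub>tensor k A A\<^esub> w) = \<iota> r \<otimes>\<^bsub>K\<^esub> ?gh w" if r: "r \<in> carrier k" and w: "w \<in> carrier AA.T" for r w
  proof -
    have hr: "(\<lambda>x. \<iota> r \<otimes>\<^bsub>K\<^esub> x) \<in> hom ?P ?P" using r by (intro K.mult_left_hom) simp
    have "?gh (r \<odot>\<^bsub>tensor k A A\<^esub> w) = tensor_lift ?P (\<lambda>x y. ?gh (AA.p (r \<odot>\<^bsub>A\<^esub> x) y)) w"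
      unfolding tensor_smult
      by (rule AA.lift_comp[OF AA.T.comm_group_axioms comm_group_K smult_tensor_balanced[OF r] gh_hom w])
    also have "\<dots> = tensor_lift ?P (\<lambda>x y. \<iota> r \<otimes>\<^bsub>K\<^esub> (g x \<otimes>\<^bsub>K\<^esub> h y)) w"
      by (rule AA.lift_cong[OF comm_group_K balanced_comp[OF bal_gh hr] _ w])
        (use r in \<open>simp add: AA.lift_pure[OF comm_group_K bal_gh] smult_closed functional_smult[OF g]
          functional_closed g h K.m_assoc\<close>)
    also have "\<dots> = \<iota> r \<otimes>\<^bsub>K\<^esub> ?gh w"
      by (rule AA.lift_comp[OF comm_group_K comm_group_K bal_gh hr w, symmetric])
    finally show ?thesis .
  qed
  have bal3: "balanced k A (tensor k A A) ?P (\<lambda>x w. f x \<otimes>\<^bsub>K\<^esub> ?gh w)"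
    by (rule balancedI)
      (use functional_closed[OF f] functional_add[OF f] functional_smult[OF f] gh_closed gh_smult
        AA.lift_mult[OF comm_group_K bal_gh]
        in \<open>simp_all add: K.l_distr K.r_distr K.m_ac\<close>)
  define Tr where "Tr = tensor_lift ?P (\<lambda>x w. f x \<otimes>\<^bsub>K\<^esub> ?gh w)"
  have Tr_hom: "Tr \<in> hom AAA.T ?P" unfolding Tr_def by (rule AAA.lift_hom[OF comm_group_K bal3])
  have Tr_pure: "Tr (AAA.p x w) = f x \<otimes>\<^bsub>K\<^esub> ?gh w" if "x \<in> carrier A" "w \<in> carrier AA.T" for x w
    unfolding Tr_def using AAA.lift_pure[OF comm_group_K bal3] that by simp
  note pD = balancedD[OF AAA.balanced_pure, simplified] and qD = balancedD[OF AA.balanced_pure]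
  have bal_r: "balanced k A A AAA.T (\<lambda>x y. AAA.p x (comul A y))"
    by (rule balancedI)
      (use pD comul_closed comul_add lmod_homD(3)[OF comul_lmod_hom] in simp_all)
  have bal_in: "balanced k A A AAA.T (\<lambda>x1 x2. AAA.p x1 (AA.p x2 y))" if "y \<in> carrier A" for y
    by (rule balancedI) (use pD qD that smult_tensor_pure in simp_all)
  \<comment> \<open>The sum of x1 \<otimes> (x2 \<otimes> y) over the terms x1 \<otimes> x2 of the
    comultiplication of x, that is, the inner lift on the left of \<open>coassoc\<close>. It has to
    be balanced in x and y before \<open>Tr\<close> can pass through the outer lift.\<close>
  define inner where "inner x y = tensor_lift AAA.T (\<lambda>x1 x2. AAA.p x1 (AA.p x2 y)) (comul A x)" for x y
  have inner_closed: "inner x y \<in> carrier AAA.T" if "x \<in> carrier A" "y \<in> carrier A" for x y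
    unfolding inner_def using AAA.T.comm_group_axioms bal_in[OF that(2)] comul_closed[OF that(1)] by (rule AA.lift_closed)
  have bal_l: "balanced k A A AAA.T inner"
  proof (rule balancedI)
    show "inner (x \<oplus>\<^bsub>A\<^esub> x') y = inner x y \<otimes>\<^bsub>AAA.T\<^esub> inner x' y"
      if "x \<in> carrier A" "x' \<in> carrier A" "y \<in> carrier A" for x x' y
      unfolding inner_def comul_add[OF that(1,2)]
      by (rule AA.lift_mult[OF AAA.T.comm_group_axioms bal_in[OF that(3)] comul_closed[OF that(1)] comul_closed[OF that(2)]])
    show "inner x (y \<oplus>\<^bsub>A\<^esub> y') = inner x y \<otimes>\<^bsub>AAA.T\<^esub> inner x y'"
      if "x \<in> carrier A" "y \<in> carrier A" "y' \<in> carrier A" for x y y'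
    proof -
      have "inner x (y \<oplus>\<^bsub>A\<^esub> y') = tensor_lift AAA.T
          (\<lambda>x1 x2. AAA.p x1 (AA.p x2 y) \<otimes>\<^bsub>AAA.T\<^esub> AAA.p x1 (AA.p x2 y')) (comul A x)"
        unfolding inner_def
        by (rule AA.lift_cong[symmetric, OF AAA.T.comm_group_axioms bal_in _ comul_closed[OF that(1)]])
          (use that pD(3) qD(1,3) in simp_all)
      then show ?thesis
        unfolding inner_def
        using AA.lift_add[OF AAA.T.comm_group_axioms bal_in[OF that(2)] bal_in[OF that(3)] comul_closed[OF that(1)]]
        by simp
    qed
    show "inner (r \<odot>\<^bsub>A\<^esub> x) y = inner x (r \<odot>\<^bsub>A\<^esub> y)"
      if "r \<in> carrier k" "x \<in> carrier A" "y \<in> carrier A" for r x y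
    proof -
      have "inner (r \<odot>\<^bsub>A\<^esub> x) y = tensor_lift AAA.T (\<lambda>x1 x2. AAA.p (r \<odot>\<^bsub>A\<^esub> x1) (AA.p x2 y)) (comul A x)"
        unfolding inner_def by (rule lift_comul_smult[OF AAA.T.comm_group_axioms bal_in[OF that(3)] that(1,2)])
      also have "\<dots> = inner x (r \<odot>\<^bsub>A\<^esub> y)"
        unfolding inner_def
        by (rule AA.lift_cong[OF AAA.T.comm_group_axioms bal_in _ comul_closed[OF that(2)]])
          (use that pD(4) qD smult_tensor_pure smult_closed in simp_all)
      finally show ?thesis .
    qed
  qed (rule inner_closed)
  have "conv f (conv g h) a = tensor_lift ?P (\<lambda>x y. Tr (AAA.p x (comul A y))) (comul A a)"
    unfolding conv_def[of f]
    by (rule AA.lift_cong[symmetric, OF comm_group_K balanced_mult[OF f conv_hom[OF g h]] _ comul_closed[OF a]])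
      (simp add: Tr_pure comul_closed conv_def)
  also have "\<dots> = Tr (tensor_lift AAA.T (\<lambda>x y. AAA.p x (comul A y)) (comul A a))"
    by (rule AA.lift_comp[OF AAA.T.comm_group_axioms comm_group_K bal_r Tr_hom comul_closed[OF a], symmetric])
  also have "\<dots> = Tr (tensor_lift AAA.T inner (comul A a))"
    using coassoc[OF a] unfolding inner_def by simp
  also have "\<dots> = tensor_lift ?P (\<lambda>x y. Tr (inner x y)) (comul A a)"
    by (rule AA.lift_comp[OF AAA.T.comm_group_axioms comm_group_K bal_l Tr_hom comul_closed[OF a]])
  also have "\<dots> = conv (conv f g) h a"
    unfolding conv_def[of "conv f g"]
  proof (rule AA.lift_cong[OF comm_group_K balanced_mult[OF conv_hom[OF f g] h] _ comul_closed[OF a]])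
    fix x y assume x: "x \<in> carrier A" and y: "y \<in> carrier A"
    have hy: "(\<lambda>c. c \<otimes>\<^bsub>K\<^esub> h y) \<in> hom ?P ?P" by (rule K.mult_right_hom[OF functional_closed[OF h y]])
    have "Tr (inner x y) = tensor_lift ?P (\<lambda>x1 x2. Tr (AAA.p x1 (AA.p x2 y))) (comul A x)"
      unfolding inner_def
      by (rule AA.lift_comp[OF AAA.T.comm_group_axioms comm_group_K bal_in[OF y] Tr_hom comul_closed[OF x]])
    also have "\<dots> = tensor_lift ?P (\<lambda>x1 x2. (f x1 \<otimes>\<^bsub>K\<^esub> g x2) \<otimes>\<^bsub>K\<^esub> h y) (comul A x)"
      by (rule AA.lift_cong[OF comm_group_K balanced_comp[OF bal_fg hy] _ comul_closed[OF x]])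
        (simp add: Tr_pure y AA.lift_pure[OF comm_group_K bal_gh] functional_closed f g h K.m_assoc)
    also have "\<dots> = conv f g x \<otimes>\<^bsub>K\<^esub> h y"
      unfolding conv_def by (rule AA.lift_comp[OF comm_group_K comm_group_K bal_fg hy comul_closed[OF x], symmetric])
    finally show "Tr (inner x y) = conv f g x \<otimes>\<^bsub>K\<^esub> h y" .
  qed
  finally show ?thesis by simp
qed

section \<open>Ring laws of the convolution algebra\<close>

lemma restrict_hom: "f \<in> lmod_hom k A E \<Longrightarrow> (\<lambda>a\<in>carrier A. f a) \<in> carrier C"
  unfolding conv_algebra_def by (auto intro!: lmod_homI simp: functional_closed functional_add functional_smult smult_closed)

lemma conv_algebraD:
  assumes "f \<in> carrier C"
  shows "f \<in> lmod_hom k A E" "f \<in> extensional (carrier A)"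
  using assms by (simp_all add: conv_algebra_def)

lemma conv_algebra_simps:
  "f \<otimes>\<^bsub>C\<^esub> g = (\<lambda>a\<in>carrier A. conv f g a)" "\<one>\<^bsub>C\<^esub> = (\<lambda>a\<in>carrier A. \<iota> (counit A a))"
  "\<zero>\<^bsub>C\<^esub> = (\<lambda>a\<in>carrier A. \<zero>\<^bsub>K\<^esub>)" "f \<oplus>\<^bsub>C\<^esub> g = (\<lambda>a\<in>carrier A. f a \<oplus>\<^bsub>K\<^esub> g a)"
  "c \<odot>\<^bsub>C\<^esub> f = (\<lambda>a\<in>carrier A. c \<otimes>\<^bsub>K\<^esub> f a)"
  by (simp_all add: conv_algebra_def conv_def)

lemma conv_algebra_eqI:
  "\<lbrakk>f \<in> extensional (carrier A); g \<in> extensional (carrier A); \<And>a. a \<in> carrier A \<Longrightarrow> f a = g a\<rbrakk> \<Longrightarrow> f = g"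
  by (rule extensionalityI)

lemma conv_algebra_closed:
  "\<lbrakk>f \<in> carrier C; g \<in> carrier C\<rbrakk> \<Longrightarrow> f \<otimes>\<^bsub>C\<^esub> g \<in> carrier C"
  "\<lbrakk>f \<in> carrier C; g \<in> carrier C\<rbrakk> \<Longrightarrow> f \<oplus>\<^bsub>C\<^esub> g \<in> carrier C"
  "\<one>\<^bsub>C\<^esub> \<in> carrier C"
  unfolding conv_algebra_simps
  by (intro restrict_hom conv_hom add_hom unit_hom; simp add: conv_algebraD)+

lemma restrict_conv:
  assumes "f \<in> lmod_hom k A E" "g \<in> lmod_hom k A E" "a \<in> carrier A"
  shows "conv (\<lambda>a\<in>carrier A. f a) g a = conv f g a" "conv f (\<lambda>a\<in>carrier A. g a) a = conv f g a"
  using assms by (auto intro: conv_cong)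

lemma ring_conv_algebra: "ring C"
proof (rule ringI)
  note D = conv_algebraD(1) and cl = conv_algebra_closed
  have zero: "\<zero>\<^bsub>C\<^esub> \<in> carrier C"
    unfolding conv_algebra_simps by (rule restrict_hom, rule lmod_homI) auto
  show "abelian_group C"
  proof (rule abelian_groupI)
    fix f g h assume *: "f \<in> carrier C" "g \<in> carrier C" "h \<in> carrier C"
    show "f \<oplus>\<^bsub>C\<^esub> g \<oplus>\<^bsub>C\<^esub> h = f \<oplus>\<^bsub>C\<^esub> (g \<oplus>\<^bsub>C\<^esub> h)"
      by (rule conv_algebra_eqI)
        (use * cl functional_closed[OF D] in \<open>auto simp: conv_algebra_simps(4) K.a_assoc\<close>)
  next
    fix f g assume *: "f \<in> carrier C" "g \<in> carrier C"
    show "f \<oplus>\<^bsub>C\<^esub> g = g \<oplus>\<^bsub>C\<^esub> f"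
      by (rule conv_algebra_eqI)
        (use * cl functional_closed[OF D] in \<open>auto simp: conv_algebra_simps(4) K.a_comm\<close>)
  next
    fix f assume f: "f \<in> carrier C"
    show "\<zero>\<^bsub>C\<^esub> \<oplus>\<^bsub>C\<^esub> f = f"
      by (rule conv_algebra_eqI)
        (use conv_algebraD(2)[OF f] functional_closed[OF D[OF f]] in \<open>auto simp: conv_algebra_simps(3,4)\<close>)
    have m: "(\<lambda>a\<in>carrier A. \<ominus>\<^bsub>K\<^esub> f a) \<in> carrier C"
      using functional_closed[OF D[OF f]] functional_add[OF D[OF f]] functional_smult[OF D[OF f]]
      by (intro restrict_hom lmod_homI) (simp_all add: K.minus_add K.r_minus)
    have "(\<lambda>a\<in>carrier A. \<ominus>\<^bsub>K\<^esub> f a) \<oplus>\<^bsub>C\<^esub> f = \<zero>\<^bsub>C\<^esub>"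
      by (rule conv_algebra_eqI)
        (use f m zero cl functional_closed[OF D[OF f]] in \<open>auto simp: conv_algebra_simps(3,4) K.l_neg\<close>)
    with m show "\<exists>g\<in>carrier C. g \<oplus>\<^bsub>C\<^esub> f = \<zero>\<^bsub>C\<^esub>" by blast
  qed (use cl zero in auto)
  show "monoid C"
  proof (rule monoidI)
    fix f g h assume *: "f \<in> carrier C" "g \<in> carrier C" "h \<in> carrier C"
    show "f \<otimes>\<^bsub>C\<^esub> g \<otimes>\<^bsub>C\<^esub> h = f \<otimes>\<^bsub>C\<^esub> (g \<otimes>\<^bsub>C\<^esub> h)"
      by (rule conv_algebra_eqI)
        (use * cl D in \<open>auto simp: conv_algebra_simps(1) restrict_conv conv_hom conv_assoc\<close>)
  next
    fix f assume f: "f \<in> carrier C"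
    show "\<one>\<^bsub>C\<^esub> \<otimes>\<^bsub>C\<^esub> f = f"
      by (rule conv_algebra_eqI)
        (use conv_algebraD[OF f] in \<open>auto simp: conv_algebra_simps(1,2) restrict_conv unit_hom conv_unit_left\<close>)
    show "f \<otimes>\<^bsub>C\<^esub> \<one>\<^bsub>C\<^esub> = f"
      by (rule conv_algebra_eqI)
        (use conv_algebraD[OF f] in \<open>auto simp: conv_algebra_simps(1,2) restrict_conv unit_hom conv_unit_right\<close>)
  qed (use cl in auto)
  fix f g h assume *: "f \<in> carrier C" "g \<in> carrier C" "h \<in> carrier C"
  show "(f \<oplus>\<^bsub>C\<^esub> g) \<otimes>\<^bsub>C\<^esub> h = f \<otimes>\<^bsub>C\<^esub> h \<oplus>\<^bsub>C\<^esub> g \<otimes>\<^bsub>C\<^esub> h"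
    by (rule conv_algebra_eqI)
      (use * cl D in \<open>auto simp: conv_algebra_simps(1,4) restrict_conv add_hom conv_add_left\<close>)
  show "h \<otimes>\<^bsub>C\<^esub> (f \<oplus>\<^bsub>C\<^esub> g) = h \<otimes>\<^bsub>C\<^esub> f \<oplus>\<^bsub>C\<^esub> h \<otimes>\<^bsub>C\<^esub> g"
    by (rule conv_algebra_eqI)
      (use * cl D in \<open>auto simp: conv_algebra_simps(1,4) restrict_conv add_hom conv_add_right\<close>)
qed

end

section \<open>The group algebra of a base change\<close>

context base_extension
begin

abbreviation "B \<equiv> base_change_alg k K \<iota> A"
abbreviation "GK \<equiv> base_change k K \<iota> A"
abbreviation "KG \<equiv> group_algebra K GK"

lemma abelian_E: "abelian_group E"
  unfolding ext_module_def by (simp add: K.is_abelian_group)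

sublocale EA: tensor_pair k E A
  by (intro tensor_pair.intro abelian_E AA.abelian_M smult_closed) simp_all

abbreviation "pB \<equiv> pure k E A"

lemma B_simps:
  "carrier B = carrier EA.T" "ring.add B = monoid.mult EA.T" "\<zero>\<^bsub>B\<^esub> = \<one>\<^bsub>EA.T\<^esub>"
  "c \<odot>\<^bsub>B\<^esub> u = tensor_lift EA.T (\<lambda>x a. pB (c \<otimes>\<^bsub>K\<^esub> x) a) u"
  by (simp_all add: base_change_alg_def)

lemma smult_B_balanced:
  assumes c: "c \<in> carrier K"
  shows "balanced k E A EA.T (\<lambda>x a. pB (c \<otimes>\<^bsub>K\<^esub> x) a)"
proof -
  note D = balancedD[OF EA.balanced_pure, simplified]
  have *: "c \<otimes>\<^bsub>K\<^esub> (\<iota> r \<otimes>\<^bsub>K\<^esub> x) = \<iota> r \<otimes>\<^bsub>K\<^esub> (c \<otimes>\<^bsub>K\<^esub> x)" if "r \<in> carrier k" "x \<in> carrier K" for r x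
    using that c by (simp add: K.m_lcomm)
  show ?thesis by (rule balancedI) (use D c * in \<open>simp_all add: K.r_distr\<close>)
qed

lemma smult_B_pure:
  "\<lbrakk>c \<in> carrier K; x \<in> carrier K; a \<in> carrier A\<rbrakk> \<Longrightarrow> c \<odot>\<^bsub>B\<^esub> pB x a = pB (c \<otimes>\<^bsub>K\<^esub> x) a"
  unfolding B_simps by (rule EA.lift_pure[OF EA.T.comm_group_axioms smult_B_balanced]) simp_all

lemma smult_B_closed: "\<lbrakk>c \<in> carrier K; u \<in> carrier EA.T\<rbrakk> \<Longrightarrow> c \<odot>\<^bsub>B\<^esub> u \<in> carrier EA.T"
  unfolding B_simps by (rule EA.lift_closed[OF EA.T.comm_group_axioms smult_B_balanced])

lemma smult_B_hom: "c \<in> carrier K \<Longrightarrow> (\<lambda>u. c \<odot>\<^bsub>B\<^esub> u) \<in> hom EA.T EA.T"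
  unfolding B_simps using EA.lift_hom[OF EA.T.comm_group_axioms smult_B_balanced] by simp

lemma abelian_B: "abelian_group B"
  unfolding abelian_group_iff_comm_group
  using comm_group_cong[of "add_monoid B" EA.T] EA.T.comm_group_axioms by (simp add: B_simps)

sublocale BB: tensor_pair K B B
  by (intro tensor_pair.intro abelian_B) (simp_all add: B_simps(1) smult_B_closed)

text \<open>The sum of (c \<otimes> a1) \<otimes> (1 \<otimes> a2) over the terms a1 \<otimes> a2 of
  the comultiplication of a. It is the inner lift in the comultiplication of
  \<open>base_change\<close>, named so that the outer one can be treated as the lift of a balanced
  map.\<close>

definition comul_inner :: "'l \<Rightarrow> 'a \<Rightarrow> (('l, 'a) tens, ('l, 'a) tens) tens" where
  "comul_inner c a = tensor_lift BB.T (\<lambda>x y. BB.p (pB c x) (pB \<one>\<^bsub>K\<^esub> y)) (comul A a)"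

lemma GK_simps:
  "carrier GK = carrier EA.T" "ring.add GK = monoid.mult EA.T" "\<zero>\<^bsub>GK\<^esub> = \<one>\<^bsub>EA.T\<^esub>"
  "smult GK = smult B" "\<one>\<^bsub>GK\<^esub> = \<one>\<^bsub>B\<^esub>" "monoid.mult GK = monoid.mult B"
  "comul GK = tensor_lift BB.T comul_inner"
  "counit GK = tensor_lift (add_monoid K) (\<lambda>c a. c \<otimes>\<^bsub>K\<^esub> \<iota> (counit A a))"
  by (simp_all add: base_change_def Let_def module.defs B_simps comul_inner_def[abs_def])

lemma balanced_comul_term:
  assumes c: "c \<in> carrier K"
  shows "balanced k A A BB.T (\<lambda>x y. BB.p (pB c x) (pB \<one>\<^bsub>K\<^esub> y))"
proof (rule balancedI)
  note D = balancedD[OF EA.balanced_pure, simplified] and D' = balancedD[OF BB.balanced_pure, unfolded B_simps(1,2)]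
  show "BB.p (pB c (r \<odot>\<^bsub>A\<^esub> x)) (pB \<one>\<^bsub>K\<^esub> y) = BB.p (pB c x) (pB \<one>\<^bsub>K\<^esub> (r \<odot>\<^bsub>A\<^esub> y))"
    if r: "r \<in> carrier k" and x: "x \<in> carrier A" and y: "y \<in> carrier A" for r x y
  proof -
    \<comment> \<open>A scalar r of k acting on A becomes the scalar \<iota> r of K on K \<otimes>
      A, and the outer tensor product is taken over K, so it can cross.\<close>
    have "pB c (r \<odot>\<^bsub>A\<^esub> x) = \<iota> r \<odot>\<^bsub>B\<^esub> pB c x" "pB \<one>\<^bsub>K\<^esub> (r \<odot>\<^bsub>A\<^esub> y) = \<iota> r \<odot>\<^bsub>B\<^esub> pB \<one>\<^bsub>K\<^esub> y"
      using D(4)[of r, symmetric] r x y c by (simp_all add: smult_B_pure)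
    then show ?thesis using D'(4)[of "\<iota> r" "pB c x" "pB \<one>\<^bsub>K\<^esub> y"] r x y c D(1) by simp
  qed
qed (use balancedD[OF EA.balanced_pure, simplified] balancedD[OF BB.balanced_pure, unfolded B_simps(1,2)] c in simp_all)

lemma balanced_comul_inner: "balanced k E A BB.T comul_inner"
proof (rule balancedI)
  note D = balancedD[OF EA.balanced_pure, simplified] and D' = balancedD[OF BB.balanced_pure, unfolded B_simps(1,2)]
  note bal = balanced_comul_term and cg = BB.T.comm_group_axioms
  show "comul_inner c a \<in> carrier BB.T" if "c \<in> carrier E" "a \<in> carrier A" for c a
    using AA.lift_closed[OF cg bal comul_closed] that by (simp add: comul_inner_def)
  show "comul_inner (c \<oplus>\<^bsub>E\<^esub> c') a = comul_inner c a \<otimes>\<^bsub>BB.T\<^esub> comul_inner c' a"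
    if "c \<in> carrier E" "c' \<in> carrier E" and a: "a \<in> carrier A" for c c' a
  proof -
    have c: "c \<in> carrier K" "c' \<in> carrier K" using that by simp_all
    have "comul_inner (c \<oplus>\<^bsub>E\<^esub> c') a = tensor_lift BB.T (\<lambda>x y.
        BB.p (pB c x) (pB \<one>\<^bsub>K\<^esub> y) \<otimes>\<^bsub>BB.T\<^esub> BB.p (pB c' x) (pB \<one>\<^bsub>K\<^esub> y)) (comul A a)"
      unfolding comul_inner_def
      by (rule AA.lift_cong[symmetric, OF cg bal _ comul_closed[OF a]]) (use c D D' in simp_all)
    then show ?thesis
      unfolding comul_inner_def using AA.lift_add[OF cg bal[OF c(1)] bal[OF c(2)] comul_closed[OF a]] by simp
  qed
  show "comul_inner c (a \<oplus>\<^bsub>A\<^esub> b) = comul_inner c a \<otimes>\<^bsub>BB.T\<^esub> comul_inner c b"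
    if "c \<in> carrier E" "a \<in> carrier A" "b \<in> carrier A" for c a b
    using AA.lift_mult[OF cg bal comul_closed comul_closed] that by (simp add: comul_inner_def comul_add)
  show "comul_inner (r \<odot>\<^bsub>E\<^esub> c) a = comul_inner c (r \<odot>\<^bsub>A\<^esub> a)"
    if r: "r \<in> carrier k" and "c \<in> carrier E" and a: "a \<in> carrier A" for r c a
  proof -
    have c: "c \<in> carrier K" using that by simp
    have "comul_inner c (r \<odot>\<^bsub>A\<^esub> a) =
        tensor_lift BB.T (\<lambda>x y. BB.p (pB c (r \<odot>\<^bsub>A\<^esub> x)) (pB \<one>\<^bsub>K\<^esub> y)) (comul A a)"
      unfolding comul_inner_def by (rule lift_comul_smult[OF cg bal[OF c] r a])
    also have "\<dots> = comul_inner (r \<odot>\<^bsub>E\<^esub> c) a"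
      unfolding comul_inner_def
      by (rule AA.lift_cong[OF cg bal _ comul_closed[OF a]]) (use r c D in simp_all)
    finally show ?thesis by simp
  qed
qed

lemma comul_GK_pure: "\<lbrakk>c \<in> carrier K; a \<in> carrier A\<rbrakk> \<Longrightarrow> comul GK (pB c a) = comul_inner c a"
  unfolding GK_simps by (rule EA.lift_pure[OF BB.T.comm_group_axioms balanced_comul_inner]) simp_all

lemma comul_GK_hom: "comul GK \<in> hom EA.T BB.T"
  unfolding GK_simps by (rule EA.lift_hom[OF BB.T.comm_group_axioms balanced_comul_inner])

lemma KG_D:
  assumes "\<phi> \<in> carrier KG"
  shows "\<And>u. u \<in> carrier EA.T \<Longrightarrow> \<phi> u \<in> carrier K"
    "\<And>u v. \<lbrakk>u \<in> carrier EA.T; v \<in> carrier EA.T\<rbrakk> \<Longrightarrow> \<phi> (u \<otimes>\<^bsub>EA.T\<^esub> v) = \<phi> u \<oplus>\<^bsub>K\<^esub> \<phi> v"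
    "\<And>c u. \<lbrakk>c \<in> carrier K; u \<in> carrier EA.T\<rbrakk> \<Longrightarrow> \<phi> (c \<odot>\<^bsub>B\<^esub> u) = c \<otimes>\<^bsub>K\<^esub> \<phi> u"
    "\<phi> \<in> extensional (carrier EA.T)"
proof -
  have "\<phi> \<in> lmod_hom K GK (self_module K)" using assms by (simp add: group_algebra_def)
  note D = lmod_homD[OF this, unfolded GK_simps]
  show "\<And>u. u \<in> carrier EA.T \<Longrightarrow> \<phi> u \<in> carrier K"
    "\<And>u v. \<lbrakk>u \<in> carrier EA.T; v \<in> carrier EA.T\<rbrakk> \<Longrightarrow> \<phi> (u \<otimes>\<^bsub>EA.T\<^esub> v) = \<phi> u \<oplus>\<^bsub>K\<^esub> \<phi> v"
    "\<And>c u. \<lbrakk>c \<in> carrier K; u \<in> carrier EA.T\<rbrakk> \<Longrightarrow> \<phi> (c \<odot>\<^bsub>B\<^esub> u) = c \<otimes>\<^bsub>K\<^esub> \<phi> u"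
    using D by simp_all
  show "\<phi> \<in> extensional (carrier EA.T)" using assms by (simp add: group_algebra_def GK_simps)
qed

lemma KG_I:
  assumes "\<And>u. u \<in> carrier EA.T \<Longrightarrow> f u \<in> carrier K"
    "\<And>u v. \<lbrakk>u \<in> carrier EA.T; v \<in> carrier EA.T\<rbrakk> \<Longrightarrow> f (u \<otimes>\<^bsub>EA.T\<^esub> v) = f u \<oplus>\<^bsub>K\<^esub> f v"
    "\<And>c u. \<lbrakk>c \<in> carrier K; u \<in> carrier EA.T\<rbrakk> \<Longrightarrow> f (c \<odot>\<^bsub>B\<^esub> u) = c \<otimes>\<^bsub>K\<^esub> f u"
  shows "(\<lambda>u\<in>carrier EA.T. f u) \<in> carrier KG"
  using assms smult_B_closed by (auto simp: group_algebra_def GK_simps intro!: lmod_homI)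

lemma KG_hom: "\<phi> \<in> carrier KG \<Longrightarrow> \<phi> \<in> hom EA.T (add_monoid K)"
  using KG_D by (simp add: hom_def)

lemma KG_eqI:
  assumes "f \<in> hom EA.T (add_monoid K)" "g \<in> hom EA.T (add_monoid K)"
    "f \<in> extensional (carrier EA.T)" "g \<in> extensional (carrier EA.T)"
    "\<And>c a. \<lbrakk>c \<in> carrier K; a \<in> carrier A\<rbrakk> \<Longrightarrow> f (pB c a) = g (pB c a)"
  shows "f = g"
  by (rule extensionalityI[OF assms(3,4)], rule EA.hom_eqI[OF assms(1,2)])
    (use assms(5) comm_group.axioms(2)[OF comm_group_K] in auto)

lemma restrict_hom_EA: "f \<in> hom EA.T (add_monoid K) \<Longrightarrow> (\<lambda>u\<in>carrier EA.T. f u) \<in> hom EA.T (add_monoid K)"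
  by (auto simp: hom_def)

section \<open>Comparison of the group algebra of the base change with the convolution
  algebra\<close>

lemma balanced_extend:
  assumes f: "f \<in> lmod_hom k A E"
  shows "balanced k E A (add_monoid K) (\<lambda>c a. c \<otimes>\<^bsub>K\<^esub> f a)"
  by (rule balancedI)
    (use functional_closed[OF f] functional_add[OF f] functional_smult[OF f]
      in \<open>simp_all add: K.l_distr K.r_distr K.m_ac\<close>)

definition extend :: "('a \<Rightarrow> 'l) \<Rightarrow> (('l, 'a) tens \<Rightarrow> 'l)" where
  "extend f = (\<lambda>u\<in>carrier EA.T. tensor_lift (add_monoid K) (\<lambda>c a. c \<otimes>\<^bsub>K\<^esub> f a) u)"

lemma extend_pure:
  "\<lbrakk>f \<in> lmod_hom k A E; c \<in> carrier K; a \<in> carrier A\<rbrakk> \<Longrightarrow> extend f (pB c a) = c \<otimes>\<^bsub>K\<^esub> f a"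
  by (simp add: extend_def EA.lift_pure[OF comm_group_K balanced_extend])

lemma extend_hom: "f \<in> lmod_hom k A E \<Longrightarrow> extend f \<in> hom EA.T (add_monoid K)"
  unfolding extend_def by (rule restrict_hom_EA[OF EA.lift_hom[OF comm_group_K balanced_extend]])

lemma extend_closed:
  assumes f: "f \<in> lmod_hom k A E"
  shows "extend f \<in> carrier KG"
proof -
  note h = EA.lift_hom[OF comm_group_K balanced_extend[OF f]]
  let ?h = "tensor_lift (add_monoid K) (\<lambda>c a. c \<otimes>\<^bsub>K\<^esub> f a)"
  show ?thesis
    unfolding extend_def
  proof (rule KG_I)
    show "?h (c \<odot>\<^bsub>B\<^esub> u) = c \<otimes>\<^bsub>K\<^esub> ?h u" if c: "c \<in> carrier K" and u: "u \<in> carrier EA.T" for c u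
    proof (rule EA.hom_eqI[OF _ _ comm_group.axioms(2)[OF comm_group_K] _ u])
      show "(\<lambda>u. ?h (c \<odot>\<^bsub>B\<^esub> u)) \<in> hom EA.T (add_monoid K)"
        using hom_compose[OF smult_B_hom[OF c] h] by (simp add: comp_def)
      show "(\<lambda>u. c \<otimes>\<^bsub>K\<^esub> ?h u) \<in> hom EA.T (add_monoid K)"
        using hom_compose[OF h K.mult_left_hom[OF c]] by (simp add: comp_def)
      show "?h (c \<odot>\<^bsub>B\<^esub> pB x a) = c \<otimes>\<^bsub>K\<^esub> ?h (pB x a)" if "x \<in> carrier E" "a \<in> carrier A" for x a
        using that c f by (simp add: smult_B_pure EA.lift_pure[OF comm_group_K balanced_extend] K.m_assoc functional_closed)
    qed
  qed (use hom_in_carrier[OF h] hom_mult[OF h] in simp_all)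
qed

definition descend :: "(('l, 'a) tens \<Rightarrow> 'l) \<Rightarrow> 'a \<Rightarrow> 'l" where
  "descend \<phi> = (\<lambda>a\<in>carrier A. \<phi> (pB \<one>\<^bsub>K\<^esub> a))"

lemma KG_pure:
  assumes "\<phi> \<in> carrier KG" "c \<in> carrier K" "a \<in> carrier A"
  shows "\<phi> (pB c a) = c \<otimes>\<^bsub>K\<^esub> descend \<phi> a"
  using KG_D(3)[OF assms(1,2), of "pB \<one>\<^bsub>K\<^esub> a"] assms(2,3) by (simp add: smult_B_pure descend_def)

lemma descend_hom:
  assumes \<phi>: "\<phi> \<in> carrier KG"
  shows "descend \<phi> \<in> lmod_hom k A E"
proof (rule lmod_homI)
  note D = balancedD[OF EA.balanced_pure, simplified]
  show "descend \<phi> (r \<odot>\<^bsub>A\<^esub> a) = r \<odot>\<^bsub>E\<^esub> descend \<phi> a" if "r \<in> carrier k" "a \<in> carrier A" for r a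
    using that KG_pure[OF \<phi>, of "\<iota> r" a] D(4)[of r "\<one>\<^bsub>K\<^esub>" a]
    by (simp add: descend_def smult_closed)
qed (use KG_D(1,2)[OF \<phi>] balancedD[OF EA.balanced_pure, simplified] in \<open>simp_all add: descend_def\<close>)

lemma descend_closed: "\<phi> \<in> carrier KG \<Longrightarrow> descend \<phi> \<in> carrier C"
  using descend_hom by (simp add: conv_algebra_def) (simp add: descend_def)

lemma extend_descend:
  assumes \<phi>: "\<phi> \<in> carrier KG"
  shows "extend (descend \<phi>) = \<phi>"
  by (rule KG_eqI[OF extend_hom[OF descend_hom[OF \<phi>]] KG_hom[OF \<phi>]])
    (use KG_D(4)[OF \<phi>] descend_hom[OF \<phi>] in \<open>simp_all add: extend_pure KG_pure[OF \<phi>], simp_all add: extend_def\<close>)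

lemma descend_extend:
  assumes f: "f \<in> carrier C"
  shows "descend (extend f) = f"
  by (rule conv_algebra_eqI)
    (use conv_algebraD[OF f] in \<open>auto simp: descend_def extend_pure functional_closed\<close>)

lemma balanced_mult_KG:
  assumes "\<phi> \<in> carrier KG" "\<psi> \<in> carrier KG"
  shows "balanced K B B (add_monoid K) (\<lambda>x y. \<phi> x \<otimes>\<^bsub>K\<^esub> \<psi> y)"
  by (rule balancedI)
    (use KG_D[OF assms(1)] KG_D[OF assms(2)]
      in \<open>simp_all add: B_simps(1,2) K.l_distr K.r_distr K.m_ac\<close>)

lemma KG_simps:
  "\<phi> \<otimes>\<^bsub>KG\<^esub> \<psi> = (\<lambda>u\<in>carrier EA.T. tensor_lift (add_monoid K) (\<lambda>x y. \<phi> x \<otimes>\<^bsub>K\<^esub> \<psi> y) (comul GK u))"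
  "\<phi> \<oplus>\<^bsub>KG\<^esub> \<psi> = (\<lambda>u\<in>carrier EA.T. \<phi> u \<oplus>\<^bsub>K\<^esub> \<psi> u)"
  "\<one>\<^bsub>KG\<^esub> = (\<lambda>u\<in>carrier EA.T. counit GK u)"
  "\<zero>\<^bsub>KG\<^esub> = (\<lambda>u\<in>carrier EA.T. \<zero>\<^bsub>K\<^esub>)"
  "c \<odot>\<^bsub>KG\<^esub> \<phi> = (\<lambda>u\<in>carrier EA.T. c \<otimes>\<^bsub>K\<^esub> \<phi> u)"
  by (simp_all add: group_algebra_def GK_simps(1))

lemma KG_mult_hom:
  assumes "\<phi> \<in> carrier KG" "\<psi> \<in> carrier KG"
  shows "\<phi> \<otimes>\<^bsub>KG\<^esub> \<psi> \<in> hom EA.T (add_monoid K)"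
  unfolding KG_simps
  using restrict_hom_EA[OF hom_compose[OF comul_GK_hom BB.lift_hom[OF comm_group_K balanced_mult_KG[OF assms]]]]
  by (simp add: comp_def)

text \<open>The comultiplication of the base change puts c on the first leg and 1 on the second, so
  K-linearity releases c exactly once and leaves a convolution over A.\<close>

lemma KG_mult_pure:
  assumes \<phi>: "\<phi> \<in> carrier KG" and \<psi>: "\<psi> \<in> carrier KG" and c: "c \<in> carrier K" and a: "a \<in> carrier A"
  shows "(\<phi> \<otimes>\<^bsub>KG\<^esub> \<psi>) (pB c a) = c \<otimes>\<^bsub>K\<^esub> conv (descend \<phi>) (descend \<psi>) a"
proof -
  note bal = balanced_mult_KG[OF \<phi> \<psi>] and cl = functional_closed[OF descend_hom]
  note bal' = balanced_mult[OF descend_hom[OF \<phi>] descend_hom[OF \<psi>]]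
  have "(\<phi> \<otimes>\<^bsub>KG\<^esub> \<psi>) (pB c a) = tensor_lift (add_monoid K) (\<lambda>x y. \<phi> x \<otimes>\<^bsub>K\<^esub> \<psi> y) (comul_inner c a)"
    using c a by (simp add: KG_simps(1) comul_GK_pure)
  also have "\<dots> = tensor_lift (add_monoid K) (\<lambda>x y.
      tensor_lift (add_monoid K) (\<lambda>x y. \<phi> x \<otimes>\<^bsub>K\<^esub> \<psi> y) (BB.p (pB c x) (pB \<one>\<^bsub>K\<^esub> y))) (comul A a)"
    unfolding comul_inner_def
    by (rule AA.lift_comp[OF BB.T.comm_group_axioms comm_group_K balanced_comul_term[OF c] BB.lift_hom[OF comm_group_K bal] comul_closed[OF a]])
  also have "\<dots> = tensor_lift (add_monoid K) (\<lambda>x y. c \<otimes>\<^bsub>K\<^esub> (descend \<phi> x \<otimes>\<^bsub>K\<^esub> descend \<psi> y)) (comul A a)"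
  proof (rule AA.lift_cong[OF comm_group_K balanced_comp[OF bal' K.mult_left_hom[OF c]] _ comul_closed[OF a]])
    fix x y assume x: "x \<in> carrier A" and y: "y \<in> carrier A"
    show "tensor_lift (add_monoid K) (\<lambda>x y. \<phi> x \<otimes>\<^bsub>K\<^esub> \<psi> y) (BB.p (pB c x) (pB \<one>\<^bsub>K\<^esub> y)) =
        c \<otimes>\<^bsub>K\<^esub> (descend \<phi> x \<otimes>\<^bsub>K\<^esub> descend \<psi> y)"
      using BB.lift_pure[OF comm_group_K bal, of "pB c x" "pB \<one>\<^bsub>K\<^esub> y"] c x y cl[OF \<phi> x] cl[OF \<psi> y]
      by (simp add: B_simps(1) KG_pure[OF \<phi>] KG_pure[OF \<psi>] K.m_assoc)
  qed
  also have "\<dots> = c \<otimes>\<^bsub>K\<^esub> conv (descend \<phi>) (descend \<psi>) a"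
    unfolding conv_def
    by (rule AA.lift_comp[OF comm_group_K comm_group_K bal' K.mult_left_hom[OF c] comul_closed[OF a], symmetric])
  finally show ?thesis .
qed

lemma extend_ring_iso: "extend \<in> ring_iso C KG"
  unfolding ring_iso_def
proof (intro CollectI conjI ring_hom_memI)
  note D = conv_algebraD(1)
  show "extend f \<in> carrier KG" if "f \<in> carrier C" for f using extend_closed[OF D[OF that]] .
  show "extend (f \<otimes>\<^bsub>C\<^esub> g) = extend f \<otimes>\<^bsub>KG\<^esub> extend g" if f: "f \<in> carrier C" and g: "g \<in> carrier C" for f g
  proof (rule KG_eqI)
    note fg = extend_closed[OF D[OF f]] extend_closed[OF D[OF g]] and c = conv_algebra_closed(1)[OF f g]
    show "extend f \<otimes>\<^bsub>KG\<^esub> extend g \<in> hom EA.T (add_monoid K)" by (rule KG_mult_hom[OF fg])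
    show "extend (f \<otimes>\<^bsub>C\<^esub> g) \<in> hom EA.T (add_monoid K)" by (rule extend_hom[OF D[OF c]])
    show "extend (f \<otimes>\<^bsub>C\<^esub> g) (pB d a) = (extend f \<otimes>\<^bsub>KG\<^esub> extend g) (pB d a)"
      if "d \<in> carrier K" "a \<in> carrier A" for d a
      using that extend_pure[OF D[OF c]] KG_mult_pure[OF fg] descend_extend[OF f] descend_extend[OF g]
      by (simp add: conv_algebra_simps(1))
  qed (simp_all add: extend_def KG_simps(1))
  show "extend (f \<oplus>\<^bsub>C\<^esub> g) = extend f \<oplus>\<^bsub>KG\<^esub> extend g" if f: "f \<in> carrier C" and g: "g \<in> carrier C" for f g
  proof (rule KG_eqI)
    note c = conv_algebra_closed(2)[OF f g] and fg = extend_closed[OF D[OF f]] extend_closed[OF D[OF g]]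
    show "extend f \<oplus>\<^bsub>KG\<^esub> extend g \<in> hom EA.T (add_monoid K)"
      unfolding KG_simps using KG_D[OF fg(1)] KG_D[OF fg(2)]
      by (intro restrict_hom_EA) (simp add: hom_def K.a_ac)
    show "extend (f \<oplus>\<^bsub>C\<^esub> g) \<in> hom EA.T (add_monoid K)" by (rule extend_hom[OF D[OF c]])
    show "extend (f \<oplus>\<^bsub>C\<^esub> g) (pB d a) = (extend f \<oplus>\<^bsub>KG\<^esub> extend g) (pB d a)"
      if "d \<in> carrier K" "a \<in> carrier A" for d a
      using that extend_pure[OF D[OF c]] functional_closed[OF D[OF f]] functional_closed[OF D[OF g]]
      by (simp add: conv_algebra_simps(4) KG_simps(2) extend_pure D[OF f] D[OF g] K.r_distr)
  qed (simp_all add: extend_def KG_simps(2))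
  show "extend \<one>\<^bsub>C\<^esub> = \<one>\<^bsub>KG\<^esub>"
    unfolding conv_algebra_simps KG_simps GK_simps extend_def
    by (rule restrict_ext, rule EA.lift_cong[OF comm_group_K balanced_extend[OF unit_hom]]) simp_all
  show "bij_betw extend (carrier C) (carrier KG)"
    by (rule bij_betw_byWitness[of _ descend])
      (use extend_descend descend_extend extend_closed D descend_closed in auto)
qed

lemma ring_KG: "ring KG"
proof -
  interpret C: ring C by (rule ring_conv_algebra)
  have "\<zero>\<^bsub>KG\<^esub> = extend \<zero>\<^bsub>C\<^esub>"
  proof (rule KG_eqI)
    note c = conv_algebraD(1)[OF C.zero_closed]
    show "extend \<zero>\<^bsub>C\<^esub> \<in> hom EA.T (add_monoid K)" by (rule extend_hom[OF c])
    show "\<zero>\<^bsub>KG\<^esub> (pB d a) = extend \<zero>\<^bsub>C\<^esub> (pB d a)" if "d \<in> carrier K" "a \<in> carrier A" for d a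
      using that extend_pure[OF c] by (simp add: conv_algebra_simps(3) KG_simps(4))
  qed (simp_all add: KG_simps(4) hom_def extend_def)
  \<comment> \<open>Transport along a ring isomorphism yields a ring whose zero field is the image
    of zero; this image has just been identified with the zero of \<open>KG\<close>, so the update
    changes nothing.\<close>
  then have "KG\<lparr>ring.zero := extend \<zero>\<^bsub>C\<^esub>\<rparr> = KG" by (simp add: group_algebra_def)
  then show ?thesis using C.ring_iso_imp_img_ring[OF extend_ring_iso] by simp
qed

lemma left_module_KG: "left_module K KG"
proof -
  interpret KG: ring KG by (rule ring_KG)
  have smult: "c \<odot>\<^bsub>KG\<^esub> \<phi> \<in> carrier KG" if "c \<in> carrier K" "\<phi> \<in> carrier KG" for c \<phi>
    unfolding KG_simps by (rule KG_I) (use KG_D[OF that(2)] that(1) in \<open>simp_all add: K.r_distr K.m_lcomm\<close>)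
  show ?thesis
  proof (intro left_module.intro left_module_axioms.intro K.ring_axioms KG.is_abelian_group smult)
    fix a b x y assume a: "a \<in> carrier K" and b: "b \<in> carrier K"
    { fix x assume x: "x \<in> carrier KG"
      show "(a \<oplus>\<^bsub>K\<^esub> b) \<odot>\<^bsub>KG\<^esub> x = a \<odot>\<^bsub>KG\<^esub> x \<oplus>\<^bsub>KG\<^esub> b \<odot>\<^bsub>KG\<^esub> x"
        unfolding KG_simps using a b KG_D[OF x] by (auto simp: fun_eq_iff K.l_distr)
      show "(a \<otimes>\<^bsub>K\<^esub> b) \<odot>\<^bsub>KG\<^esub> x = a \<odot>\<^bsub>KG\<^esub> (b \<odot>\<^bsub>KG\<^esub> x)"
        unfolding KG_simps using a b KG_D[OF x] by (auto simp: fun_eq_iff K.m_assoc) }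
  next
    fix a x y assume "a \<in> carrier K" "x \<in> carrier KG" "y \<in> carrier KG"
    then show "a \<odot>\<^bsub>KG\<^esub> (x \<oplus>\<^bsub>KG\<^esub> y) = a \<odot>\<^bsub>KG\<^esub> x \<oplus>\<^bsub>KG\<^esub> a \<odot>\<^bsub>KG\<^esub> y"
      unfolding KG_simps using KG_D by (auto simp: fun_eq_iff K.r_distr)
  next
    fix x assume x: "x \<in> carrier KG"
    show "\<one>\<^bsub>K\<^esub> \<odot>\<^bsub>KG\<^esub> x = x"
      unfolding KG_simps by (rule extensionalityI[OF _ KG_D(4)[OF x]]) (use KG_D[OF x] in auto)
  qed
qed

text \<open>Scalars pass through the second factor of a convolution term by term. With the unit as
  second factor, right multiplication by a multiple of the unit becomes scaling, which
  \<open>smult_pure_one\<close> uses.\<close>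

lemma KG_mult_smult:
  assumes \<phi>: "\<phi> \<in> carrier KG" and \<psi>: "\<psi> \<in> carrier KG" and c: "c \<in> carrier K"
  shows "\<phi> \<otimes>\<^bsub>KG\<^esub> (c \<odot>\<^bsub>KG\<^esub> \<psi>) = c \<odot>\<^bsub>KG\<^esub> (\<phi> \<otimes>\<^bsub>KG\<^esub> \<psi>)"
proof -
  interpret KG: left_module K KG by (rule left_module_KG)
  have "tensor_lift (add_monoid K) (\<lambda>x y. \<phi> x \<otimes>\<^bsub>K\<^esub> (c \<odot>\<^bsub>KG\<^esub> \<psi>) y) w =
      c \<otimes>\<^bsub>K\<^esub> tensor_lift (add_monoid K) (\<lambda>x y. \<phi> x \<otimes>\<^bsub>K\<^esub> \<psi> y) w" if w: "w \<in> carrier BB.T" for w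
  proof -
    have "tensor_lift (add_monoid K) (\<lambda>x y. \<phi> x \<otimes>\<^bsub>K\<^esub> (c \<odot>\<^bsub>KG\<^esub> \<psi>) y) w =
        tensor_lift (add_monoid K) (\<lambda>x y. c \<otimes>\<^bsub>K\<^esub> (\<phi> x \<otimes>\<^bsub>K\<^esub> \<psi> y)) w"
      by (rule BB.lift_cong[OF comm_group_K balanced_comp[OF balanced_mult_KG[OF \<phi> \<psi>] K.mult_left_hom[OF c]] _ w])
        (use KG_D(1)[OF \<phi>] KG_D(1)[OF \<psi>] c in \<open>simp add: B_simps(1) KG_simps(5) K.m_lcomm\<close>)
    also have "\<dots> = c \<otimes>\<^bsub>K\<^esub> tensor_lift (add_monoid K) (\<lambda>x y. \<phi> x \<otimes>\<^bsub>K\<^esub> \<psi> y) w"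
      by (rule BB.lift_comp[OF comm_group_K comm_group_K balanced_mult_KG[OF \<phi> \<psi>] K.mult_left_hom[OF c] w, symmetric])
    finally show ?thesis .
  qed
  then show ?thesis
    unfolding KG_simps(1) KG_simps(5)[of c "\<lambda>u\<in>carrier EA.T. tensor_lift (add_monoid K) (\<lambda>x y. \<phi> x \<otimes>\<^bsub>K\<^esub> \<psi> y) (comul GK u)"]
    using hom_in_carrier[OF comul_GK_hom] by (auto simp: fun_eq_iff)
qed

lemma ring_group_algebra: "ring (group_algebra k A)"
proof -
  interpret k: base_extension k A k id
    by unfold_locales (auto simp: ring_hom_def)
  show ?thesis using k.ring_conv_algebra by (simp add: group_algebra_eq_conv_algebra)
qed

lemma group_algebra_ext_eq: "group_algebra_ext k K \<iota> A \<phi> = extend (\<lambda>a. \<iota> (\<phi> a))"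
  by (simp add: group_algebra_ext_def extend_def GK_simps)

lemma scalar_extension_hom:
  assumes \<phi>: "\<phi> \<in> lmod_hom k A (self_module k)"
  shows "(\<lambda>a. \<iota> (\<phi> a)) \<in> lmod_hom k A E"
  by (rule lmod_homI) (use lmod_homD[OF \<phi>] in \<open>simp_all add: \<iota>_add \<iota>_mult\<close>)

text \<open>The map factors as composition with \<iota>, from kG to the convolution algebra,
  followed by \<open>extend\<close>. The first step is multiplicative because \<iota> is additive,
  hence passes through the lift over the comultiplication, and respects products.\<close>

lemma group_algebra_ext_ring_hom: "group_algebra_ext k K \<iota> A \<in> ring_hom (group_algebra k A) KG"
proof -
  interpret k: base_extension k A k id
    by unfold_locales (auto simp: ring_hom_def)
  have iso: "extend \<in> ring_hom C KG" using extend_ring_iso by (simp add: ring_iso_def)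
  let ?G = "group_algebra k A"
  let ?s = "\<lambda>\<phi>. \<lambda>a\<in>carrier A. \<iota> (\<phi> a)"
  have D: "\<phi> \<in> lmod_hom k A (self_module k)" if "\<phi> \<in> carrier ?G" for \<phi>
    using that by (simp add: group_algebra_def)
  have kE: "k.E = self_module k" by (simp add: ext_module_def self_module_def)
  have \<phi>c: "\<phi> a \<in> carrier k" if "\<phi> \<in> carrier ?G" "a \<in> carrier A" for \<phi> a
    using lmod_homD(1)[OF D[OF that(1)] that(2)] by simp
  have s: "?s \<in> ring_hom ?G C"
  proof (rule ring_hom_memI)
    show "?s \<phi> \<in> carrier C" if "\<phi> \<in> carrier ?G" for \<phi>
      by (rule restrict_hom[OF scalar_extension_hom[OF D[OF that]]])
    show "?s (\<phi> \<oplus>\<^bsub>?G\<^esub> \<psi>) = ?s \<phi> \<oplus>\<^bsub>C\<^esub> ?s \<psi>" if "\<phi> \<in> carrier ?G" "\<psi> \<in> carrier ?G" for \<phi> \<psi>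
      by (rule conv_algebra_eqI) (use \<phi>c that in \<open>simp_all add: group_algebra_def conv_algebra_simps(4) \<iota>_add\<close>)
    show "?s \<one>\<^bsub>?G\<^esub> = \<one>\<^bsub>C\<^esub>"
      by (rule conv_algebra_eqI) (simp_all add: group_algebra_def conv_algebra_simps(2))
    show "?s (\<phi> \<otimes>\<^bsub>?G\<^esub> \<psi>) = ?s \<phi> \<otimes>\<^bsub>C\<^esub> ?s \<psi>" if \<phi>: "\<phi> \<in> carrier ?G" and \<psi>: "\<psi> \<in> carrier ?G" for \<phi> \<psi>
    proof (rule conv_algebra_eqI)
      fix a assume a: "a \<in> carrier A"
      have bal: "balanced k A A (add_monoid k) (\<lambda>x y. \<phi> x \<otimes>\<^bsub>k\<^esub> \<psi> y)"
        using k.balanced_mult[unfolded kE, OF D[OF \<phi>] D[OF \<psi>]] .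
      have h: "\<iota> \<in> hom (add_monoid k) (add_monoid K)" by (simp add: hom_def \<iota>_add)
      have "?s (\<phi> \<otimes>\<^bsub>?G\<^esub> \<psi>) a = \<iota> (tensor_lift (add_monoid k) (\<lambda>x y. \<phi> x \<otimes>\<^bsub>k\<^esub> \<psi> y) (comul A a))"
        using a by (simp add: group_algebra_def)
      also have "\<dots> = tensor_lift (add_monoid K) (\<lambda>x y. \<iota> (\<phi> x \<otimes>\<^bsub>k\<^esub> \<psi> y)) (comul A a)"
        by (rule AA.lift_comp[OF k.comm_group_K comm_group_K bal h comul_closed[OF a]])
      also have "\<dots> = conv (?s \<phi>) (?s \<psi>) a"
        unfolding conv_def
        by (rule AA.lift_cong[OF comm_group_K balanced_mult[OF conv_algebraD(1)[OF restrict_hom[OF scalar_extension_hom[OF D[OF \<phi>]]]]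
              conv_algebraD(1)[OF restrict_hom[OF scalar_extension_hom[OF D[OF \<psi>]]]]] _ comul_closed[OF a]])
          (simp add: \<iota>_mult \<phi>c \<phi> \<psi>)
      finally show "?s (\<phi> \<otimes>\<^bsub>?G\<^esub> \<psi>) a = (?s \<phi> \<otimes>\<^bsub>C\<^esub> ?s \<psi>) a" using a by (simp add: conv_algebra_simps(1))
    qed (simp_all add: conv_algebra_simps(1))
  qed
  \<comment> \<open>\<open>extend\<close> looks only at values on \<open>carrier A\<close>, so
    restricting the functional to that set, as membership in the convolution algebra requires, does
    not change the result.\<close>
  have ext: "group_algebra_ext k K \<iota> A \<phi> = extend (?s \<phi>)" if "\<phi> \<in> carrier ?G" for \<phi>
    unfolding group_algebra_ext_eq
  proof (rule KG_eqI)
    note h = scalar_extension_hom[OF D[OF that]]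
    note h' = conv_algebraD(1)[OF restrict_hom[OF h]]
    show "extend (\<lambda>a. \<iota> (\<phi> a)) \<in> hom EA.T (add_monoid K)" "extend (?s \<phi>) \<in> hom EA.T (add_monoid K)"
      by (rule extend_hom[OF h], rule extend_hom[OF h'])
    show "extend (\<lambda>a. \<iota> (\<phi> a)) (pB c a) = extend (?s \<phi>) (pB c a)" if "c \<in> carrier K" "a \<in> carrier A" for c a
      using that by (simp add: extend_pure[OF h] extend_pure[OF h'])
  qed (simp_all add: extend_def)
  interpret G: ring ?G by (rule ring_group_algebra)
  have "(\<lambda>\<phi>. extend (?s \<phi>)) \<in> ring_hom ?G KG"
    using ring_hom_trans[OF s iso] by (simp add: comp_def)
  then show ?thesis
    by (auto simp: ring_hom_def Pi_iff ext)
qed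

end

section \<open>Point modules\<close>

lemma module_imp_left_module: "module R M \<Longrightarrow> left_module R M"
  by (intro left_module.intro left_module_axioms.intro)
    (auto simp: module_def module_axioms_def cring_def)

text \<open>Induction on the set of functionals: the kernel of one of them on U is separated by the
  others and hence finitely spanned, and if it is smaller than U, one vector x outside it completes
  the spanning set.\<close>

lemma finite_spanning_if_separated:
  assumes K: "field K" and V: "left_module K V" and "finite S"
    and hom: "\<And>s. s \<in> S \<Longrightarrow> \<mu> s \<in> lmod_hom K V (self_module K)"
    and "submodule U K V" and "\<And>u. \<lbrakk>u \<in> U; \<And>s. s \<in> S \<Longrightarrow> \<mu> s u = \<zero>\<^bsub>K\<^esub>\<rbrakk> \<Longrightarrow> u = \<zero>\<^bsub>V\<^esub>"
  shows "\<exists>F. finite F \<and> F \<subseteq> U \<and> (\<forall>W. submodule W K V \<and> F \<subseteq> W \<longrightarrow> U \<subseteq> W)"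
  using assms(3-)
proof (induction S arbitrary: U)
  case empty
  then have "U \<subseteq> {\<zero>\<^bsub>V\<^esub>}" by blast
  then have "\<forall>W. submodule W K V \<longrightarrow> U \<subseteq> W" using submodule_zero by blast
  then show ?case by (intro exI[of _ "{}"]) simp
next
  case (insert s S)
  interpret K: field K by fact
  interpret V: left_module K V by fact
  have s: "\<mu> s \<in> lmod_hom K V (self_module K)" using insert.prems(1) by simp
  define U0 where "U0 = {u \<in> U. \<mu> s u = \<zero>\<^bsub>K\<^esub>}"
  have U0: "submodule U0 K V"
    using submodule_kernel[OF s V left_module_self[OF K.ring_axioms] insert.prems(2)] by (simp add: U0_def)
  have "\<exists>F. finite F \<and> F \<subseteq> U0 \<and> (\<forall>W. submodule W K V \<and> F \<subseteq> W \<longrightarrow> U0 \<subseteq> W)"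
  proof (rule insert.IH[OF _ U0])
    show "\<mu> s' \<in> lmod_hom K V (self_module K)" if "s' \<in> S" for s' using insert.prems(1) that by simp
    show "u = \<zero>\<^bsub>V\<^esub>" if "u \<in> U0" "\<And>s'. s' \<in> S \<Longrightarrow> \<mu> s' u = \<zero>\<^bsub>K\<^esub>" for u
      using that insert.prems(3) by (auto simp: U0_def)
  qed
  then obtain F where F: "finite F" "F \<subseteq> U0"
    and span: "\<forall>W. submodule W K V \<and> F \<subseteq> W \<longrightarrow> U0 \<subseteq> W"
    by (elim exE conjE) (rule that)
  show ?case
  proof (cases "U0 = U")
    case True
    then show ?thesis using F span by (intro exI[of _ F]) simp
  next
    case False
    then obtain x where x: "x \<in> U" "\<mu> s x \<noteq> \<zero>\<^bsub>K\<^esub>" by (auto simp: U0_def)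
    note Uc = subsetD[OF submodule_subset[OF insert.prems(2)]]
    have sc: "\<mu> s u \<in> carrier K" if "u \<in> carrier V" for u using lmod_homD(1)[OF s that] by simp
    have unit: "\<mu> s x \<in> Units K" using sc[OF Uc[OF x(1)]] x(2) K.field_Units by blast
    have "U \<subseteq> W" if W: "submodule W K V" and FW: "insert x F \<subseteq> W" for W
    proof
      fix u assume u: "u \<in> U"
      \<comment> \<open>Chosen so that u - c x is annihilated by the functional at s and therefore
        falls under the induction hypothesis.\<close>
      define c where "c = \<mu> s u \<otimes>\<^bsub>K\<^esub> inv\<^bsub>K\<^esub> (\<mu> s x)"
      have c: "c \<in> carrier K" using unit sc[OF Uc[OF u]] by (simp add: c_def)
      have cx: "c \<odot>\<^bsub>V\<^esub> x \<in> carrier V" using V.lm_closed[OF c Uc[OF x(1)]] .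
      define u' where "u' = u \<oplus>\<^bsub>V\<^esub> \<ominus>\<^bsub>V\<^esub> (c \<odot>\<^bsub>V\<^esub> x)"
      have "\<mu> s (\<ominus>\<^bsub>V\<^esub> (c \<odot>\<^bsub>V\<^esub> x)) = \<ominus>\<^bsub>K\<^esub> (\<mu> s (c \<odot>\<^bsub>V\<^esub> x))"
        using lmod_hom_minus[OF s V.abelian_group_axioms _ cx] K.is_abelian_group by (simp add: self_module_def)
      also have "\<mu> s (c \<odot>\<^bsub>V\<^esub> x) = \<mu> s u"
        using lmod_homD(3)[OF s c Uc[OF x(1)]] unit sc[OF Uc[OF u]] sc[OF Uc[OF x(1)]]
        by (simp add: c_def K.m_assoc)
      finally have "\<mu> s u' = \<zero>\<^bsub>K\<^esub>"
        using lmod_homD(2)[OF s Uc[OF u] V.M.a_inv_closed[OF cx]] sc[OF Uc[OF u]] by (simp add: u'_def K.r_neg)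
      moreover have "u' \<in> U"
        unfolding u'_def
        by (intro submodule_add[OF insert.prems(2)] submodule_minus[OF insert.prems(2)]
            submodule.smult_closed[OF insert.prems(2)] u c x)
      ultimately have "u' \<in> W" using span[rule_format, of W] W FW by (auto simp: U0_def)
      moreover have "u = u' \<oplus>\<^bsub>V\<^esub> c \<odot>\<^bsub>V\<^esub> x"
        unfolding u'_def using Uc[OF u] cx by (simp add: V.M.a_assoc V.M.l_neg)
      ultimately show "u \<in> W" using submodule_add[OF W] submodule.smult_closed[OF W c, of x] FW by simp
    qed
    moreover have "finite (insert x F)" "insert x F \<subseteq> U" using F x(1) by (auto simp: U0_def)
    ultimately show ?thesis by (intro exI[of _ "insert x F"]) simp
  qed
qed

text \<open>The separating functionals are evaluations at 1 \<otimes> a for a in a finite generating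
  set of A. If all of them vanish at \<phi>, the kernel of \<open>descend \<phi>\<close> is a
  k-submodule containing these generators, so \<phi> is zero.\<close>

lemma (in base_extension) finite_spanning_KG:
  "\<exists>F. finite F \<and> F \<subseteq> carrier KG \<and> (\<forall>W. submodule W K KG \<and> F \<subseteq> W \<longrightarrow> carrier KG \<subseteq> W)"
proof -
  interpret KG: left_module K KG by (rule left_module_KG)
  obtain S where S: "finite S" "S \<subseteq> carrier A" and gen: "\<And>U. \<lbrakk>submodule U k A; S \<subseteq> U\<rbrakk> \<Longrightarrow> U = carrier A"
    using finite_dim unfolding fin_gen_def by blast
  have E: "left_module k E"
    by (intro left_module.intro left_module_axioms.intro base.ring_axioms abelian_E)
      (auto simp: \<iota>_add \<iota>_mult \<iota>_one K.l_distr K.r_distr K.m_assoc)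
  have A: "left_module k A" by (rule module_imp_left_module[OF module_A])
  note D = balancedD(1)[OF EA.balanced_pure, simplified]
  show ?thesis
  proof (rule finite_spanning_if_separated[OF K.field_axioms left_module_KG S(1), where \<mu> = "\<lambda>a \<phi>. \<phi> (pB \<one>\<^bsub>K\<^esub> a)"])
    show "(\<lambda>\<phi>. \<phi> (pB \<one>\<^bsub>K\<^esub> a)) \<in> lmod_hom K KG (self_module K)" if "a \<in> S" for a
      using KG_D(1) D S(2) that by (intro lmod_homI) (auto simp: KG_simps)
    show "submodule (carrier KG) K KG" by (rule KG.submodule_carrier)
    fix \<phi> assume \<phi>: "\<phi> \<in> carrier KG" and z: "\<And>a. a \<in> S \<Longrightarrow> \<phi> (pB \<one>\<^bsub>K\<^esub> a) = \<zero>\<^bsub>K\<^esub>"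
    interpret A: left_module k A by (rule A)
    have "submodule {a \<in> carrier A. descend \<phi> a = \<zero>\<^bsub>E\<^esub>} k A"
      by (rule submodule_kernel[OF descend_hom[OF \<phi>] A E A.submodule_carrier])
    then have "{a \<in> carrier A. descend \<phi> a = \<zero>\<^bsub>E\<^esub>} = carrier A"
      by (rule gen) (use S(2) z in \<open>auto simp: descend_def\<close>)
    then have "descend \<phi> a = \<zero>\<^bsub>K\<^esub>" if "a \<in> carrier A" for a using that by auto
    then show "\<phi> = \<zero>\<^bsub>KG\<^esub>"
      by (intro KG_eqI KG_hom \<phi> KG.M.zero_closed KG_D(4)) (simp add: KG_pure[OF \<phi>] KG_simps(4) D)
  qed
qed

text \<open>A multiple of t^q has zero constant term because q > 0. Hence the constant coefficient
  is well defined on cosets and the choice in \<open>residue_module\<close> is harmless.\<close>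

lemma trunc_poly_coset:
  assumes K: "field K" and q: "q > 0" and f: "f \<in> carrier (UP K)"
    and g: "g \<in> genideal (UP K) {monom (UP K) \<one>\<^bsub>K\<^esub> q} +>\<^bsub>UP K\<^esub> f"
  shows "g \<in> carrier (UP K)" "coeff (UP K) g 0 = coeff (UP K) f 0"
proof -
  interpret K: field K by fact
  interpret UP: UP_cring K "UP K" by (intro UP_cring.intro K.cring_axioms) simp
  have "g \<in> PIdl\<^bsub>UP K\<^esub> (monom (UP K) \<one>\<^bsub>K\<^esub> q) +>\<^bsub>UP K\<^esub> f"
    using g UP.P.cgenideal_eq_genideal[of "monom (UP K) \<one>\<^bsub>K\<^esub> q"] by simp
  then obtain x where x: "x \<in> carrier (UP K)" "g = x \<otimes>\<^bsub>UP K\<^esub> monom (UP K) \<one>\<^bsub>K\<^esub> q \<oplus>\<^bsub>UP K\<^esub> f"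
    by (auto simp: a_r_coset_def' cgenideal_def)
  then show "g \<in> carrier (UP K)" using f by simp
  have "coeff (UP K) (x \<otimes>\<^bsub>UP K\<^esub> monom (UP K) \<one>\<^bsub>K\<^esub> q) 0 = \<zero>\<^bsub>K\<^esub>"
    using x(1) q by (subst UP.coeff_mult) auto
  then show "coeff (UP K) g 0 = coeff (UP K) f 0"
    using x f by simp
qed

lemma trunc_poly_representative:
  assumes K: "field K" and q: "q > 0" and D: "D \<in> carrier (trunc_poly K q)"
  shows "(SOME g. g \<in> D) \<in> D" "(SOME g. g \<in> D) \<in> carrier (UP K)"
proof -
  interpret K: field K by fact
  interpret UP: UP_cring K "UP K" by (intro UP_cring.intro K.cring_axioms) simp
  interpret I: ideal "genideal (UP K) {monom (UP K) \<one>\<^bsub>K\<^esub> q}" "UP K" by (rule UP.P.genideal_ideal) simp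
  obtain f where f: "f \<in> carrier (UP K)" "D = genideal (UP K) {monom (UP K) \<one>\<^bsub>K\<^esub> q} +>\<^bsub>UP K\<^esub> f"
    using D by (auto simp: trunc_poly_def Let_def FactRing_def A_RCOSETS_def')
  have "f \<in> D" unfolding f(2) by (rule I.a_rcos_self[OF f(1)])
  then show "(SOME g. g \<in> D) \<in> D" using someI[of "\<lambda>g. g \<in> D" f] by simp
  then show "(SOME g. g \<in> D) \<in> carrier (UP K)"
    using trunc_poly_coset(1)[OF K q f(1)] f(2) by blast
qed

locale point_module_data = base_extension k A K \<iota>
  for k :: "('k, 'z) ring_scheme" and A :: "('k, 'a, 'y) hopf_scheme" and K :: "('l, 'w) ring_scheme"
    and \<iota> :: "'k \<Rightarrow> 'l" +
  fixes q :: nat and \<alpha> :: "(nat \<Rightarrow> 'l) set \<Rightarrow> (('l, 'a) tens \<Rightarrow> 'l)"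
  assumes q_pos: "q > 0" and \<alpha>: "\<alpha> \<in> alg_hom K (trunc_poly K q) KG"
begin

sublocale KG: ring KG by (rule ring_KG)

abbreviation "TP \<equiv> trunc_poly K q"
abbreviation "I \<equiv> genideal (UP K) {monom (UP K) \<one>\<^bsub>K\<^esub> q}"
abbreviation "L \<equiv> with_smult KG (\<lambda>r x. x \<otimes>\<^bsub>KG\<^esub> \<alpha> r)"
abbreviation "N \<equiv> residue_module K"

lemma residue_smult_closed:
  assumes "D \<in> carrier TP" "x \<in> carrier N"
  shows "D \<odot>\<^bsub>N\<^esub> x \<in> carrier N"
proof -
  interpret UP: UP_cring K "UP K" by (intro UP_cring.intro K.cring_axioms) simp
  show ?thesis
    using assms trunc_poly_representative(2)[OF K.field_axioms q_pos] by (simp add: residue_module_def)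
qed

lemma \<alpha>_closed: "r \<in> carrier TP \<Longrightarrow> \<alpha> r \<in> carrier KG"
  using \<alpha> ring_hom_closed[of \<alpha> TP KG r] by (simp add: alg_hom_def)

lemma residue_module_simps [simp]:
  "carrier N = carrier K" "ring.add N = ring.add K" "\<zero>\<^bsub>N\<^esub> = \<zero>\<^bsub>K\<^esub>"
  by (simp_all add: residue_module_def)

sublocale LN: tensor_pair TP L N
proof (intro tensor_pair.intro)
  show "abelian_group L" by (simp add: KG.is_abelian_group)
  show "abelian_group N" by (simp add: residue_module_def K.is_abelian_group)
  show "r \<odot>\<^bsub>L\<^esub> x \<in> carrier L" if "r \<in> carrier TP" "x \<in> carrier L" for r x
    using that \<alpha>_closed by simp
qed (rule residue_smult_closed)

text \<open>The witness is the coset of the constant polynomial c. Its right action on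
  \<open>KG\<close> and its action on \<open>N\<close> are both scaling by c, so the balancing
  relation over \<open>TP\<close> carries scalars of K across the tensor sign.\<close>

lemma scalar_in_TP:
  assumes c: "c \<in> carrier K"
  obtains r where "r \<in> carrier TP" "\<alpha> r = c \<odot>\<^bsub>KG\<^esub> \<one>\<^bsub>KG\<^esub>" "r \<odot>\<^bsub>N\<^esub> \<one>\<^bsub>K\<^esub> = c"
proof -
  interpret UP: UP_cring K "UP K" by (intro UP_cring.intro K.cring_axioms) simp
  interpret I: ideal I "UP K" by (rule UP.P.genideal_ideal) simp
  interpret Q: ring "UP K Quot I" by (rule I.quotient_is_ring)
  let ?r = "I +>\<^bsub>UP K\<^esub> monom (UP K) c 0"
  have m: "monom (UP K) c 0 \<in> carrier (UP K)" using c by simp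
  have rQ: "?r \<in> carrier (UP K Quot I)"
    using m by (auto simp: FactRing_def A_RCOSETS_def')
  have T: "carrier TP = carrier (UP K Quot I)" "\<one>\<^bsub>TP\<^esub> = \<one>\<^bsub>UP K Quot I\<^esub>"
    "c \<odot>\<^bsub>TP\<^esub> \<one>\<^bsub>TP\<^esub> = ?r"
    using rQ by (simp_all add: trunc_poly_def Let_def)
  have "\<alpha> \<in> ring_hom TP KG" "\<alpha> \<in> lmod_hom K TP KG" using \<alpha> by (simp_all add: alg_hom_def)
  then have "\<alpha> (c \<odot>\<^bsub>TP\<^esub> \<one>\<^bsub>TP\<^esub>) = c \<odot>\<^bsub>KG\<^esub> \<one>\<^bsub>KG\<^esub>"
    using c T(1,2) lmod_homD(3)[of \<alpha> K TP KG c "\<one>\<^bsub>TP\<^esub>"] ring_hom_one[of \<alpha> TP KG] by simp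
  moreover have "?r \<odot>\<^bsub>N\<^esub> \<one>\<^bsub>K\<^esub> = c"
  proof -
    have "(SOME g. g \<in> ?r) \<in> ?r"
      using trunc_poly_representative(1)[OF K.field_axioms q_pos] rQ T(1) by simp
    then have "coeff (UP K) (SOME g. g \<in> ?r) 0 = c"
      using trunc_poly_coset(2)[OF K.field_axioms q_pos m] c by simp
    then show ?thesis using c by (simp add: residue_module_def)
  qed
  ultimately show thesis using that[of ?r] rQ T by simp
qed

lemma LN_pure_balanced:
  "\<lbrakk>x \<in> carrier KG; c \<in> carrier K\<rbrakk> \<Longrightarrow> LN.p x c \<in> carrier LN.T"
  "\<lbrakk>x \<in> carrier KG; y \<in> carrier KG; c \<in> carrier K\<rbrakk> \<Longrightarrow> LN.p (x \<oplus>\<^bsub>KG\<^esub> y) c = LN.p x c \<otimes>\<^bsub>LN.T\<^esub> LN.p y c"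
  "\<lbrakk>x \<in> carrier KG; c \<in> carrier K; d \<in> carrier K\<rbrakk> \<Longrightarrow> LN.p x (c \<oplus>\<^bsub>K\<^esub> d) = LN.p x c \<otimes>\<^bsub>LN.T\<^esub> LN.p x d"
  "\<lbrakk>r \<in> carrier TP; x \<in> carrier KG; c \<in> carrier K\<rbrakk> \<Longrightarrow> LN.p (x \<otimes>\<^bsub>KG\<^esub> \<alpha> r) c = LN.p x (r \<odot>\<^bsub>N\<^esub> c)"
  using balancedD[OF LN.balanced_pure] by simp_all

section \<open>Commuting actions of \<open>KG\<close> and \<open>K\<close> on the induced
  module\<close>

definition act :: "(('l, 'a) tens \<Rightarrow> 'l) \<Rightarrow> (('l, 'a) tens \<Rightarrow> 'l, 'l) tens \<Rightarrow> (('l, 'a) tens \<Rightarrow> 'l, 'l) tens" where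
  "act g = tensor_lift LN.T (\<lambda>x c. LN.p (g \<otimes>\<^bsub>KG\<^esub> x) c)"

text \<open>Placing K on the right-hand factor makes it commute with left multiplication by
  \<open>KG\<close>. This action, rather than the \<open>TP\<close>-action built into
  \<open>tensor\<close>, provides the vector space structure.\<close>

definition scal :: "'l \<Rightarrow> (('l, 'a) tens \<Rightarrow> 'l, 'l) tens \<Rightarrow> (('l, 'a) tens \<Rightarrow> 'l, 'l) tens" where
  "scal d = tensor_lift LN.T (\<lambda>x c. LN.p x (d \<otimes>\<^bsub>K\<^esub> c))"

lemma act_balanced:
  assumes g: "g \<in> carrier KG"
  shows "balanced TP L N LN.T (\<lambda>x c. LN.p (g \<otimes>\<^bsub>KG\<^esub> x) c)"
  by (rule balancedI)
    (use LN_pure_balanced g \<alpha>_closed in \<open>simp_all add: KG.r_distr KG.m_assoc[symmetric]\<close>)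

lemma scal_balanced:
  assumes d: "d \<in> carrier K"
  shows "balanced TP L N LN.T (\<lambda>x c. LN.p x (d \<otimes>\<^bsub>K\<^esub> c))"
proof (rule balancedI)
  fix r x c assume r: "r \<in> carrier TP" and x: "x \<in> carrier L" and c: "c \<in> carrier N"
  interpret UP: UP_cring K "UP K" by (intro UP_cring.intro K.cring_axioms) simp
  \<comment> \<open>An element r of \<open>TP\<close> acts on \<open>N\<close> as multiplication by
    an element of K, the constant coefficient of a representative, and K is commutative.\<close>
  have "r \<odot>\<^bsub>N\<^esub> (d \<otimes>\<^bsub>K\<^esub> c) = d \<otimes>\<^bsub>K\<^esub> (r \<odot>\<^bsub>N\<^esub> c)"
    using d c trunc_poly_representative(2)[OF K.field_axioms q_pos r]
    by (simp add: residue_module_def K.m_lcomm)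
  then show "LN.p (r \<odot>\<^bsub>L\<^esub> x) (d \<otimes>\<^bsub>K\<^esub> c) = LN.p x (d \<otimes>\<^bsub>K\<^esub> (r \<odot>\<^bsub>N\<^esub> c))"
    using LN_pure_balanced(4)[OF r, of x "d \<otimes>\<^bsub>K\<^esub> c"] x c d by simp
qed (use LN_pure_balanced d in \<open>simp_all add: K.r_distr\<close>)

lemma act_pure: "\<lbrakk>g \<in> carrier KG; x \<in> carrier KG; c \<in> carrier K\<rbrakk> \<Longrightarrow> act g (LN.p x c) = LN.p (g \<otimes>\<^bsub>KG\<^esub> x) c"
  unfolding act_def using LN.lift_pure[OF LN.T.comm_group_axioms act_balanced] by simp

lemma scal_pure: "\<lbrakk>d \<in> carrier K; x \<in> carrier KG; c \<in> carrier K\<rbrakk> \<Longrightarrow> scal d (LN.p x c) = LN.p x (d \<otimes>\<^bsub>K\<^esub> c)"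
  unfolding scal_def using LN.lift_pure[OF LN.T.comm_group_axioms scal_balanced] by simp

lemma act_hom: "g \<in> carrier KG \<Longrightarrow> act g \<in> hom LN.T LN.T"
  unfolding act_def by (rule LN.lift_hom[OF LN.T.comm_group_axioms act_balanced])

lemma scal_hom: "d \<in> carrier K \<Longrightarrow> scal d \<in> hom LN.T LN.T"
  unfolding scal_def by (rule LN.lift_hom[OF LN.T.comm_group_axioms scal_balanced])

lemma LN_endo_eqI:
  assumes "f \<in> hom LN.T LN.T" "g \<in> hom LN.T LN.T" "u \<in> carrier LN.T"
    "\<And>x c. \<lbrakk>x \<in> carrier KG; c \<in> carrier K\<rbrakk> \<Longrightarrow> f (LN.p x c) = g (LN.p x c)"
  shows "f u = g u"
  by (rule LN.hom_eqI[OF assms(1,2) LN.T.is_group _ assms(3)]) (use assms(4) in simp)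

lemma LN_hom_comp: "\<lbrakk>f \<in> hom LN.T LN.T; g \<in> hom LN.T LN.T\<rbrakk> \<Longrightarrow> (\<lambda>u. g (f u)) \<in> hom LN.T LN.T"
  using hom_compose by (fastforce simp: comp_def)

lemma LN_hom_prod: "\<lbrakk>f \<in> hom LN.T LN.T; g \<in> hom LN.T LN.T\<rbrakk> \<Longrightarrow> (\<lambda>u. f u \<otimes>\<^bsub>LN.T\<^esub> g u) \<in> hom LN.T LN.T"
  by (simp add: hom_def Pi_iff LN.T.m_ac)

lemma LN_hom_id: "(\<lambda>u. u) \<in> hom LN.T LN.T"
  by (simp add: hom_def)

lemma act_add: "\<lbrakk>g \<in> carrier KG; h \<in> carrier KG; u \<in> carrier LN.T\<rbrakk> \<Longrightarrow> act (g \<oplus>\<^bsub>KG\<^esub> h) u = act g u \<otimes>\<^bsub>LN.T\<^esub> act h u"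
  by (rule LN_endo_eqI[OF act_hom LN_hom_prod[OF act_hom act_hom]])
    (simp_all add: act_pure KG.l_distr LN_pure_balanced)

lemma act_mult: "\<lbrakk>g \<in> carrier KG; h \<in> carrier KG; u \<in> carrier LN.T\<rbrakk> \<Longrightarrow> act (g \<otimes>\<^bsub>KG\<^esub> h) u = act g (act h u)"
  by (rule LN_endo_eqI[OF act_hom LN_hom_comp[OF act_hom act_hom]])
    (simp_all add: act_pure KG.m_assoc)

lemma act_one: "u \<in> carrier LN.T \<Longrightarrow> act \<one>\<^bsub>KG\<^esub> u = u"
  by (rule LN_endo_eqI[OF act_hom LN_hom_id]) (simp_all add: act_pure)

lemma scal_add: "\<lbrakk>c \<in> carrier K; d \<in> carrier K; u \<in> carrier LN.T\<rbrakk> \<Longrightarrow> scal (c \<oplus>\<^bsub>K\<^esub> d) u = scal c u \<otimes>\<^bsub>LN.T\<^esub> scal d u"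
  by (rule LN_endo_eqI[OF scal_hom LN_hom_prod[OF scal_hom scal_hom]])
    (simp_all add: scal_pure K.l_distr LN_pure_balanced)

lemma scal_mult: "\<lbrakk>c \<in> carrier K; d \<in> carrier K; u \<in> carrier LN.T\<rbrakk> \<Longrightarrow> scal (c \<otimes>\<^bsub>K\<^esub> d) u = scal c (scal d u)"
  by (rule LN_endo_eqI[OF scal_hom LN_hom_comp[OF scal_hom scal_hom]])
    (simp_all add: scal_pure K.m_assoc)

lemma scal_one: "u \<in> carrier LN.T \<Longrightarrow> scal \<one>\<^bsub>K\<^esub> u = u"
  by (rule LN_endo_eqI[OF scal_hom LN_hom_id]) (simp_all add: scal_pure)

lemma act_scal: "\<lbrakk>g \<in> carrier KG; d \<in> carrier K; u \<in> carrier LN.T\<rbrakk> \<Longrightarrow> act g (scal d u) = scal d (act g u)"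
  by (rule LN_endo_eqI[OF LN_hom_comp[OF scal_hom act_hom] LN_hom_comp[OF act_hom scal_hom]])
    (simp_all add: act_pure scal_pure)

section \<open>The point module as a finite dimensional bimodule\<close>

abbreviation "kG \<equiv> group_algebra k A"
abbreviation "PM \<equiv> point_module k q A K \<iota> \<alpha>"

lemma PM_simps:
  "carrier PM = carrier LN.T" "ring.add PM = monoid.mult LN.T" "\<zero>\<^bsub>PM\<^esub> = \<one>\<^bsub>LN.T\<^esub>"
  "\<phi> \<odot>\<^bsub>PM\<^esub> u = act (group_algebra_ext k K \<iota> A \<phi>) u"
  by (simp_all add: point_module_def induced_module_def Let_def act_def)

lemma abelian_PM: "abelian_group PM"
  unfolding abelian_group_iff_comm_group
  using comm_group_cong[of "add_monoid PM" LN.T] LN.T.comm_group_axioms by (simp add: PM_simps)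

lemma left_module_PM: "left_module kG PM"
proof -
  note hom = group_algebra_ext_ring_hom
  note cl = ring_hom_closed[OF hom]
  show ?thesis
    by (intro left_module.intro left_module_axioms.intro ring_group_algebra abelian_PM)
      (simp_all add: PM_simps cl hom_in_carrier[OF act_hom] ring_hom_add[OF hom] ring_hom_mult[OF hom]
        ring_hom_one[OF hom] act_add act_mult act_one hom_mult[OF act_hom])
qed

lemma left_module_scal: "left_module K (with_smult PM scal)"
  by (intro left_module.intro left_module_axioms.intro K.ring_axioms)
    (simp_all add: PM_simps abelian_PM hom_in_carrier[OF scal_hom] scal_add scal_mult scal_one hom_mult[OF scal_hom])

text \<open>With r the constant c in \<open>TP\<close>, the vector c x \<otimes> 1 equals x
  \<alpha>(r) \<otimes> 1, hence x \<otimes> r 1, which is x \<otimes> c. So the K-structure of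
  \<open>KG\<close> matches the one given by \<open>scal\<close>.\<close>

lemma smult_pure_one:
  assumes x: "x \<in> carrier KG" and c: "c \<in> carrier K"
  shows "LN.p (c \<odot>\<^bsub>KG\<^esub> x) \<one>\<^bsub>K\<^esub> = scal c (LN.p x \<one>\<^bsub>K\<^esub>)"
proof -
  obtain r where r: "r \<in> carrier TP" "\<alpha> r = c \<odot>\<^bsub>KG\<^esub> \<one>\<^bsub>KG\<^esub>" "r \<odot>\<^bsub>N\<^esub> \<one>\<^bsub>K\<^esub> = c"
    using scalar_in_TP[OF c] by blast
  have "c \<odot>\<^bsub>KG\<^esub> x = x \<otimes>\<^bsub>KG\<^esub> \<alpha> r"
    unfolding r(2) using KG_mult_smult[OF x KG.one_closed c] x by simp
  then show ?thesis using LN_pure_balanced(4)[OF r(1) x, of "\<one>\<^bsub>K\<^esub>"] r(3) x c by (simp add: scal_pure)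
qed

text \<open>If a subspace W contains the x \<otimes> 1 for x in a finite spanning set of
  \<open>KG\<close>, then by \<open>smult_pure_one\<close> the x with x \<otimes> 1 in W form a
  K-subspace of \<open>KG\<close>, hence all of it. Scaling gives every x \<otimes> c, and these
  generate the tensor group.\<close>

lemma fin_gen_scal: "fin_gen K (with_smult PM scal)"
proof -
  interpret V: left_module K "with_smult PM scal" by (rule left_module_scal)
  interpret KGm: left_module K KG by (rule left_module_KG)
  obtain F where F: "finite F" "F \<subseteq> carrier KG"
    and span: "\<forall>W. submodule W K KG \<and> F \<subseteq> W \<longrightarrow> carrier KG \<subseteq> W"
    using finite_spanning_KG by (elim exE conjE) (rule that)
  have "W = carrier (with_smult PM scal)"
    if W: "submodule W K (with_smult PM scal)" and FW: "(\<lambda>x. LN.p x \<one>\<^bsub>K\<^esub>) ` F \<subseteq> W" for W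
  proof
    note zero = submodule_zero[OF W, simplified PM_simps with_smult_simps]
      and add = submodule_add[OF W, simplified PM_simps with_smult_simps]
      and smult = submodule.smult_closed[OF W, simplified PM_simps with_smult_simps]
    have "submodule {x \<in> carrier KG. LN.p x \<one>\<^bsub>K\<^esub> \<in> W} K KG"
    proof (rule KGm.submodule_criterion)
      \<comment> \<open>The vector 0 \<otimes> 1 is rewritten as zero times itself, since what W is
        known to contain is the unit of \<open>LN.T\<close>.\<close>
      have "LN.p \<zero>\<^bsub>KG\<^esub> \<one>\<^bsub>K\<^esub> = scal \<zero>\<^bsub>K\<^esub> (LN.p \<zero>\<^bsub>KG\<^esub> \<one>\<^bsub>K\<^esub>)"
        using smult_pure_one[OF KG.zero_closed K.zero_closed] KGm.smult_l_null[OF KG.zero_closed] by simp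
      also have "\<dots> = \<one>\<^bsub>LN.T\<^esub>"
        using V.smult_l_null[of "LN.p \<zero>\<^bsub>KG\<^esub> \<one>\<^bsub>K\<^esub>"] by (simp add: PM_simps LN_pure_balanced(1))
      finally show "\<zero>\<^bsub>KG\<^esub> \<in> {x \<in> carrier KG. LN.p x \<one>\<^bsub>K\<^esub> \<in> W}" using zero by simp
    qed (use add smult KGm.lm_closed in \<open>auto simp: LN_pure_balanced(2) smult_pure_one\<close>)
    then have "carrier KG \<subseteq> {x \<in> carrier KG. LN.p x \<one>\<^bsub>K\<^esub> \<in> W}"
      by (rule span[rule_format, OF conjI]) (use F(2) FW in auto)
    then have one: "LN.p x \<one>\<^bsub>K\<^esub> \<in> W" if "x \<in> carrier KG" for x
      using that by blast
    show "carrier (with_smult PM scal) \<subseteq> W"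
    proof
      fix u assume "u \<in> carrier (with_smult PM scal)"
      then have "u \<in> carrier LN.T" by (simp add: PM_simps)
      then show "u \<in> W"
      proof (induction rule: LN.tensor_induct)
        case (pure x c)
        then show ?case using smult[OF _ one, of c x] by (simp add: scal_pure)
      next
        case (diff u v)
        have "inv\<^bsub>LN.T\<^esub> v = \<ominus>\<^bsub>with_smult PM scal\<^esub> v"
          by (simp add: a_inv_def m_inv_def PM_simps)
        then show ?case using diff add submodule_minus[OF W] by simp
      qed (rule zero)
    qed
  qed (rule submodule_subset[OF W])
  moreover have "(\<lambda>x. LN.p x \<one>\<^bsub>K\<^esub>) ` F \<subseteq> carrier (with_smult PM scal)"
    using F(2) by (auto simp: PM_simps LN_pure_balanced(1))
  ultimately show ?thesis unfolding fin_gen_def using F(1) by blast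
qed

sublocale PM: fd_bimodule kG PM K scal
proof (intro fd_bimodule.intro fd_bimodule_axioms.intro left_module_PM left_module_scal K.field_axioms fin_gen_scal)
  show "r \<odot>\<^bsub>PM\<^esub> scal c x = scal c (r \<odot>\<^bsub>PM\<^esub> x)"
    if "r \<in> carrier kG" "c \<in> carrier K" "x \<in> carrier PM" for r c x
    using that act_scal[OF ring_hom_closed[OF group_algebra_ext_ring_hom]] by (simp add: PM_simps)
qed

end

text \<open>The type \<open>'n\<close> of the modules compared is a free type variable, so the
  equality holds for modules on any type; \<open>in_AddI\<close> and \<open>in_ProdI\<close> account
  for index sets of any type.\<close>

theorem proposition3p7:
  fixes k :: "'k ring" and p :: nat and G :: "('k, 'a) hopf"
    and K :: "'l ring" and \<iota> :: "'k \<Rightarrow> 'l"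
    and \<alpha> :: "(nat \<Rightarrow> 'l) set \<Rightarrow> (('l, 'a) tens \<Rightarrow> 'l)"
  assumes "field k" and "has_characteristic k p" and "p > 0"
    and "finite_group_scheme k G"
    and "field K" and "\<iota> \<in> ring_hom k K"
    and "pi_point k p G K \<iota> \<alpha>"
  shows "endofinite (group_algebra k G) (point_module k p G K \<iota> \<alpha>)
    \<and> (Add (group_algebra k G) (point_module k p G K \<iota> \<alpha>) :: ('a \<Rightarrow> 'k, 'n) module set)
      = Prod (group_algebra k G) (point_module k p G K \<iota> \<alpha>)"
proof -
  have "\<alpha> \<in> alg_hom K (trunc_poly K p) (group_algebra K (base_change k K \<iota> G))"
    using assms(7) by (simp add: pi_point_def Let_def)
  then interpret point_module_data k G K \<iota> p \<alpha>
    using assms by (intro point_module_data.intro base_extension.intro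
        base_extension_axioms.intro point_module_data_axioms.intro)
  show ?thesis using PM.endofinite PM.Add_eq_Prod by blast
qed

end
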